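(* Let $G$ be an amenable countable discrete group acting continuously on a compact metrizable space $X$. Let $\Sigma=\{\sigma_i: G\to \mathrm{Sym}(d_i)\}_{i=1}^\infty$ be a sofic approximation sequence for $G$. Then the sofic topological entropy with respect to $\Sigma$ equals the classical topological entropy: $$h_\Sigma(X,G)=h_{\mathrm{top}}(X,G).$$
   Context: **Sofic approximation sequence.** $\mathrm{Sym}(d)$ is the permutation group of $\{1,\dots,d\}$. A sofic approximation sequence for a countable discrete group $G$ is a sequence of maps $\sigma_i: G\to\mathrm{Sym}(d_i)$, $s\mapsto\sigma_{i,s}$ (not necessarily homomorphisms), with $d_i\in\mathbb N$, $\lim_{i\to\infty} d_i=\infty$, such that $\lim_{i\to\infty}\frac1{d_i}|\{a:\sigma_{i,st}(a)=\sigma_{i,s}\sigma_{i,t}(a)\}|=1$ for all $s,t\in G$, and $\lim_{i\to\infty}\frac1{d_i}|\{a:\sigma_{i,s}(a)\ne\sigma_{i,t}(a)\}|=1$ for all distinct $s,t\in G$. **Separated sets.** For a pseudometric space $(Y,\rho)$ and $\varepsilon>0$, $N_\varepsilon(Y,\rho)$ is the maximal cardinality of a finite set $A\subseteq Y$ with $\rho(x,y)\ge\varepsilon$ for all distinct $x,y\in A$. **Sofic topological entropy.** Let $\alpha$ denote the action, and also the induced action on $C(X)$, $\alpha_s(f)(x)=f(s^{-1}x)$. For a map $\sigma:G\to\mathrm{Sym}(d)$ write also $\sigma_s$ for the automorphism $\sigma_s(f)(a)=f(\sigma_s^{-1}(a))$ of $\mathbb C^d=C(\{1,\dots,d\})$.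 On $\mathbb C^d$ put $\|f\|_2=(\frac1d\sum_{a=1}^d|f(a)|^2)^{1/2}$. Let $\mathcal S=\{p_n\}_{n\in\mathbb N}$ be a sequence in the unit ball of the real-valued continuous functions $C_{\mathbb R}(X)$. For unital homomorphisms $\varphi,\psi:C(X)\to\mathbb C^d$ (homomorphisms of $C^*$-algebras) set $\rho_{\mathcal S,2}(\varphi,\psi)=\sum_{n=1}^\infty 2^{-n}\|\varphi(p_n)-\psi(p_n)\|_2$ (the same formula is used for $\rho_{\mathcal S,2}(\varphi\circ\alpha_s,\sigma_s\circ\varphi)$). For a nonempty finite $F\subseteq G$ and $\delta>0$, let $\mathrm{Hom}(\mathcal S,F,\delta,\sigma)$ be the set of unital homomorphisms $\varphi:C(X)\to\mathbb C^d$ with $\rho_{\mathcal S,2}(\varphi\circ\alpha_s,\sigma_s\circ\varphi)<\delta$ for all $s\in F$. Define $$h_\Sigma(\mathcal S)=\sup_{\varepsilon>0}\ \inf_F\ \inf_{\delta>0}\ \limsup_{i\to\infty}\frac1{d_i}\log N_\varepsilon(\mathrm{Hom}(\mathcal S,F,\delta,\sigma_i),\rho_{\mathcal S,2}),$$ with $F$ ranging over nonempty finite subsets of $G$ and $\log 0=-\infty$. The sequence $\mathcal S$ is dynamically generating if it is not contained in any proper $G$-invariant unital $C^*$-subalgebra of $C(X)$. It is known that $h_\Sigma(\mathcal S)$ is the same for all dynamically generating $\mathcal S$; $h_\Sigma(X,G)$ is this common value. **Classical topological entropy.** For an open cover $\mathcal U$ of $X$, $N(\mathcal U)$ is the minimal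 cardinality of a subcover, and for nonempty finite $F\subseteq G$, $\mathcal U^F=\bigvee_{s\in F}s^{-1}\mathcal U$. For a finite open cover $\mathcal U$, $h_{\mathrm{top}}(\mathcal U)$ is the limit of $\frac1{|F|}\log N(\mathcal U^F)$ as $F$ becomes more and more left invariant: for every $\varepsilon>0$ there are a nonempty finite $K\subseteq G$ and $\delta>0$ such that this quantity is within $\varepsilon$ of the limit whenever $|KF\Delta F|\le\delta|F|$ (the limit is known to exist). Then $h_{\mathrm{top}}(X,G)=\sup_{\mathcal U}h_{\mathrm{top}}(\mathcal U)$ over all finite open covers $\mathcal U$. *)

theory Defs
  imports
    "HOL-Analysis.Analysis"
    "HOL-Library.Extended_Nat"
    "HOL-Algebra.Group_Action"
    "HOL-Algebra.Sym_Groups"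
begin

text \<open>Amenability of a discrete group: existence of a finitely additive, left invariant
  probability measure defined on all subsets of the group.\<close>

definition amenable :: "('g, 'b) monoid_scheme \<Rightarrow> bool" where
  "amenable G \<longleftrightarrow>
     (\<exists>\<mu> :: 'g set \<Rightarrow> real.
        (\<forall>A \<subseteq> carrier G. 0 \<le> \<mu> A) \<and> \<mu> (carrier G) = 1 \<and>
        (\<forall>A \<subseteq> carrier G. \<forall>B \<subseteq> carrier G. A \<inter> B = {} \<longrightarrow> \<mu> (A \<union> B) = \<mu> A + \<mu> B) \<and>
        (\<forall>s \<in> carrier G. \<forall>A \<subseteq> carrier G. \<mu> (s <#\<^bsub>G\<^esub> A) = \<mu> A))"

text \<open>As the acting group is discrete, continuity of the action means that every group element
  acts by a continuous map.\<close>

definition continuous_action ::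
    "('g, 'b) monoid_scheme \<Rightarrow> 'x topology \<Rightarrow> ('g \<Rightarrow> 'x \<Rightarrow> 'x) \<Rightarrow> bool" where
  "continuous_action G X \<alpha> \<longleftrightarrow>
     group_action G (topspace X) \<alpha> \<and> (\<forall>s \<in> carrier G. continuous_map X X (\<alpha> s))"

definition sofic_approximation ::
    "('g, 'b) monoid_scheme \<Rightarrow> (nat \<Rightarrow> nat) \<Rightarrow> (nat \<Rightarrow> 'g \<Rightarrow> nat \<Rightarrow> nat) \<Rightarrow> bool" where
  "sofic_approximation G d \<sigma> \<longleftrightarrow>
     (\<forall>i. \<sigma> i \<in> carrier G \<rightarrow> carrier (sym_group (d i))) \<and>
     filterlim d at_top sequentially \<and>
     (\<forall>s \<in> carrier G. \<forall>t \<in> carrier G.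
        (\<lambda>i. real (card {a \<in> {1..d i}. \<sigma> i (s \<otimes>\<^bsub>G\<^esub> t) a = \<sigma> i s (\<sigma> i t a)}) / real (d i))
          \<longlonglongrightarrow> 1) \<and>
     (\<forall>s \<in> carrier G. \<forall>t \<in> carrier G. s \<noteq> t \<longrightarrow>
        (\<lambda>i. real (card {a \<in> {1..d i}. \<sigma> i s a \<noteq> \<sigma> i t a}) / real (d i)) \<longlonglongrightarrow> 1)"

section \<open>The $C^*$-algebra of continuous functions\<close>

text \<open>Continuous functions on \<open>X\<close> are normalised (extensional) outside the carrier set of
  \<open>X\<close>, so that distinct elements of \<^term>\<open>C_fun X\<close> are distinct functions on \<open>X\<close>.\<close>

definition C_fun :: "'x topology \<Rightarrow> ('x \<Rightarrow> complex) set" where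
  "C_fun X = {f \<in> extensional (topspace X). continuous_map X euclidean f}"

definition C_star_subalgebra :: "'x topology \<Rightarrow> ('x \<Rightarrow> complex) set \<Rightarrow> bool" where
  "C_star_subalgebra X A \<longleftrightarrow>
     A \<subseteq> C_fun X \<and>
     (\<lambda>x \<in> topspace X. 1) \<in> A \<and>
     (\<forall>f \<in> A. \<forall>g \<in> A. (\<lambda>x \<in> topspace X. f x + g x) \<in> A) \<and>
     (\<forall>f \<in> A. \<forall>g \<in> A. (\<lambda>x \<in> topspace X. f x * g x) \<in> A) \<and>
     (\<forall>c. \<forall>f \<in> A. (\<lambda>x \<in> topspace X. c * f x) \<in> A) \<and>
     (\<forall>f \<in> A. (\<lambda>x \<in> topspace X. cnj (f x)) \<in> A) \<and>
     (\<forall>F. \<forall>f \<in> C_fun X. (\<forall>n. F n \<in> A) \<and> uniform_limit (topspace X) F f sequentially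
        \<longrightarrow> f \<in> A)"

text \<open>Unital $*$-homomorphisms from $C(X)$ to $C(Y)$.\<close>

definition unital_homs ::
    "'x topology \<Rightarrow> 'y topology \<Rightarrow> (('x \<Rightarrow> complex) \<Rightarrow> 'y \<Rightarrow> complex) set" where
  "unital_homs X Y =
     {\<phi> \<in> C_fun X \<rightarrow>\<^sub>E C_fun Y. \<forall>y \<in> topspace Y.
        \<phi> (\<lambda>x \<in> topspace X. 1) y = 1 \<and>
        (\<forall>f \<in> C_fun X. \<forall>g \<in> C_fun X. \<phi> (\<lambda>x \<in> topspace X. f x + g x) y = \<phi> f y + \<phi> g y) \<and>
        (\<forall>f \<in> C_fun X. \<forall>g \<in> C_fun X. \<phi> (\<lambda>x \<in> topspace X. f x * g x) y = \<phi> f y * \<phi> g y) \<and>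
        (\<forall>c. \<forall>f \<in> C_fun X. \<phi> (\<lambda>x \<in> topspace X. c * f x) y = c * \<phi> f y) \<and>
        (\<forall>f \<in> C_fun X. \<phi> (\<lambda>x \<in> topspace X. cnj (f x)) y = cnj (\<phi> f y))}"

definition induced_action ::
    "('g, 'b) monoid_scheme \<Rightarrow> 'x topology \<Rightarrow> ('g \<Rightarrow> 'x \<Rightarrow> 'x) \<Rightarrow> 'g \<Rightarrow>
       ('x \<Rightarrow> complex) \<Rightarrow> 'x \<Rightarrow> complex" where
  "induced_action G X \<alpha> s f = (\<lambda>x \<in> topspace X. f (\<alpha> (inv\<^bsub>G\<^esub> s) x))"

text \<open>The automorphism of $\mathbb C^d = C(\{1,\dots,d\})$ induced by a permutation.\<close>

definition perm_action :: "nat \<Rightarrow> (nat \<Rightarrow> nat) \<Rightarrow> (nat \<Rightarrow> complex) \<Rightarrow> nat \<Rightarrow> complex" where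
  "perm_action d p f = (\<lambda>a \<in> {1..d}. f (inv_into UNIV p a))"

section \<open>Sofic topological entropy\<close>

text \<open>The logarithm with $\log 0 = -\infty$.\<close>

definition elog :: "enat \<Rightarrow> ereal" where
  "elog n = (case n of enat k \<Rightarrow> if k = 0 then -\<infinity> else ereal (ln (real k)) | \<infinity> \<Rightarrow> \<infinity>)"

definition separation_number :: "'y set \<Rightarrow> ('y \<Rightarrow> 'y \<Rightarrow> real) \<Rightarrow> real \<Rightarrow> enat" where
  "separation_number Y \<rho> \<epsilon> =
     (SUP A \<in> {A. finite A \<and> A \<subseteq> Y \<and> (\<forall>x \<in> A. \<forall>y \<in> A. x \<noteq> y \<longrightarrow> \<epsilon> \<le> \<rho> x y)}. enat (card A))"

definition norm2 :: "nat \<Rightarrow> (nat \<Rightarrow> complex) \<Rightarrow> real" where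
  "norm2 d f = sqrt (1 / real d * (\<Sum>a = 1..d. (norm (f a))\<^sup>2))"

text \<open>Sequences $(p_n)_{n \ge 1}$ are indexed from 0 here: \<open>p n\<close> stands for $p_{n+1}$,
  which has weight $2^{-(n+1)}$.\<close>

definition rho2 ::
    "(nat \<Rightarrow> 'x \<Rightarrow> complex) \<Rightarrow> nat \<Rightarrow>
       (('x \<Rightarrow> complex) \<Rightarrow> nat \<Rightarrow> complex) \<Rightarrow> (('x \<Rightarrow> complex) \<Rightarrow> nat \<Rightarrow> complex) \<Rightarrow> real" where
  "rho2 p d \<phi> \<psi> = (\<Sum>n. (1/2) ^ Suc n * norm2 d (\<lambda>a. \<phi> (p n) a - \<psi> (p n) a))"

definition approx_homs ::
    "('g, 'b) monoid_scheme \<Rightarrow> 'x topology \<Rightarrow> ('g \<Rightarrow> 'x \<Rightarrow> 'x) \<Rightarrow> (nat \<Rightarrow> 'x \<Rightarrow> complex) \<Rightarrow>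
       'g set \<Rightarrow> real \<Rightarrow> nat \<Rightarrow> ('g \<Rightarrow> nat \<Rightarrow> nat) \<Rightarrow> (('x \<Rightarrow> complex) \<Rightarrow> nat \<Rightarrow> complex) set" where
  "approx_homs G X \<alpha> p F \<delta> d \<tau> =
     {\<phi> \<in> unital_homs X (discrete_topology {1..d}).
        \<forall>s \<in> F. rho2 p d (\<phi> \<circ> induced_action G X \<alpha> s) (perm_action d (\<tau> s) \<circ> \<phi>) < \<delta>}"

definition sofic_entropy_of ::
    "('g, 'b) monoid_scheme \<Rightarrow> 'x topology \<Rightarrow> ('g \<Rightarrow> 'x \<Rightarrow> 'x) \<Rightarrow>
       (nat \<Rightarrow> nat) \<Rightarrow> (nat \<Rightarrow> 'g \<Rightarrow> nat \<Rightarrow> nat) \<Rightarrow> (nat \<Rightarrow> 'x \<Rightarrow> complex) \<Rightarrow> ereal" where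
  "sofic_entropy_of G X \<alpha> d \<sigma> p =
     (SUP \<epsilon> \<in> {0<..}. INF F \<in> {F. finite F \<and> F \<noteq> {} \<and> F \<subseteq> carrier G}. INF \<delta> \<in> {0<..}.
        limsup (\<lambda>i. elog (separation_number (approx_homs G X \<alpha> p F \<delta> (d i) (\<sigma> i))
                            (rho2 p (d i)) \<epsilon>) / ereal (real (d i))))"

definition unit_ball_sequence :: "'x topology \<Rightarrow> (nat \<Rightarrow> 'x \<Rightarrow> complex) \<Rightarrow> bool" where
  "unit_ball_sequence X p \<longleftrightarrow>
     (\<forall>n. p n \<in> C_fun X \<and> (\<forall>x \<in> topspace X. p n x \<in> \<real> \<and> norm (p n x) \<le> 1))"

definition dynamically_generating ::
    "('g, 'b) monoid_scheme \<Rightarrow> 'x topology \<Rightarrow> ('g \<Rightarrow> 'x \<Rightarrow> 'x) \<Rightarrow>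
       (nat \<Rightarrow> 'x \<Rightarrow> complex) \<Rightarrow> bool" where
  "dynamically_generating G X \<alpha> p \<longleftrightarrow>
     \<not> (\<exists>A. C_star_subalgebra X A \<and> A \<noteq> C_fun X \<and>
            (\<forall>s \<in> carrier G. \<forall>f \<in> A. induced_action G X \<alpha> s f \<in> A) \<and>
            range p \<subseteq> A)"

text \<open>The common value of the entropies of all dynamically generating sequences:
  \<^const>\<open>the_elem\<close> picks the unique element of a one-element set.\<close>

definition sofic_entropy ::
    "('g, 'b) monoid_scheme \<Rightarrow> 'x topology \<Rightarrow> ('g \<Rightarrow> 'x \<Rightarrow> 'x) \<Rightarrow>
       (nat \<Rightarrow> nat) \<Rightarrow> (nat \<Rightarrow> 'g \<Rightarrow> nat \<Rightarrow> nat) \<Rightarrow> ereal" where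
  "sofic_entropy G X \<alpha> d \<sigma> =
     the_elem (sofic_entropy_of G X \<alpha> d \<sigma> `
       {p. unit_ball_sequence X p \<and> dynamically_generating G X \<alpha> p})"

section \<open>Classical topological entropy\<close>

definition open_cover :: "'x topology \<Rightarrow> 'x set set \<Rightarrow> bool" where
  "open_cover X \<U> \<longleftrightarrow> (\<forall>U \<in> \<U>. openin X U) \<and> \<Union>\<U> = topspace X"

definition cover_number :: "'x topology \<Rightarrow> 'x set set \<Rightarrow> nat" where
  "cover_number X \<U> =
     (LEAST n. \<exists>\<V> \<subseteq> \<U>. finite \<V> \<and> \<Union>\<V> = topspace X \<and> card \<V> = n)"

text \<open>The join $\bigvee_{s \in F} s^{-1} \mathcal U$.\<close>

definition cover_join ::
    "('g, 'b) monoid_scheme \<Rightarrow> ('g \<Rightarrow> 'x \<Rightarrow> 'x) \<Rightarrow> 'x set set \<Rightarrow> 'g set \<Rightarrow> 'x set set" where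
  "cover_join G \<alpha> \<U> F = {\<Inter>s \<in> F. \<alpha> (inv\<^bsub>G\<^esub> s) ` u s | u. u \<in> F \<rightarrow> \<U>}"

text \<open>\<open>f F\<close> tends to \<open>l\<close> as the nonempty finite set \<open>F\<close> becomes more and more left
  invariant. For finite \<open>l\<close> the neighbourhoods \<open>V\<close> amount to the usual condition of being within
  \<open>\<epsilon>\<close> of \<open>l\<close>; infinite \<open>l\<close> is needed for empty \<open>X\<close> only.\<close>

definition invariance_limit ::
    "('g, 'b) monoid_scheme \<Rightarrow> ('g set \<Rightarrow> ereal) \<Rightarrow> ereal \<Rightarrow> bool" where
  "invariance_limit G f l \<longleftrightarrow>
     (\<forall>V. open V \<and> l \<in> V \<longrightarrow>
        (\<exists>K \<delta>. finite K \<and> K \<noteq> {} \<and> K \<subseteq> carrier G \<and> 0 < (\<delta> :: real) \<and>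
          (\<forall>F. finite F \<and> F \<noteq> {} \<and> F \<subseteq> carrier G \<and>
               real (card (sym_diff (K <#>\<^bsub>G\<^esub> F) F)) \<le> \<delta> * real (card F) \<longrightarrow> f F \<in> V)))"

definition cover_entropy ::
    "('g, 'b) monoid_scheme \<Rightarrow> 'x topology \<Rightarrow> ('g \<Rightarrow> 'x \<Rightarrow> 'x) \<Rightarrow> 'x set set \<Rightarrow> ereal" where
  "cover_entropy G X \<alpha> \<U> =
     (THE l. invariance_limit G
        (\<lambda>F. elog (enat (cover_number X (cover_join G \<alpha> \<U> F))) / ereal (real (card F))) l)"

definition topological_entropy ::
    "('g, 'b) monoid_scheme \<Rightarrow> 'x topology \<Rightarrow> ('g \<Rightarrow> 'x \<Rightarrow> 'x) \<Rightarrow> ereal" where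
  "topological_entropy G X \<alpha> = (SUP \<U> \<in> {\<U>. finite \<U> \<and> open_cover X \<U>}. cover_entropy G X \<alpha> \<U>)"

end

theory Submission
  imports Defs
begin

text \<open>Every sufficiently good sofic model of an amenable group is, up to a small proportion of its
  points, tiled by translates of finitely many shapes \<open>T\<close>, each as invariant as desired; this is the
  Ornstein--Weiss quasi-tiling argument, run greedily from the most invariant shape downwards. A
  unital homomorphism into \<open>C({1..d})\<close> is a map \<open>\<xi>\<close> from \<open>{1..d}\<close> to \<open>X\<close>, and
  approximate equivariance says that on most tiles \<open>\<xi>\<close> is close to a piece \<open>s x\<close>
  (\<open>s \<in> T\<close>) of an orbit. Such pieces are described by the elements of a minimal subcover of
  \<open>\<U>\<^sup>T\<close>, so there are at most about \<open>exp (d * h)\<close> separated homomorphisms, with \<open>h\<close> the classical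
  entropy. Conversely, choosing orbit pieces freely on the tiles produces approximately equivariant
  maps, and a Hamming ball count shows that exponentially few of them are close to each other.
  A very invariant subset of the group is itself such a model, so the same tilings yield the
  existence of the limit that defines the classical entropy.\<close>

text \<open>Amenability is given by an invariant mean, so the Foelner sets that serve as shapes have
  to be extracted from it; Hall's theorem is the bridge. Shapes may overlap, but their claimed parts
  are disjoint and almost full. The sizes of all shapes therefore add up to at most
  \<open>card D / (1 - \<epsilon>)\<close>, and this is what turns a rate per element of a shape
  into a rate per point of the model. The delicate point of the lower bound is the order of the
  quantifiers: the separation scale is fixed before \<open>F\<close> and \<delta>, while the shapes
  depend on both. Patterns that differ on few tiles are closer than this scale, so no family of
  patterns is separated by construction; a maximal separated family is taken instead and shown to be
  large. Since \<open>sofic_entropy\<close> is defined through \<open>the_elem\<close>, computing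
  the entropy of each generating sequence does not suffice: one such sequence must be exhibited,
  which is done with Stone-Weierstrass. An empty \<open>X\<close>, where both entropies are
  \<open>- \<infinity>\<close>, is treated separately.\<close>

section \<open>Hall's theorem and Foelner sets\<close>

text \<open>Rado's argument: Zorn's lemma, applied to the set \<open>D\<close> of removed pairs, yields a minimal family
  that still satisfies Hall's condition, and submodularity of the cardinality forces the members of
  this family to be singletons.\<close>

theorem Hall_Rado:
  fixes A :: "'i \<Rightarrow> 'a set"
  assumes fin: "\<And>i. i \<in> I \<Longrightarrow> finite (A i)"
    and hall: "\<And>J. finite J \<Longrightarrow> J \<subseteq> I \<Longrightarrow> card J \<le> card (\<Union>(A ` J))"
  shows "\<exists>f. inj_on f I \<and> (\<forall>i\<in>I. f i \<in> A i)"
proof -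
  define B where "B D i = {a \<in> A i. (i, a) \<notin> D}" for D :: "('i \<times> 'a) set" and i
  define HC where "HC D \<longleftrightarrow> (\<forall>J. finite J \<and> J \<subseteq> I \<longrightarrow> card J \<le> card (\<Union>(B D ` J)))" for D
  let ?S = "{D. D \<subseteq> Sigma I A \<and> HC D}"
  have finB: "finite (\<Union>(B D ` J))" if "finite J" "J \<subseteq> I" for D J
    using that fin unfolding B_def by (intro finite_UN_I) auto
  have "{} \<in> ?S"
    using hall by (auto simp: HC_def B_def)
  moreover have "\<Union>C \<in> ?S" if C: "subset.chain ?S C" "C \<noteq> {}" for C
  proof -
    have "card J \<le> card (\<Union>(B (\<Union>C) ` J))" if J: "finite J" "J \<subseteq> I" for J
    proof -
      \<comment> \<open>Hall's condition for \<open>J\<close> depends only on the pairs in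
        \<open>Sigma J A\<close>. This set is finite, so its intersection with the union of the
        chain lies in a single member of the chain.\<close>
      have "finite (Sigma J A \<inter> \<Union>C)"
        using J fin by (intro finite_Int disjI1 finite_SigmaI) auto
      moreover have "subset.chain ?S C" by fact
      ultimately obtain D where D: "D \<in> C" "Sigma J A \<inter> \<Union>C \<subseteq> D"
        using finite_subset_Union_chain[of "Sigma J A \<inter> \<Union>C" C ?S] C(2) by auto
      have "HC D" using D(1) C(1) by (auto simp: subset.chain_def)
      have "B (\<Union>C) i = B D i" if "i \<in> J" for i
        using D that by (auto simp: B_def)
      then show ?thesis
        using \<open>HC D\<close> J unfolding HC_def by (metis (no_types, lifting) SUP_cong)
    qed
    then show ?thesis
      using C(1) by (auto simp: HC_def subset.chain_def)
  qed
  ultimately obtain D where D: "D \<in> ?S" and max: "\<And>D'. D' \<in> ?S \<Longrightarrow> D \<subseteq> D' \<Longrightarrow> D' = D"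
    using subset_Zorn_nonempty[of ?S] by (metis (lifting) empty_iff)
  have HCD: "card J \<le> card (\<Union>(B D ` J))" if "finite J" "J \<subseteq> I" for J
    using D that by (auto simp: HC_def)
  \<comment> \<open>By maximality of \<open>D\<close>, deleting one more pair \<open>(i, a)\<close>
    breaks Hall's condition, and only for a set that contains \<open>i\<close>. The witness
    \<open>J\<close> is this set without \<open>i\<close>, which turns the strict inequality into
    \<open>\<le>\<close>.\<close>
  have viol: "\<exists>J. finite J \<and> J \<subseteq> I \<and> i \<notin> J \<and> card (\<Union>(B D ` J) \<union> (B D i - {a})) \<le> card J"
    if i: "i \<in> I" "a \<in> B D i" for i a
  proof -
    have "insert (i, a) D \<notin> ?S"
      using max[of "insert (i, a) D"] i by (auto simp: B_def)
    then have "\<not> HC (insert (i, a) D)"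
      using D i by (auto simp: B_def)
    then obtain J where J: "finite J" "J \<subseteq> I" "card (\<Union>(B (insert (i,a) D) ` J)) < card J"
      unfolding HC_def by (auto simp: not_le)
    have eq: "B (insert (i,a) D) j = (if j = i then B D i - {a} else B D j)" for j
      by (auto simp: B_def)
    have "i \<in> J"
    proof (rule ccontr)
      assume "i \<notin> J"
      then have "\<Union>(B (insert (i,a) D) ` J) = \<Union>(B D ` J)"
        by (intro SUP_cong) (auto simp: eq)
      then show False using J HCD[of J] by simp
    qed
    have "\<Union>(B (insert (i,a) D) ` J) = \<Union>(B D ` (J - {i})) \<union> (B D i - {a})"
      using \<open>i \<in> J\<close> by (auto simp: eq split: if_splits)
    with J(3) have "card (\<Union>(B D ` (J - {i})) \<union> (B D i - {a})) < card J"
      by (simp only:)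
    also have "card J = Suc (card (J - {i}))"
      using J(1) \<open>i \<in> J\<close> by (rule card.remove)
    finally have "card (\<Union>(B D ` (J - {i})) \<union> (B D i - {a})) \<le> card (J - {i})"
      by (simp only: less_Suc_eq_le)
    then show ?thesis
      using J(1,2) by (intro exI[of _ "J - {i}"]) blast
  qed
  have single: "a = b" if i: "i \<in> I" and ab: "a \<in> B D i" "b \<in> B D i" for i a b
  proof (rule ccontr)
    assume "a \<noteq> b"
    obtain J1 where J1: "finite J1" "J1 \<subseteq> I" "i \<notin> J1"
      "card (\<Union>(B D ` J1) \<union> (B D i - {a})) \<le> card J1" using viol[OF i ab(1)] by blast
    obtain J2 where J2: "finite J2" "J2 \<subseteq> I" "i \<notin> J2"
      "card (\<Union>(B D ` J2) \<union> (B D i - {b})) \<le> card J2" using viol[OF i ab(2)] by blast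
    let ?P = "\<Union>(B D ` J1) \<union> (B D i - {a})" and ?Q = "\<Union>(B D ` J2) \<union> (B D i - {b})"
    have fPQ: "finite ?P" "finite ?Q"
      using finB[OF J1(1,2)] finB[OF J2(1,2)] finB[of "{i}"] i by auto
    \<comment> \<open>What one of the two sets leaves out of \<open>B D i\<close> the other
      contains, since \<open>a\<close> and \<open>b\<close> differ. So the union is large although
      both sets are small.\<close>
    have "?P \<union> ?Q = \<Union>(B D ` insert i (J1 \<union> J2))"
      using \<open>a \<noteq> b\<close> by auto
    then have "card (insert i (J1 \<union> J2)) \<le> card (?P \<union> ?Q)"
      using HCD[of "insert i (J1 \<union> J2)"] J1 J2 i by auto
    then have 1: "Suc (card (J1 \<union> J2)) \<le> card (?P \<union> ?Q)"
      using J1 J2 by auto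
    have "card (J1 \<inter> J2) \<le> card (\<Union>(B D ` (J1 \<inter> J2)))"
      using HCD[of "J1 \<inter> J2"] J1 by auto
    also have "\<dots> \<le> card (?P \<inter> ?Q)"
      using fPQ by (intro card_mono) auto
    finally have 2: "card (J1 \<inter> J2) \<le> card (?P \<inter> ?Q)" .
    have "card J1 + card J2 = card (J1 \<union> J2) + card (J1 \<inter> J2)"
      by (rule card_Un_Int[OF J1(1) J2(1)])
    moreover have "card ?P + card ?Q = card (?P \<union> ?Q) + card (?P \<inter> ?Q)"
      by (rule card_Un_Int[OF fPQ])
    ultimately show False using 1 2 J1(4) J2(4) by linarith
  qed
  have "\<exists>a. B D i = {a}" if "i \<in> I" for i
  proof -
    have "B D i \<noteq> {}" using HCD[of "{i}"] that by auto
    then show ?thesis using single[OF that] by blast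
  qed
  then obtain f where f: "\<And>i. i \<in> I \<Longrightarrow> B D i = {f i}" by metis
  have "inj_on f I"
  proof (rule inj_onI)
    fix i j assume ij: "i \<in> I" "j \<in> I" "f i = f j"
    then have "card {i, j} \<le> card (\<Union>(B D ` {i, j}))" by (intro HCD) auto
    then show "i = j" using f ij by (cases "i = j") auto
  qed
  moreover have "f i \<in> A i" if "i \<in> I" for i
    using f[OF that] by (auto simp: B_def)
  ultimately show ?thesis by blast
qed

section \<open>Foelner sets from an invariant mean\<close>

lemma finitely_additive_UN:
  fixes \<mu> :: "'g set \<Rightarrow> real"
  assumes add: "\<And>A B. A \<subseteq> \<Omega> \<Longrightarrow> B \<subseteq> \<Omega> \<Longrightarrow> A \<inter> B = {} \<Longrightarrow> \<mu> (A \<union> B) = \<mu> A + \<mu> B"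
    and fin: "finite I" and sub: "\<And>i. i \<in> I \<Longrightarrow> A i \<subseteq> \<Omega>" and disj: "disjoint_family_on A I"
  shows "\<mu> (\<Union>(A ` I)) = (\<Sum>i\<in>I. \<mu> (A i))"
  using fin sub disj
proof (induction I)
  case empty
  then show ?case using add[of "{}" "{}"] by simp
next
  case (insert i I)
  have "\<mu> (A i \<union> \<Union>(A ` I)) = \<mu> (A i) + \<mu> (\<Union>(A ` I))"
    using insert.prems insert.hyps by (intro add) (auto simp: disjoint_family_on_def)
  then show ?case
    using insert by (auto simp: disjoint_family_on_def)
qed

lemma finite_set_mult: "finite A \<Longrightarrow> finite B \<Longrightarrow> finite (A <#>\<^bsub>G\<^esub> B)"
  by (auto simp: set_mult_def)

text \<open>If every finite set at least doubled under \<open>Q\<close>, Hall's theorem would produce a paradoxical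
  decomposition, which an invariant mean forbids.\<close>

lemma amenable_not_doubling:
  assumes G: "group G" and am: "amenable G" and Q: "finite Q" "Q \<subseteq> carrier G"
  shows "\<exists>F. finite F \<and> F \<subseteq> carrier G \<and> card (Q <#>\<^bsub>G\<^esub> F) < 2 * card F"
proof (rule ccontr)
  interpret group G by fact
  assume neg: "\<not> ?thesis"
  obtain \<mu> :: "'a set \<Rightarrow> real" where \<mu>: "(\<forall>A \<subseteq> carrier G. 0 \<le> \<mu> A) \<and> \<mu> (carrier G) = 1 \<and>
        (\<forall>A \<subseteq> carrier G. \<forall>B \<subseteq> carrier G. A \<inter> B = {} \<longrightarrow> \<mu> (A \<union> B) = \<mu> A + \<mu> B) \<and>
        (\<forall>s \<in> carrier G. \<forall>A \<subseteq> carrier G. \<mu> (s <#\<^bsub>G\<^esub> A) = \<mu> A)"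
    using am unfolding amenable_def by (elim exE)
  have nonneg: "0 \<le> \<mu> A" if "A \<subseteq> carrier G" for A using \<mu> that by blast
  have one: "\<mu> (carrier G) = 1" using \<mu> by blast
  have add: "\<mu> (A \<union> B) = \<mu> A + \<mu> B" if "A \<subseteq> carrier G" "B \<subseteq> carrier G" "A \<inter> B = {}" for A B
    using \<mu> that by blast
  have inv: "\<mu> (s <#\<^bsub>G\<^esub> A) = \<mu> A" if "s \<in> carrier G" "A \<subseteq> carrier G" for s A
    using \<mu> that by blast
  \<comment> \<open>Two copies of every group element \<open>g\<close> compete for places in
    \<open>Q g\<close>. Doubling under \<open>Q\<close> yields Hall's condition for this family,
    hence an injective choice \<open>f\<close>.\<close>
  let ?I = "carrier G \<times> (UNIV :: bool set)"
  let ?A = "\<lambda>(g, b::bool). Q <#>\<^bsub>G\<^esub> {g}"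
  have "\<exists>f. inj_on f ?I \<and> (\<forall>i\<in>?I. f i \<in> ?A i)"
  proof (rule Hall_Rado)
    show "finite (?A i)" for i using Q by (cases i) (auto intro: finite_set_mult)
  next
    fix J assume J: "finite J" "J \<subseteq> ?I"
    have "card J \<le> card (fst ` J \<times> (UNIV::bool set))"
      using J(1) by (intro card_mono finite_cartesian_product finite_imageI subsetI)
        (auto simp: mem_Times_iff)
    also have "\<dots> = 2 * card (fst ` J)"
      by (simp add: card_cartesian_product)
    also have "\<dots> \<le> card (Q <#>\<^bsub>G\<^esub> (fst ` J))"
    proof -
      have "finite (fst ` J)" "fst ` J \<subseteq> carrier G" using J by auto
      then show ?thesis using neg by (meson not_less)
    qed
    also have "Q <#>\<^bsub>G\<^esub> (fst ` J) = \<Union>(?A ` J)"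
      by (force simp: set_mult_def)
    finally show "card J \<le> card (\<Union>(?A ` J))" .
  qed
  then obtain f where f: "inj_on f ?I" "\<And>i. i \<in> ?I \<Longrightarrow> f i \<in> ?A i" by blast
  \<comment> \<open>\<open>P (k, b)\<close> collects the \<open>g\<close> whose copy
    \<open>b\<close> is placed at \<open>k g\<close>. For fixed \<open>b\<close> these sets
    partition the group, so their measures add up to 1.\<close>
  define P where "P = (\<lambda>(k, b::bool). {g \<in> carrier G. f (g, b) = k \<otimes>\<^bsub>G\<^esub> g})"
  have Psub: "P i \<subseteq> carrier G" for i by (cases i) (auto simp: P_def)
  have Pb: "(\<Sum>k\<in>Q. \<mu> (P (k, b))) = 1" for b
  proof -
    have "(\<Union>k\<in>Q. P (k, b)) = carrier G"
      using f(2) by (force simp: P_def set_mult_def)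
    moreover have "disjoint_family_on (\<lambda>k. P (k, b)) Q"
      unfolding disjoint_family_on_def
    proof (intro ballI impI, rule ccontr)
      fix k l assume kl: "k \<in> Q" "l \<in> Q" "k \<noteq> l" "P (k, b) \<inter> P (l, b) \<noteq> {}"
      then obtain g where "g \<in> carrier G" "k \<otimes>\<^bsub>G\<^esub> g = l \<otimes>\<^bsub>G\<^esub> g"
        unfolding P_def by auto (metis sym)
      then show False using kl Q by (metis right_cancel subsetD)
    qed
    ultimately show ?thesis
      using finitely_additive_UN[of "carrier G" \<mu> Q "\<lambda>k. P (k, b)"] add Q(1) Psub one by auto
  qed
  \<comment> \<open>Injectivity of \<open>f\<close> makes the translates \<open>R\<close> of the
    pieces of both partitions disjoint inside one copy of the group, although their measures add up
    to 2.\<close>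
  define R where "R i = fst i <#\<^bsub>G\<^esub> P i" for i
  have Rsub: "R i \<subseteq> carrier G" if "i \<in> Q \<times> UNIV" for i
    using that Q Psub[of i] unfolding R_def l_coset_def
    by (auto intro!: m_closed dest: subsetD)
  have Rf: "\<exists>g\<in>carrier G. x = f (g, snd i) \<and> f (g, snd i) = fst i \<otimes>\<^bsub>G\<^esub> g" if "x \<in> R i" for x i
    using that by (cases i) (auto simp: R_def l_coset_def P_def, metis)
  have "disjoint_family_on R (Q \<times> UNIV)"
    unfolding disjoint_family_on_def
  proof (intro ballI impI, rule ccontr)
    fix i j assume ij: "i \<in> Q \<times> (UNIV::bool set)" "j \<in> Q \<times> (UNIV::bool set)" "i \<noteq> j" "R i \<inter> R j \<noteq> {}"
    then obtain x where x: "x \<in> R i" "x \<in> R j" by blast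
    obtain g where g: "g \<in> carrier G" "x = f (g, snd i)" "f (g, snd i) = fst i \<otimes>\<^bsub>G\<^esub> g"
      using Rf[OF x(1)] by blast
    obtain h where h: "h \<in> carrier G" "x = f (h, snd j)" "f (h, snd j) = fst j \<otimes>\<^bsub>G\<^esub> h"
      using Rf[OF x(2)] by blast
    have "(g, snd i) = (h, snd j)"
      using g(1,2) h(1,2) by (intro inj_onD[OF f(1)]) simp_all
    then have eq: "g = h" "snd i = snd j" by simp_all
    have "fst i \<otimes>\<^bsub>G\<^esub> g = fst j \<otimes>\<^bsub>G\<^esub> g"
      using g(2,3) h(2,3) unfolding eq by (simp only:)
    moreover have "fst i \<in> carrier G" "fst j \<in> carrier G"
      using ij(1,2) Q(2) by auto
    ultimately have "fst i = fst j" using g(1) by simp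
    then show False using eq(2) ij(3) by (simp add: prod_eq_iff)
  qed
  then have "(\<Sum>i\<in>Q \<times> UNIV. \<mu> (R i)) = \<mu> (\<Union>(R ` (Q \<times> UNIV)))"
    using finitely_additive_UN[of "carrier G" \<mu> "Q \<times> UNIV" R] add Q(1) Rsub by auto
  also have "\<dots> \<le> \<mu> (\<Union>(R ` (Q \<times> UNIV))) + \<mu> (carrier G - \<Union>(R ` (Q \<times> UNIV)))"
    using nonneg by simp
  also have "\<dots> = \<mu> (\<Union>(R ` (Q \<times> UNIV)) \<union> (carrier G - \<Union>(R ` (Q \<times> UNIV))))"
    using Rsub by (intro add[symmetric]) blast+
  also have "\<Union>(R ` (Q \<times> UNIV)) \<union> (carrier G - \<Union>(R ` (Q \<times> UNIV))) = carrier G"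
    using Rsub by blast
  finally have "(\<Sum>i\<in>Q \<times> UNIV. \<mu> (R i)) \<le> 1" using one by simp
  moreover have "(\<Sum>i\<in>Q \<times> UNIV. \<mu> (R i)) = (\<Sum>i\<in>Q \<times> (UNIV::bool set). \<mu> (P i))"
    using Q Psub by (intro sum.cong) (auto simp: R_def inv)
  moreover have "\<dots> = (\<Sum>b\<in>(UNIV::bool set). \<Sum>k\<in>Q. \<mu> (P (k, b)))"
    by (subst sum.swap) (simp add: sum.cartesian_product)
  ultimately show False using Pb by (simp add: UNIV_bool)
qed

text \<open>If no finite set were almost invariant under \<open>K\<close>, adding the unit to
  \<open>K\<close> would make every finite set grow by the factor \<open>1 + \<delta>\<close>. The
  \<open>n\<close>-fold product of this set would then expand by \<open>(1 + \<delta>) ^ n\<close>,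
  which exceeds 2 for large \<open>n\<close>.\<close>

theorem amenable_Folner:
  assumes G: "group G" and am: "amenable G" and K: "finite K" "K \<subseteq> carrier G" and \<delta>: "0 < \<delta>"
  shows "\<exists>F. finite F \<and> F \<noteq> {} \<and> F \<subseteq> carrier G \<and> real (card ((K <#>\<^bsub>G\<^esub> F) - F)) \<le> \<delta> * real (card F)"
proof (rule ccontr)
  interpret group G by fact
  assume neg: "\<not> ?thesis"
  define K' where "K' = insert \<one>\<^bsub>G\<^esub> K"
  have K': "finite K'" "K' \<subseteq> carrier G" using K by (auto simp: K'_def)
  have grow: "(1 + \<delta>) * card F \<le> card (K' <#>\<^bsub>G\<^esub> F)" if F: "finite F" "F \<subseteq> carrier G" for F
  proof (cases "F = {}")
    case False
    have "K' <#>\<^bsub>G\<^esub> F = F \<union> ((K <#>\<^bsub>G\<^esub> F) - F)"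
      using F by (force simp: K'_def set_mult_def subset_iff)
    also have "card \<dots> = card F + card ((K <#>\<^bsub>G\<^esub> F) - F)"
      using F K by (intro card_Un_disjoint finite_Diff finite_set_mult) auto
    finally have "card (K' <#>\<^bsub>G\<^esub> F) = card F + card ((K <#>\<^bsub>G\<^esub> F) - F)" .
    moreover have "\<delta> * card F < card ((K <#>\<^bsub>G\<^esub> F) - F)"
      using neg F False by (auto simp: not_le)
    ultimately show ?thesis by (simp add: algebra_simps)
  qed auto
  have iter: "\<exists>Q. finite Q \<and> Q \<subseteq> carrier G \<and> (\<forall>F. finite F \<and> F \<subseteq> carrier G \<longrightarrow> (1 + \<delta>) ^ n * card F \<le> card (Q <#>\<^bsub>G\<^esub> F))" for n
  proof (induction n)
    case 0
    have "{\<one>\<^bsub>G\<^esub>} <#>\<^bsub>G\<^esub> F = F" if "F \<subseteq> carrier G" for F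
      using that by (force simp: set_mult_def subset_iff)
    then show ?case by (intro exI[of _ "{\<one>\<^bsub>G\<^esub>}"]) auto
  next
    case (Suc n)
    then obtain Q where Q: "finite Q" "Q \<subseteq> carrier G"
      "\<And>F. finite F \<Longrightarrow> F \<subseteq> carrier G \<Longrightarrow> (1 + \<delta>) ^ n * card F \<le> card (Q <#>\<^bsub>G\<^esub> F)" by blast
    have "(1 + \<delta>) ^ Suc n * card F \<le> card ((K' <#>\<^bsub>G\<^esub> Q) <#>\<^bsub>G\<^esub> F)" if F: "finite F" "F \<subseteq> carrier G" for F
    proof -
      have "(1 + \<delta>) ^ Suc n * card F \<le> (1 + \<delta>) * card (Q <#>\<^bsub>G\<^esub> F)"
        using Q(3)[OF F] \<delta> by (simp add: mult.assoc)
      also have "\<dots> \<le> card (K' <#>\<^bsub>G\<^esub> (Q <#>\<^bsub>G\<^esub> F))"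
        using Q F by (intro grow finite_set_mult set_mult_closed) auto
      finally show ?thesis using set_mult_assoc K' Q F by simp
    qed
    then show ?case
      using finite_set_mult[OF K'(1) Q(1)] set_mult_closed[OF K'(2) Q(2)]
      by (intro exI[of _ "K' <#>\<^bsub>G\<^esub> Q"]) blast
  qed
  obtain n where n: "2 < (1 + \<delta>) ^ n"
    using real_arch_pow[of "1 + \<delta>" 2] \<delta> by auto
  obtain Q where Q: "finite Q" "Q \<subseteq> carrier G"
    "\<And>F. finite F \<Longrightarrow> F \<subseteq> carrier G \<Longrightarrow> (1 + \<delta>) ^ n * card F \<le> card (Q <#>\<^bsub>G\<^esub> F)"
    using iter[of n] by blast
  obtain F where F: "finite F" "F \<subseteq> carrier G" "card (Q <#>\<^bsub>G\<^esub> F) < 2 * card F"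
    using amenable_not_doubling[OF G am Q(1,2)] by blast
  have "2 * real (card F) \<le> (1 + \<delta>) ^ n * card F"
    using n by (intro mult_right_mono) auto
  also have "\<dots> \<le> card (Q <#>\<^bsub>G\<^esub> F)" using Q(3) F by blast
  finally show False using F(3) by linarith
qed

section \<open>The filter of increasingly invariant finite sets\<close>

definition invariant_sets :: "('g, 'b) monoid_scheme \<Rightarrow> 'g set \<Rightarrow> real \<Rightarrow> 'g set set" where
  "invariant_sets G K \<delta> = {F. finite F \<and> F \<noteq> {} \<and> F \<subseteq> carrier G \<and>
     real (card (sym_diff (K <#>\<^bsub>G\<^esub> F) F)) \<le> \<delta> * real (card F)}"

text \<open>Turns the limit in \<open>invariance_limit\<close> into convergence along a filter, so
  that the general theory of limits and the notion \<open>frequently\<close> become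
  available.\<close>

definition folner :: "('g, 'b) monoid_scheme \<Rightarrow> 'g set filter" where
  "folner G = (INF (K, \<delta>) \<in> {(K, \<delta>). finite K \<and> K \<noteq> {} \<and> K \<subseteq> carrier G \<and> 0 < \<delta>}.
     principal (invariant_sets G K \<delta>))"

text \<open>A translate of \<open>F\<close> lies in the product, so the product has at least as many
  elements as \<open>F\<close>. Hence the part of \<open>F\<close> outside the product is no larger
  than the part of the product outside \<open>F\<close>, and the one-sided defect controls the
  symmetric one.\<close>

lemma card_sym_diff_le_set_mult:
  assumes "group G" "finite K" "K \<noteq> {}" "K \<subseteq> carrier G" "finite F" "F \<subseteq> carrier G"
  shows "card (sym_diff (K <#>\<^bsub>G\<^esub> F) F) \<le> 2 * card ((K <#>\<^bsub>G\<^esub> F) - F)"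
proof -
  interpret group G by fact
  obtain k where k: "k \<in> K" using assms by auto
  have "card F = card ((\<lambda>x. k \<otimes>\<^bsub>G\<^esub> x) ` F)"
    using assms k by (intro card_image[symmetric] inj_onI) (metis Units_eq Units_l_cancel subsetD)
  also have "\<dots> \<le> card (K <#>\<^bsub>G\<^esub> F)"
    using assms k by (intro card_mono finite_set_mult) (auto simp: set_mult_def)
  finally have "card F \<le> card (K <#>\<^bsub>G\<^esub> F)" .
  moreover have "card (K <#>\<^bsub>G\<^esub> F) = card ((K <#>\<^bsub>G\<^esub> F) - F) + card ((K <#>\<^bsub>G\<^esub> F) \<inter> F)"
    using assms finite_set_mult[of K F G] by (metis Int_commute add.commute card_Int_Diff)
  moreover have "card F = card (F - (K <#>\<^bsub>G\<^esub> F)) + card ((K <#>\<^bsub>G\<^esub> F) \<inter> F)"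
    using assms by (metis Int_commute add.commute card_Int_Diff)
  moreover have "card (sym_diff (K <#>\<^bsub>G\<^esub> F) F) \<le> card ((K <#>\<^bsub>G\<^esub> F) - F) + card (F - (K <#>\<^bsub>G\<^esub> F))"
    by (rule card_Un_le)
  ultimately show ?thesis by linarith
qed

text \<open>Symmetric differences are not monotone in \<open>K\<close>, but one-sided defects are;
  passing through them costs the factor 2.\<close>

lemma invariant_sets_mono:
  assumes G: "group G" and K: "finite K" "K \<noteq> {}" "K \<subseteq> K'" "K' \<subseteq> carrier G" "finite K'" and \<delta>: "2 * \<delta>' \<le> \<delta>"
  shows "invariant_sets G K' \<delta>' \<subseteq> invariant_sets G K \<delta>"
proof
  fix F assume "F \<in> invariant_sets G K' \<delta>'"
  then have F: "finite F" "F \<noteq> {}" "F \<subseteq> carrier G"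
    "real (card (sym_diff (K' <#>\<^bsub>G\<^esub> F) F)) \<le> \<delta>' * real (card F)"
    by (auto simp: invariant_sets_def)
  have "card ((K <#>\<^bsub>G\<^esub> F) - F) \<le> card (sym_diff (K' <#>\<^bsub>G\<^esub> F) F)"
    using K F mono_set_mult[OF K(3), of F F G] by (intro card_mono) (auto intro: finite_set_mult)
  moreover have "card (sym_diff (K <#>\<^bsub>G\<^esub> F) F) \<le> 2 * card ((K <#>\<^bsub>G\<^esub> F) - F)"
    using K F by (intro card_sym_diff_le_set_mult[OF G]) auto
  ultimately have "real (card (sym_diff (K <#>\<^bsub>G\<^esub> F) F)) \<le> 2 * (\<delta>' * real (card F))"
    using F(4) by linarith
  also have "\<dots> \<le> \<delta> * real (card F)"
    using mult_right_mono[OF \<delta>, of "real (card F)"] by simp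
  finally show "F \<in> invariant_sets G K \<delta>" using F by (auto simp: invariant_sets_def)
qed

lemma eventually_folner:
  assumes G: "group G"
  shows "eventually P (folner G) \<longleftrightarrow>
    (\<exists>K \<delta>. finite K \<and> K \<noteq> {} \<and> K \<subseteq> carrier G \<and> 0 < \<delta> \<and> (\<forall>F \<in> invariant_sets G K \<delta>. P F))"
proof -
  let ?B = "{(K, \<delta>). finite K \<and> K \<noteq> {} \<and> K \<subseteq> carrier G \<and> (0::real) < \<delta>}"
  have folner: "folner G = (INF b\<in>?B. principal (invariant_sets G (fst b) (snd b)))"
    unfolding folner_def by (simp add: case_prod_unfold)
  have "eventually P (folner G) \<longleftrightarrow>
    (\<exists>b\<in>?B. eventually P (principal (invariant_sets G (fst b) (snd b))))"
    unfolding folner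
  proof (rule eventually_INF_base)
    interpret group G by fact
    have "({\<one>\<^bsub>G\<^esub>}, 1) \<in> ?B" by auto
    then show "?B \<noteq> {}" by blast
    fix a b assume "a \<in> ?B" "b \<in> ?B"
    then obtain K L \<delta> \<eta> where ab: "a = (K, \<delta>)" "b = (L, \<eta>)" "finite K" "K \<noteq> {}" "K \<subseteq> carrier G" "0 < \<delta>"
        "finite L" "L \<noteq> {}" "L \<subseteq> carrier G" "0 < \<eta>" by auto
    show "\<exists>x\<in>?B. principal (invariant_sets G (fst x) (snd x)) \<le>
        inf (principal (invariant_sets G (fst a) (snd a))) (principal (invariant_sets G (fst b) (snd b)))"
      using ab invariant_sets_mono[OF G, of K "K \<union> L" "min \<delta> \<eta> / 2" \<delta>]
        invariant_sets_mono[OF G, of L "K \<union> L" "min \<delta> \<eta> / 2" \<eta>]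
      by (intro bexI[of _ "(K \<union> L, min \<delta> \<eta> / 2)"]) auto
  qed
  then show ?thesis by (auto simp: eventually_principal)
qed

text \<open>The point at which Foelner sets enter the limits: it makes them unique and allows
  \<open>eventually\<close> to be weakened to \<open>frequently\<close>.\<close>

lemma folner_nonbot:
  assumes G: "group G" and am: "amenable G"
  shows "folner G \<noteq> bot"
proof
  assume "folner G = bot"
  then have "eventually (\<lambda>F. False) (folner G)" by simp
  then obtain K \<delta> where K: "finite K" "K \<noteq> {}" "K \<subseteq> carrier G" "0 < \<delta>" "invariant_sets G K \<delta> = {}"
    unfolding eventually_folner[OF G] by blast
  obtain F where F: "finite F" "F \<noteq> {}" "F \<subseteq> carrier G"
      "real (card ((K <#>\<^bsub>G\<^esub> F) - F)) \<le> \<delta> / 2 * real (card F)"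
    using amenable_Folner[OF G am K(1,3), of "\<delta>/2"] K(4) by auto
  then have "F \<in> invariant_sets G K \<delta>"
    using card_sym_diff_le_set_mult[OF G K(1-3) F(1,3)] by (auto simp: invariant_sets_def)
  then show False using K by auto
qed

lemma eventually_folner_basic:
  assumes G: "group G"
  shows "eventually (\<lambda>F. finite F \<and> F \<noteq> {} \<and> F \<subseteq> carrier G) (folner G)"
proof -
  interpret group G by fact
  show ?thesis
    unfolding eventually_folner[OF G]
    by (intro exI[of _ "{\<one>\<^bsub>G\<^esub>}"] exI[of _ 1]) (auto simp: invariant_sets_def)
qed

lemma eventually_folner_invariant:
  assumes G: "group G" and K: "finite K" "K \<subseteq> carrier G" and \<delta>: "0 < \<delta>"
  shows "eventually (\<lambda>F. real (card ((K <#>\<^bsub>G\<^esub> F) - F)) \<le> \<delta> * real (card F)) (folner G)"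
proof (cases "K = {}")
  case True
  then show ?thesis using \<delta> by (simp add: set_mult_def)
next
  case False
  have "real (card ((K <#>\<^bsub>G\<^esub> F) - F)) \<le> \<delta> * real (card F)" if "F \<in> invariant_sets G K \<delta>" for F
  proof -
    have "card ((K <#>\<^bsub>G\<^esub> F) - F) \<le> card (sym_diff (K <#>\<^bsub>G\<^esub> F) F)"
      using that K by (intro card_mono) (auto simp: invariant_sets_def intro: finite_set_mult)
    then show ?thesis using that by (auto simp: invariant_sets_def)
  qed
  then show ?thesis
    unfolding eventually_folner[OF G] using K \<delta> False by blast
qed

lemma invariance_limit_iff_tendsto:
  assumes G: "group G"
  shows "invariance_limit G f l \<longleftrightarrow> (f \<longlongrightarrow> l) (folner G)"
  unfolding invariance_limit_def tendsto_def eventually_folner[OF G] invariant_sets_def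
  by (simp add: Ball_def conj_assoc conj_commute cong: conj_cong) (meson)

section \<open>Quasi-tilings\<close>

text \<open>The maps \<open>\<tau> s\<close> are only required to look like a free action of \<open>S\<close> at these points. They need not
  preserve \<open>D\<close>, which allows \<open>D\<close> to be a finite subset of the group, acted on by multiplication.\<close>

definition goodpts ::
    "('g, 'b) monoid_scheme \<Rightarrow> 'g set \<Rightarrow> ('g \<Rightarrow> 'a \<Rightarrow> 'a) \<Rightarrow> 'a set \<Rightarrow> 'a set" where
  "goodpts G S \<tau> D = {c \<in> D. inj_on (\<lambda>s. \<tau> s c) S \<and> (\<forall>s\<in>S. \<tau> s c \<in> D) \<and>
     (\<forall>t\<in>S. \<forall>u\<in>S. \<tau> t (\<tau> u c) = \<tau> (t \<otimes>\<^bsub>G\<^esub> u) c)}"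

text \<open>A tile consists of its shape, its center, and the part of the shape whose translate it claims.\<close>

abbreviation shape :: "'g set \<times> 'a \<times> 'g set \<Rightarrow> 'g set" where "shape P \<equiv> fst P"
abbreviation center :: "'g set \<times> 'a \<times> 'g set \<Rightarrow> 'a" where "center P \<equiv> fst (snd P)"
abbreviation part :: "'g set \<times> 'a \<times> 'g set \<Rightarrow> 'g set" where "part P \<equiv> snd (snd P)"

definition covered :: "('g \<Rightarrow> 'a \<Rightarrow> 'a) \<Rightarrow> ('g set \<times> 'a \<times> 'g set) set \<Rightarrow> 'a set" where
  "covered \<tau> PP = (\<lambda>(P, s). \<tau> s (center P)) ` (SIGMA P:PP. part P)"

text \<open>The last clause keeps the full translates of the shapes, not only the claimed parts, inside the
  covered set: a center whose translate meets the covered set is then either covered itself or lies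
  in the boundary of a tile.\<close>

definition quasitiling ::
    "('g \<Rightarrow> 'a \<Rightarrow> 'a) \<Rightarrow> 'g set set \<Rightarrow> real \<Rightarrow> 'a set \<Rightarrow> 'a set \<Rightarrow> ('g set \<times> 'a \<times> 'g set) set \<Rightarrow> bool"
  where
  "quasitiling \<tau> TT \<epsilon> C D PP \<longleftrightarrow>
     finite PP \<and> covered \<tau> PP \<subseteq> D \<and> inj_on (\<lambda>(P, s). \<tau> s (center P)) (SIGMA P:PP. part P) \<and>
     (\<forall>P\<in>PP. shape P \<in> TT \<and> finite (shape P) \<and> center P \<in> C \<and> part P \<subseteq> shape P \<and>
        (1 - \<epsilon>) * card (shape P) \<le> card (part P) \<and>
        (\<lambda>s. \<tau> s (center P)) ` shape P \<subseteq> covered \<tau> PP)"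

section \<open>Sizes of tiles and insertion of a tile\<close>

lemma goodpts_antimono: "S \<subseteq> S' \<Longrightarrow> goodpts G S' \<tau> D \<subseteq> goodpts G S \<tau> D"
  by (auto simp: goodpts_def intro: inj_on_subset)

lemma covered_insert: "covered \<tau> (insert P PP) = (\<lambda>s. \<tau> s (center P)) ` part P \<union> covered \<tau> PP"
  by (force simp: covered_def)

lemma covered_mono: "PP \<subseteq> PP' \<Longrightarrow> covered \<tau> PP \<subseteq> covered \<tau> PP'"
  by (force simp: covered_def)

lemma quasitiling_mono:
  "quasitiling \<tau> TT \<epsilon> C D PP \<Longrightarrow> TT \<subseteq> TT' \<Longrightarrow> C \<subseteq> C' \<Longrightarrow> quasitiling \<tau> TT' \<epsilon> C' D PP"
  unfolding quasitiling_def by blast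

lemma card_covered:
  assumes "quasitiling \<tau> TT \<epsilon> C D PP"
  shows "card (covered \<tau> PP) = (\<Sum>P\<in>PP. card (part P))"
proof -
  have "finite PP" and inj: "inj_on (\<lambda>(P, s). \<tau> s (center P)) (SIGMA P:PP. part P)"
    and "\<And>P. P \<in> PP \<Longrightarrow> finite (part P)"
    using assms finite_subset unfolding quasitiling_def by blast+
  then show ?thesis
    unfolding covered_def card_image[OF inj] by (simp add: card_SigmaI)
qed

text \<open>The claimed parts are disjoint in \<open>D\<close> and make up at least the proportion
  \<open>1 - \<epsilon>\<close> of each shape. The crude bound with 2 serves for error terms, the
  sharp one for rates.\<close>

lemma sum_card_shape_le:
  fixes \<epsilon> :: real
  assumes "quasitiling \<tau> TT \<epsilon> C D PP" and "finite D" and \<epsilon>: "\<epsilon> \<le> 1/2" "0 < \<epsilon>"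
  shows "(\<Sum>P\<in>PP. real (card (shape P))) \<le> 2 * real (card D)"
    and "(1 - \<epsilon>) * (\<Sum>P\<in>PP. real (card (shape P))) \<le> real (card D)"
proof -
  have "(1 - \<epsilon>) * (\<Sum>P\<in>PP. real (card (shape P))) \<le> (\<Sum>P\<in>PP. real (card (part P)))"
    unfolding sum_distrib_left using assms(1) by (intro sum_mono) (auto simp: quasitiling_def)
  also have "\<dots> = card (covered \<tau> PP)" by (simp add: card_covered[OF assms(1)])
  also have "\<dots> \<le> card D"
    using assms(1,2) by (auto simp: quasitiling_def intro: card_mono)
  finally show le: "(1 - \<epsilon>) * (\<Sum>P\<in>PP. real (card (shape P))) \<le> real (card D)" .
  have "1/2 * (\<Sum>P\<in>PP. real (card (shape P))) \<le> (1 - \<epsilon>) * (\<Sum>P\<in>PP. real (card (shape P)))"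
    using \<epsilon> by (intro mult_right_mono sum_nonneg) auto
  then show "(\<Sum>P\<in>PP. real (card (shape P))) \<le> 2 * real (card D)"
    using le by linarith
qed

text \<open>A translate of \<open>T\<close> that meets the covered set in few points becomes a tile
  by claiming only its uncovered points \<open>R\<close>. At least the proportion
  \<open>1 - \<epsilon>\<close> of \<open>T\<close> remains, and \<open>R\<close> is nonempty, which
  gives progress in the greedy construction.\<close>

lemma quasitiling_insert:
  fixes \<epsilon> :: real
  assumes q: "quasitiling \<tau> TT \<epsilon> C D PP"
    and T: "finite T" "T \<noteq> {}" "T \<in> TT" and \<epsilon>: "\<epsilon> < 1"
    and c: "c \<in> C" "inj_on (\<lambda>s. \<tau> s c) T" "\<And>s. s \<in> T \<Longrightarrow> \<tau> s c \<in> D"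
    and few: "card ((\<lambda>s. \<tau> s c) ` T \<inter> covered \<tau> PP) \<le> \<epsilon> * card T"
    and R: "R = {s \<in> T. \<tau> s c \<notin> covered \<tau> PP}"
  shows "R \<noteq> {}" and "quasitiling \<tau> TT \<epsilon> C D (insert (T, c, R) PP)"
proof -
  let ?V = "covered \<tau> PP"
  have "(\<lambda>s. \<tau> s c) ` T \<inter> ?V = (\<lambda>s. \<tau> s c) ` {s \<in> T. \<tau> s c \<in> ?V}" by auto
  moreover have "inj_on (\<lambda>s. \<tau> s c) {s \<in> T. \<tau> s c \<in> ?V}"
    using c(2) by (rule inj_on_subset) auto
  ultimately have 1: "card {s \<in> T. \<tau> s c \<in> ?V} \<le> \<epsilon> * card T"
    using few by (simp add: card_image)
  have "card T = card ({s \<in> T. \<tau> s c \<in> ?V} \<union> R)"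
    unfolding R by (rule arg_cong[where f = card]) auto
  also have "\<dots> = card {s \<in> T. \<tau> s c \<in> ?V} + card R"
    unfolding R using T by (intro card_Un_disjoint) auto
  finally have "real (card T) = card {s \<in> T. \<tau> s c \<in> ?V} + real (card R)" by simp
  moreover have "(1 - \<epsilon>) * card T = card T - \<epsilon> * card T" by (simp add: algebra_simps)
  ultimately have cR: "(1 - \<epsilon>) * card T \<le> card R"
    using 1 by linarith
  moreover have "0 < (1 - \<epsilon>) * card T"
    using \<epsilon> T by (simp add: card_gt_0_iff)
  ultimately have "0 < real (card R)" by linarith
  then show "R \<noteq> {}" by auto
  have cov: "covered \<tau> (insert (T, c, R) PP) = (\<lambda>s. \<tau> s c) ` R \<union> ?V"
    by (simp add: covered_insert)
  have "(SIGMA P:insert (T, c, R) PP. part P) = (SIGMA P:PP. part P) \<union> {(T, c, R)} \<times> R"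
    by auto
  moreover have "inj_on (\<lambda>(P, s). \<tau> s (center P)) ((SIGMA P:PP. part P) \<union> {(T, c, R)} \<times> R)"
  proof -
    let ?g = "\<lambda>(P, s). \<tau> s (center P)"
    have a: "inj_on ?g (SIGMA P:PP. part P)" using q by (auto simp: quasitiling_def)
    have b: "inj_on ?g ({(T, c, R)} \<times> R)"
      using c(2) unfolding R by (auto simp: inj_on_def)
    have d: "?g ` (SIGMA P:PP. part P) \<inter> ?g ` ({(T, c, R)} \<times> R) = {}"
      unfolding covered_def[symmetric] by (auto simp: R)
    show ?thesis using a b d by (subst inj_on_Un) blast
  qed
  ultimately have inj: "inj_on (\<lambda>(P, s). \<tau> s (center P)) (SIGMA P:insert (T, c, R) PP. part P)"
    by simp
  have "shape P \<in> TT \<and> finite (shape P) \<and> center P \<in> C \<and> part P \<subseteq> shape P \<and>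
        (1 - \<epsilon>) * card (shape P) \<le> card (part P) \<and>
        (\<lambda>s. \<tau> s (center P)) ` shape P \<subseteq> (\<lambda>s. \<tau> s c) ` R \<union> ?V"
    if P: "P \<in> insert (T, c, R) PP" for P
  proof (cases "P \<in> PP")
    case True
    then show ?thesis using q unfolding quasitiling_def by blast
  next
    case False
    then have [simp]: "P = (T, c, R)" using P by simp
    show ?thesis using T c(1) cR by (auto simp: R)
  qed
  moreover have "finite (insert (T, c, R) PP)" "(\<lambda>s. \<tau> s c) ` R \<union> ?V \<subseteq> D"
    using q c(3) by (auto simp: quasitiling_def R)
  ultimately show "quasitiling \<tau> TT \<epsilon> C D (insert (T, c, R) PP)"
    unfolding quasitiling_def cov using inj by (intro conjI ballI) blast+
qed

text \<open>Insertion stops because every new tile covers a new point of the finite set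
  \<open>D\<close>. When it stops, every center in \<open>C\<close>, whether or not it carries a
  tile, sees more than the proportion \<epsilon> of its translate of \<open>T\<close>
  covered.\<close>

lemma quasitiling_saturate:
  fixes \<epsilon> :: real
  assumes D: "finite D" and T: "finite T" "T \<noteq> {}" "T \<in> TT" and \<epsilon>: "\<epsilon> < 1"
    and inj: "\<And>c. c \<in> C \<Longrightarrow> inj_on (\<lambda>s. \<tau> s c) T" 
    and clo: "\<And>c s. c \<in> C \<Longrightarrow> s \<in> T \<Longrightarrow> \<tau> s c \<in> D"
    and q: "quasitiling \<tau> TT \<epsilon> C D PP"
  shows "\<exists>PP'. PP \<subseteq> PP' \<and> quasitiling \<tau> TT \<epsilon> C D PP' \<and>
    (\<forall>c\<in>C. \<epsilon> * card T < card ((\<lambda>s. \<tau> s c) ` T \<inter> covered \<tau> PP'))"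
  using q
proof (induction "card (D - covered \<tau> PP)" arbitrary: PP rule: less_induct)
  case less
  show ?case
  proof (cases "\<forall>c\<in>C. \<epsilon> * card T < card ((\<lambda>s. \<tau> s c) ` T \<inter> covered \<tau> PP)")
    case True
    then show ?thesis using less.prems by blast
  next
    case False
    then obtain c where c: "c \<in> C" "card ((\<lambda>s. \<tau> s c) ` T \<inter> covered \<tau> PP) \<le> \<epsilon> * card T"
      by (auto simp: not_less)
    define R where "R = {s \<in> T. \<tau> s c \<notin> covered \<tau> PP}"
    note ins = quasitiling_insert[OF less.prems T \<epsilon> c(1) inj[OF c(1)] clo[OF c(1)] c(2) R_def]
    obtain s where s: "s \<in> T" "\<tau> s c \<notin> covered \<tau> PP"
      using ins(1) by (auto simp: R_def)
    have "D - covered \<tau> (insert (T, c, R) PP) \<subset> D - covered \<tau> PP"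
      using s clo[OF c(1) s(1)] by (auto simp: covered_insert R_def)
    then have "card (D - covered \<tau> (insert (T, c, R) PP)) < card (D - covered \<tau> PP)"
      using D by (intro psubset_card_mono) auto
    moreover have "quasitiling \<tau> TT \<epsilon> C D (insert (T, c, R) PP)" by (rule ins(2))
    ultimately obtain PP' where "insert (T, c, R) PP \<subseteq> PP'"
      "quasitiling \<tau> TT \<epsilon> C D PP'"
      "\<forall>c\<in>C. \<epsilon> * card T < card ((\<lambda>s. \<tau> s c) ` T \<inter> covered \<tau> PP')" using less.hyps[of "insert (T, c, R) PP"] by metis
    then show ?thesis by (intro exI[of _ PP']) simp
  qed
qed

text \<open>Double counting of the pairs \<open>(c, s)\<close> with \<open>\<tau> s c\<close> newly covered: every center whose translate
  misses the old covered set contributes at least \<open>\<epsilon> |T|\<close> of them.\<close>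

lemma quasitiling_gain:
  fixes G (structure) and \<epsilon> :: real
  assumes G: "group G" and D: "finite D" and T: "finite T" "T \<noteq> {}" "T \<subseteq> S" and S: "S \<subseteq> carrier G"
    and inj: "\<And>s. s \<in> S \<Longrightarrow> inj_on (\<tau> s) D" and C: "C \<subseteq> goodpts G S \<tau> D"
    and q: "quasitiling \<tau> TT \<epsilon> C D PP" and q': "quasitiling \<tau> TT' \<epsilon> C D PP'" "PP \<subseteq> PP'"
    and SS: "\<And>U. U \<in> TT \<Longrightarrow> U \<subseteq> S \<and> (m_inv G ` T) <#> U \<subseteq> S"
    and sat: "\<And>c. c \<in> C \<Longrightarrow> \<epsilon> * card T < card ((\<lambda>s. \<tau> s c) ` T \<inter> covered \<tau> PP')"
    and \<epsilon>: "0 < \<epsilon>"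
  shows "\<epsilon> * (real (card D) - card (covered \<tau> PP) - card (D - C)
      - (\<Sum>P\<in>PP. real (card (((m_inv G ` T) <#> shape P) - shape P))))
    \<le> real (card (covered \<tau> PP')) - card (covered \<tau> PP)"
proof -
  interpret group G by fact
  let ?V = "covered \<tau> PP" and ?V' = "covered \<tau> PP'"
  have VV: "?V \<subseteq> ?V'" by (rule covered_mono) fact
  have fV': "finite ?V'" "?V' \<subseteq> D" using q' D by (auto simp: quasitiling_def intro: finite_subset)
  have CD: "C \<subseteq> D" using C by (auto simp: goodpts_def)
  define W where "W = ?V' - ?V"
  have fW: "finite W" using fV' by (simp add: W_def)
  \<comment> \<open>For centers in \<open>I\<close> the translate avoids the old covered set, so
    everything that saturation forces to be covered there is new.\<close>
  define I where "I = {c \<in> C. \<forall>s\<in>T. \<tau> s c \<notin> ?V}"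
  have fI: "finite I" using CD D by (auto simp: I_def intro: finite_subset)
  have "real (card I) * (\<epsilon> * card T) = (\<Sum>c\<in>I. \<epsilon> * card T)" by simp
  also have "\<dots> \<le> (\<Sum>c\<in>I. real (card {s\<in>T. \<tau> s c \<in> W}))"
  proof (rule sum_mono)
    fix c assume c: "c \<in> I"
    have "(\<lambda>s. \<tau> s c) ` T \<inter> ?V' = (\<lambda>s. \<tau> s c) ` {s\<in>T. \<tau> s c \<in> W}"
      using c by (auto simp: I_def W_def)
    then have "card ((\<lambda>s. \<tau> s c) ` T \<inter> ?V') \<le> card {s\<in>T. \<tau> s c \<in> W}"
      using T by (simp add: card_image_le)
    then show "\<epsilon> * card T \<le> real (card {s\<in>T. \<tau> s c \<in> W})"
      using sat[of c] c by (auto simp: I_def)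
  qed
  also have "\<dots> = (\<Sum>c\<in>I. \<Sum>s\<in>T. if \<tau> s c \<in> W then 1 else 0)"
    using T by (simp add: sum.If_cases Int_def)
  also have "\<dots> = (\<Sum>s\<in>T. \<Sum>c\<in>I. if \<tau> s c \<in> W then 1 else 0)"
    by (rule sum.swap)
  also have "\<dots> = (\<Sum>s\<in>T. real (card {c\<in>I. \<tau> s c \<in> W}))"
    using fI by (simp add: sum.If_cases Int_def)
  \<comment> \<open>For fixed \<open>s\<close> the map \<open>\<tau> s\<close> is injective, so each
    new point is counted at most once for every \<open>s\<close>.\<close>
  also have "\<dots> \<le> (\<Sum>s\<in>T. real (card W))"
  proof (intro sum_mono of_nat_mono)
    fix s assume s: "s \<in> T"
    then have "inj_on (\<tau> s) {c\<in>I. \<tau> s c \<in> W}"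
      using inj[of s] T(3) CD by (auto simp: I_def inj_on_def subset_iff)
    then show "card {c\<in>I. \<tau> s c \<in> W} \<le> card W"
      using fW by (intro card_inj_on_le[where f = "\<tau> s"]) auto
  qed
  also have "\<dots> = card W * real (card T)" by simp
  finally have "\<epsilon> * card I * card T \<le> card W * real (card T)" by (simp add: mult_ac)
  then have I: "\<epsilon> * card I \<le> card W"
    using T by (simp add: card_gt_0_iff)
  let ?N = "\<lambda>P. ((m_inv G ` T) <#> shape P) - shape P"
  have fin: "finite PP" "\<And>P. P \<in> PP \<Longrightarrow> finite (shape P)" using q by (auto simp: quasitiling_def)
  have "D \<subseteq> I \<union> (D - C) \<union> ?V \<union> (\<Union>P\<in>PP. (\<lambda>u. \<tau> u (center P)) ` ?N P)"
  proof
    fix c assume "c \<in> D"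
    show "c \<in> I \<union> (D - C) \<union> ?V \<union> (\<Union>P\<in>PP. (\<lambda>u. \<tau> u (center P)) ` ?N P)"
    proof (cases "c \<in> C \<and> c \<notin> I")
      case True
      then obtain s where s: "s \<in> T" "\<tau> s c \<in> ?V" by (auto simp: I_def)
      then obtain P u where P: "P \<in> PP" "u \<in> part P" "\<tau> s c = \<tau> u (center P)"
        by (auto simp: covered_def)
      have PT: "shape P \<in> TT" "u \<in> shape P" "center P \<in> C" "(\<lambda>s. \<tau> s (center P)) ` shape P \<subseteq> ?V"
        using q P by (auto simp: quasitiling_def)
      have uS: "u \<in> S" "s \<in> S" using SS[OF PT(1)] PT(2) s T by auto
      \<comment> \<open>This solves \<open>\<tau> s c = \<tau> u (center P)\<close> for
        \<open>c\<close>: the center of \<open>P\<close> is good, so \<open>\<tau> s\<close> sends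
        \<open>\<tau> w (center P)\<close> to \<open>\<tau> u (center P)\<close>, and injectivity of
        \<open>\<tau> s\<close> gives \<open>c = \<tau> w (center P)\<close>.\<close>
      define w where "w = inv s \<otimes> u"
      have w: "w \<in> (m_inv G ` T) <#> shape P" using s PT by (auto simp: w_def set_mult_def)
      then have "w \<in> S" using SS[OF PT(1)] by auto
      have "center P \<in> goodpts G S \<tau> D" using C PT by auto
      then have "\<tau> s (\<tau> w (center P)) = \<tau> (s \<otimes> w) (center P)" "\<tau> w (center P) \<in> D"
        using \<open>w \<in> S\<close> uS by (auto simp: goodpts_def)
      moreover have "s \<otimes> w = u"
        using uS S by (simp add: w_def m_assoc[symmetric] subset_iff)
      ultimately have "c = \<tau> w (center P)"
        using P(3) \<open>c \<in> D\<close> by - (rule inj_onD[OF inj[OF uS(2)]], simp_all)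
      show ?thesis
      proof (cases "w \<in> shape P")
        case True
        then have "c \<in> ?V" using PT(4) \<open>c = \<tau> w (center P)\<close> by blast
        then show ?thesis by blast
      next
        case False
        then have "c \<in> (\<lambda>u. \<tau> u (center P)) ` ?N P" using w \<open>c = \<tau> w (center P)\<close> by blast
        then show ?thesis using P(1) by blast
      qed
    qed (use \<open>c \<in> D\<close> in auto)
  qed
  then have "card D \<le> card (I \<union> (D - C) \<union> ?V \<union> (\<Union>P\<in>PP. (\<lambda>u. \<tau> u (center P)) ` ?N P))"
    using fI D finite_subset[OF VV fV'(1)] fin T
    by (intro card_mono finite_UnI finite_UN_I finite_imageI finite_Diff finite_set_mult) simp_all
  also have "\<dots> \<le> card I + card (D - C) + card ?V + card (\<Union>P\<in>PP. (\<lambda>u. \<tau> u (center P)) ` ?N P)"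
    by (intro order.trans[OF card_Un_le] add_mono order.refl)
  also have "card (\<Union>P\<in>PP. (\<lambda>u. \<tau> u (center P)) ` ?N P) \<le> (\<Sum>P\<in>PP. card ((\<lambda>u. \<tau> u (center P)) ` ?N P))"
    using fin by (intro card_UN_le)
  also have "\<dots> \<le> (\<Sum>P\<in>PP. card (?N P))"
    using fin T by (intro sum_mono card_image_le finite_Diff finite_set_mult) auto
  finally have "card D \<le> card I + card (D - C) + card ?V + (\<Sum>P\<in>PP. card (?N P))" by simp
  then have "real (card D) \<le> real (card I + card (D - C) + card ?V + (\<Sum>P\<in>PP. card (?N P)))"
    by (rule of_nat_mono)
  then have "real (card D) - card ?V - card (D - C) - (\<Sum>P\<in>PP. real (card (?N P))) \<le> card I"
    by simp
  then have "\<epsilon> * (real (card D) - card ?V - card (D - C) - (\<Sum>P\<in>PP. real (card (?N P)))) \<le> \<epsilon> * card I"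
    using \<epsilon> by (intro mult_left_mono) auto
  also have "\<dots> \<le> card W" by (rule I)
  also have "real (card W) = real (card ?V') - card ?V"
    unfolding W_def using VV fV'(1) by (simp add: card_Diff_subset finite_subset of_nat_diff card_mono)
  finally show ?thesis .
qed

text \<open>Each shape turns an uncovered proportion \<open>x\<close> into at most
  \<open>(1 - \<epsilon>) * x + \<epsilon> * (\<eta> + 2 * \<beta>)\<close>, and the error term
  \<open>\<eta> + 2 * \<beta>\<close> is the fixed point of this recursion. Points outside
  \<open>C\<close> account for \<eta>, boundaries of the earlier tiles for
  \<open>2 * \<beta>\<close>. Therefore an earlier shape \<open>U\<close> has to be almost invariant
  under the inverses of every later shape \<open>T\<close>.\<close>

lemma quasitiling_list:
  fixes G (structure) and \<epsilon> \<beta> \<eta> :: real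
  assumes G: "group G" and D: "finite D" and S: "S \<subseteq> carrier G"
    and inj: "\<And>s. s \<in> S \<Longrightarrow> inj_on (\<tau> s) D" and C: "C \<subseteq> goodpts G S \<tau> D"
    and \<epsilon>: "0 < \<epsilon>" "\<epsilon> \<le> 1/2" and \<beta>: "0 \<le> \<beta>" and \<eta>: "card (D - C) \<le> \<eta> * card D"
    and sorted: "sorted_wrt (\<lambda>U T. card (((m_inv G ` T) <#> U) - U) \<le> \<beta> * card U) Ts"
    and Ts: "\<And>T. T \<in> set Ts \<Longrightarrow> finite T \<and> T \<noteq> {} \<and> T \<subseteq> S"
    and SS: "\<And>T U. T \<in> set Ts \<Longrightarrow> U \<in> set Ts \<Longrightarrow> (m_inv G ` T) <#> U \<subseteq> S"
  shows "\<exists>PP. quasitiling \<tau> (set Ts) \<epsilon> C D PP \<and>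
    real (card D) - card (covered \<tau> PP) \<le> ((1 - \<epsilon>) ^ length Ts + \<eta> + 2 * \<beta>) * card D"
  using sorted Ts SS
proof (induction Ts rule: rev_induct)
  case Nil
  have "0 \<le> \<eta> * card D" using \<eta> by linarith
  then have "0 \<le> \<eta> * card D + 2 * \<beta> * card D" using \<beta> by simp
  then show ?case by (intro exI[of _ "{}"]) (simp add: quasitiling_def covered_def algebra_simps)
next
  case (snoc T Ts)
  have "\<exists>PP. quasitiling \<tau> (set Ts) \<epsilon> C D PP \<and>
    real (card D) - card (covered \<tau> PP) \<le> ((1 - \<epsilon>) ^ length Ts + \<eta> + 2 * \<beta>) * card D"
    using snoc.prems by (intro snoc.IH) (auto simp: sorted_wrt_append)
  then obtain PP where PP: "quasitiling \<tau> (set Ts) \<epsilon> C D PP"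
    "real (card D) - card (covered \<tau> PP) \<le> ((1 - \<epsilon>) ^ length Ts + \<eta> + 2 * \<beta>) * card D" by blast
  have T: "finite T" "T \<noteq> {}" "T \<subseteq> S" using snoc.prems(2)[of T] by auto
  have cg: "inj_on (\<lambda>s. \<tau> s c) T" "s \<in> T \<Longrightarrow> \<tau> s c \<in> D" if "c \<in> C" for c s
    using that C T(3) by (auto simp: goodpts_def subset_iff intro: inj_on_subset)
  have PPq: "quasitiling \<tau> (set (Ts @ [T])) \<epsilon> C D PP"
    using PP(1) by (rule quasitiling_mono) auto
  obtain PP' where PP': "PP \<subseteq> PP'" "quasitiling \<tau> (set (Ts @ [T])) \<epsilon> C D PP'"
    "\<And>c. c \<in> C \<Longrightarrow> \<epsilon> * card T < card ((\<lambda>s. \<tau> s c) ` T \<inter> covered \<tau> PP')"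
    using quasitiling_saturate[OF D T(1,2) _ _ _ _ PPq] \<epsilon> cg by fastforce
  let ?s = "\<Sum>P\<in>PP. real (card (((m_inv G ` T) <#> shape P) - shape P))"
  have "?s \<le> (\<Sum>P\<in>PP. \<beta> * card (shape P))"
    using PP(1) snoc.prems(1) by (intro sum_mono) (auto simp: quasitiling_def sorted_wrt_append)
  also have "\<dots> \<le> \<beta> * (2 * card D)"
    unfolding sum_distrib_left[symmetric] using sum_card_shape_le(1)[OF PP(1) D] \<epsilon> \<beta>
    by (intro mult_left_mono) auto
  finally have s: "?s \<le> 2 * \<beta> * card D" by simp
  let ?d = "real (card D)" and ?v = "real (card (covered \<tau> PP))" and ?v' = "real (card (covered \<tau> PP'))"
  have "\<epsilon> * (?d - ?v - \<eta> * ?d - 2 * \<beta> * ?d) \<le> \<epsilon> * (?d - ?v - card (D - C) - ?s)"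
    using \<epsilon> s \<eta> by (intro mult_left_mono) auto
  also have "\<dots> \<le> ?v' - ?v"
    using snoc.prems(2,3)
    by (intro quasitiling_gain[OF G D T S inj C PP(1) PP'(2,1) _ PP'(3) \<epsilon>(1)]) auto
  finally have "?d - ?v' \<le> (1 - \<epsilon>) * (?d - ?v) + \<epsilon> * ((\<eta> + 2 * \<beta>) * ?d)"
    by (simp add: algebra_simps)
  also have "\<dots> \<le> (1 - \<epsilon>) * (((1 - \<epsilon>) ^ length Ts + \<eta> + 2 * \<beta>) * ?d) + \<epsilon> * ((\<eta> + 2 * \<beta>) * ?d)"
    using PP(2) \<epsilon> by (intro add_right_mono mult_left_mono) auto
  also have "\<dots> = ((1 - \<epsilon>) ^ length (Ts @ [T]) + \<eta> + 2 * \<beta>) * ?d"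
    by (simp add: algebra_simps)
  finally show ?case using PP'(2) by blast
qed

section \<open>Choice of the shapes\<close>

lemma frequently_eventually_ex:
  assumes "frequently P F" "eventually R F"
  shows "\<exists>x. P x \<and> R x"
proof (rule ccontr)
  assume "\<not> ?thesis"
  then have "eventually (\<lambda>x. \<not> P x) F" using assms(2) by (auto elim: eventually_mono)
  then show False using assms(1) by (simp add: frequently_def)
qed

text \<open>The list grows at its head: when \<open>U\<close> is chosen, all shapes that will follow
  it are known, so \<open>U\<close> can be taken almost invariant under all their inverses. It
  suffices that \<open>Q\<close> holds frequently, because the invariance holds eventually.\<close>

lemma frequently_folner_tiles:
  fixes G (structure) and \<beta> :: real
  assumes G: "group G" and Q: "frequently Q (folner G)" and \<beta>: "0 < \<beta>"
  shows "\<exists>Ts. length Ts = n \<and> sorted_wrt (\<lambda>U T. card (((m_inv G ` T) <#> U) - U) \<le> \<beta> * card U) Ts \<and>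
    (\<forall>T\<in>set Ts. Q T \<and> finite T \<and> T \<noteq> {} \<and> T \<subseteq> carrier G)"
proof (induction n)
  case (Suc n)
  from Suc.IH obtain Ts where Ts: "length Ts = n"
    "sorted_wrt (\<lambda>U T. card (((m_inv G ` T) <#> U) - U) \<le> \<beta> * card U) Ts"
    "\<forall>T\<in>set Ts. Q T \<and> finite T \<and> T \<noteq> {} \<and> T \<subseteq> carrier G" by (elim exE conjE)
  interpret group G by fact
  define K where "K = (\<Union>T\<in>set Ts. m_inv G ` T)"
  have K: "finite K" "K \<subseteq> carrier G" using Ts(3) by (auto simp: K_def)
  have "eventually (\<lambda>U. card ((K <#> U) - U) \<le> \<beta> * card U \<and> finite U \<and> U \<noteq> {} \<and> U \<subseteq> carrier G) (folner G)"
    using eventually_folner_invariant[OF G K \<beta>] eventually_folner_basic[OF G] by eventually_elim auto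
  then have "\<exists>U. Q U \<and> card ((K <#> U) - U) \<le> \<beta> * card U \<and> finite U \<and> U \<noteq> {} \<and> U \<subseteq> carrier G"
    by (rule frequently_eventually_ex[OF Q])
  then obtain U where U: "Q U" "card ((K <#> U) - U) \<le> \<beta> * card U" "finite U" "U \<noteq> {}" "U \<subseteq> carrier G"
    by (elim exE conjE)
  have "card (((m_inv G ` T) <#> U) - U) \<le> \<beta> * card U" if "T \<in> set Ts" for T
  proof -
    have "card (((m_inv G ` T) <#> U) - U) \<le> card ((K <#> U) - U)"
      using that K U by (intro card_mono finite_Diff finite_set_mult Diff_mono mono_set_mult)
        (auto simp: K_def)
    then show ?thesis using U(2) by linarith
  qed
  then show ?case using Ts U by (intro exI[of _ "U # Ts"]) auto
qed auto

text \<open>The shapes and \<open>S\<close> are chosen before the model, so one finite family tiles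
  every \<open>D\<close> with enough good points. Boundaries of proportion
  \<open>\<epsilon>/8\<close>, bad points of proportion \<open>\<epsilon>/4\<close> and
  \<open>(1 - \<epsilon>) ^ n < \<epsilon>/4\<close> together leave at most the proportion
  \<epsilon> uncovered.\<close>

theorem quasitiling_exists:
  fixes G (structure) and \<epsilon> :: real
  assumes G: "group G" and Q: "frequently Q (folner G)" and \<epsilon>: "0 < \<epsilon>" "\<epsilon> \<le> 1/2"
  obtains TT S where "finite TT" "\<And>T. T \<in> TT \<Longrightarrow> Q T \<and> finite T \<and> T \<noteq> {} \<and> T \<subseteq> S"
    "finite S" "S \<subseteq> carrier G"
    "\<And>(D :: 'a set) \<tau> C. finite D \<Longrightarrow> (\<And>s. s \<in> S \<Longrightarrow> inj_on (\<tau> s) D) \<Longrightarrow>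
       C \<subseteq> goodpts G S \<tau> D \<Longrightarrow> real (card (D - C)) \<le> \<epsilon> / 4 * card D \<Longrightarrow>
       \<exists>PP. quasitiling \<tau> TT \<epsilon> C D PP \<and> (1 - \<epsilon>) * card D \<le> card (covered \<tau> PP)"
proof -
  interpret group G by fact
  obtain n where n: "(1 - \<epsilon>) ^ n < \<epsilon> / 4"
    using real_arch_pow_inv[of "\<epsilon>/4" "1 - \<epsilon>"] \<epsilon> by auto
  obtain Ts where Ts: "length Ts = n"
    "sorted_wrt (\<lambda>U T. card (((m_inv G ` T) <#> U) - U) \<le> \<epsilon>/8 * card U) Ts"
    "\<forall>T\<in>set Ts. Q T \<and> finite T \<and> T \<noteq> {} \<and> T \<subseteq> carrier G"
    using frequently_folner_tiles[OF G Q, of "\<epsilon>/8" n] \<epsilon> by auto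
  \<comment> \<open>Besides the shapes, \<open>S\<close> contains the products
    \<open>inv s \<otimes> u\<close> of elements of two shapes, which arise when a center is located
    relative to another tile.\<close>
  define S where "S = \<Union>(set Ts) \<union> (\<Union>T\<in>set Ts. \<Union>U\<in>set Ts. (m_inv G ` T) <#> U)"
  have S: "finite S" "S \<subseteq> carrier G"
    using Ts(3) by (auto simp: S_def set_mult_def)
  have tile: "\<exists>PP. quasitiling \<tau> (set Ts) \<epsilon> C D PP \<and> (1 - \<epsilon>) * card D \<le> card (covered \<tau> PP)"
    if D: "finite D" "\<And>s. s \<in> S \<Longrightarrow> inj_on (\<tau> s) D" "C \<subseteq> goodpts G S \<tau> D"
      "real (card (D - C)) \<le> \<epsilon> / 4 * card D" for D :: "'a set" and \<tau> C
  proof -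
    have "\<exists>PP. quasitiling \<tau> (set Ts) \<epsilon> C D PP \<and>
      real (card D) - card (covered \<tau> PP) \<le> ((1 - \<epsilon>) ^ length Ts + \<epsilon>/4 + 2 * (\<epsilon>/8)) * card D"
      using Ts(3) \<epsilon> by (intro quasitiling_list[OF G D(1) S(2) D(2,3) \<epsilon> _ D(4) Ts(2)]) (auto simp: S_def)
    then obtain PP where PP: "quasitiling \<tau> (set Ts) \<epsilon> C D PP"
      "real (card D) - card (covered \<tau> PP) \<le> ((1 - \<epsilon>) ^ length Ts + \<epsilon>/4 + 2 * (\<epsilon>/8)) * card D" by blast
    have "((1 - \<epsilon>) ^ length Ts + \<epsilon>/4 + 2 * (\<epsilon>/8)) * card D \<le> \<epsilon> * card D"
      using n Ts(1) \<epsilon> by (intro mult_right_mono) auto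
    then show ?thesis using PP by (intro exI[of _ PP]) (auto simp: algebra_simps)
  qed
  show thesis
  proof (rule that[of "set Ts" S])
    show "Q T \<and> finite T \<and> T \<noteq> {} \<and> T \<subseteq> S" if "T \<in> set Ts" for T
      using Ts(3) that by (auto simp: S_def)
  qed (use S tile in auto)
qed

section \<open>Classical topological entropy\<close>

lemma div_one_minus_le:
  fixes x e :: real
  assumes "0 \<le> x" "0 \<le> e" "e \<le> 1/2"
  shows "x / (1 - e) \<le> x + 2 * e * x"
proof -
  have "0 \<le> e * (1 - 2 * e)" using assms by (intro mult_nonneg_nonneg) auto
  then have "x * 1 \<le> x * ((1 + 2 * e) * (1 - e))"
    using assms(1) by (intro mult_left_mono) (auto simp: algebra_simps)
  then show ?thesis using assms(2,3) by (simp add: pos_divide_le_eq algebra_simps)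
qed

locale amenable_action = group G for G (structure) +
  fixes X :: "'x topology" and \<alpha> :: "'a \<Rightarrow> 'x \<Rightarrow> 'x"
  assumes amenable: "amenable G" and compact: "compact_space X" and action: "continuous_action G X \<alpha>"
begin

section \<open>The action and names for the members of a join\<close>

lemma group_action: "group_action G (topspace X) \<alpha>"
  using action by (simp add: continuous_action_def)

lemma is_group: "group G" by unfold_locales

lemma act_closed: "s \<in> carrier G \<Longrightarrow> x \<in> topspace X \<Longrightarrow> \<alpha> s x \<in> topspace X"
  using group_action.element_image[OF group_action] by metis

lemma act_mult: "s \<in> carrier G \<Longrightarrow> t \<in> carrier G \<Longrightarrow> x \<in> topspace X \<Longrightarrow> \<alpha> (s \<otimes> t) x = \<alpha> s (\<alpha> t x)"
  using group_action.composition_rule[OF group_action] by metis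

lemma act_inv: "s \<in> carrier G \<Longrightarrow> x \<in> topspace X \<Longrightarrow> \<alpha> (inv s) (\<alpha> s x) = x"
  using group_action.orbit_sym_aux[OF group_action] by metis

lemma act_one: "x \<in> topspace X \<Longrightarrow> \<alpha> \<one> x = x"
  using group_action.id_eq_one[OF group_action] by (metis restrict_apply)

lemma image_act_inv:
  assumes "s \<in> carrier G" "U \<subseteq> topspace X"
  shows "\<alpha> (inv s) ` U = {x \<in> topspace X. \<alpha> s x \<in> U}"
proof (intro equalityI subsetI)
  fix x assume "x \<in> \<alpha> (inv s) ` U"
  then obtain y where y: "y \<in> U" "x = \<alpha> (inv s) y" by auto
  have "\<alpha> s x = y"
    using act_inv[of "inv s" y] assms y by auto
  then show "x \<in> {x \<in> topspace X. \<alpha> s x \<in> U}"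
    using y assms act_closed[of "inv s" y] by auto
next
  fix x assume "x \<in> {x \<in> topspace X. \<alpha> s x \<in> U}"
  then show "x \<in> \<alpha> (inv s) ` U"
    using act_inv[of s x] assms by (metis (mono_tags, lifting) image_eqI mem_Collect_eq)
qed

lemma open_cover_act:
  assumes "open_cover X \<U>" "s \<in> carrier G" "x \<in> topspace X"
  shows "\<exists>V\<in>\<U>. \<alpha> s x \<in> V"
  using act_closed[OF assms(2,3)] assms(1) unfolding open_cover_def by blast

text \<open>A function \<open>w\<close> stands for the element of the join that is the intersection of the sets \<open>\<alpha> (inv s) ` w s\<close>.\<close>

definition names :: "'x set set \<Rightarrow> 'a set \<Rightarrow> ('a \<Rightarrow> 'x set) set \<Rightarrow> bool" where
  "names \<U> F W \<longleftrightarrow> finite W \<and> W \<subseteq> (F \<rightarrow> \<U>) \<and> (\<forall>x\<in>topspace X. \<exists>w\<in>W. \<forall>s\<in>F. \<alpha> s x \<in> w s)"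

abbreviation join_number :: "'x set set \<Rightarrow> 'a set \<Rightarrow> nat" where
  "join_number \<U> F \<equiv> cover_number X (cover_join G \<alpha> \<U> F)"

lemma Inter_act_inv:
  assumes "F \<noteq> {}" "F \<subseteq> carrier G" "open_cover X \<U>" "u \<in> F \<rightarrow> \<U>"
  shows "(\<Inter>s\<in>F. \<alpha> (inv s) ` u s) = {x \<in> topspace X. \<forall>s\<in>F. \<alpha> s x \<in> u s}"
proof -
  have "u s \<subseteq> topspace X" if "s \<in> F" for s
    using assms that by (auto simp: open_cover_def Pi_iff)
  then have "(\<Inter>s\<in>F. \<alpha> (inv s) ` u s) = (\<Inter>s\<in>F. {x \<in> topspace X. \<alpha> s x \<in> u s})"
    using assms(2) by (intro INF_cong refl image_act_inv) auto
  then show ?thesis using assms(1) by auto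
qed

lemma names_subcover:
  assumes F: "F \<noteq> {}" "F \<subseteq> carrier G" and U: "open_cover X \<U>" and W: "names \<U> F W"
  shows "\<exists>\<V>\<subseteq>cover_join G \<alpha> \<U> F. finite \<V> \<and> \<Union>\<V> = topspace X \<and> card \<V> \<le> card W"
proof (intro exI[of _ "(\<lambda>w. \<Inter>s\<in>F. \<alpha> (inv s) ` w s) ` W"] conjI)
  have WF: "w \<in> F \<rightarrow> \<U>" if "w \<in> W" for w using W that by (auto simp: names_def)
  show "(\<lambda>w. \<Inter>s\<in>F. \<alpha> (inv s) ` w s) ` W \<subseteq> cover_join G \<alpha> \<U> F"
    using WF by (auto simp: cover_join_def)
  show "finite ((\<lambda>w. \<Inter>s\<in>F. \<alpha> (inv s) ` w s) ` W)" using W by (auto simp: names_def)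
  have "\<Union> ((\<lambda>w. \<Inter>s\<in>F. \<alpha> (inv s) ` w s) ` W) = (\<Union>w\<in>W. {x \<in> topspace X. \<forall>s\<in>F. \<alpha> s x \<in> w s})"
    using WF by (intro SUP_cong refl Inter_act_inv[OF F U]) auto
  also have "\<dots> = topspace X" using W unfolding names_def by blast
  finally show "\<Union> ((\<lambda>w. \<Inter>s\<in>F. \<alpha> (inv s) ` w s) ` W) = topspace X" .
  show "card ((\<lambda>w. \<Inter>s\<in>F. \<alpha> (inv s) ` w s) ` W) \<le> card W"
    using W by (intro card_image_le) (auto simp: names_def)
qed

lemma join_number_le:
  assumes F: "F \<noteq> {}" "F \<subseteq> carrier G" and U: "open_cover X \<U>" and W: "names \<U> F W"
  shows "join_number \<U> F \<le> card W"
proof -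
  obtain \<V> where V: "\<V>\<subseteq>cover_join G \<alpha> \<U> F" "finite \<V>" "\<Union>\<V> = topspace X" "card \<V> \<le> card W"
    using names_subcover[OF assms] by blast
  then have "join_number \<U> F \<le> card \<V>"
    unfolding cover_number_def by (intro Least_le) blast
  then show ?thesis using V by linarith
qed

lemma names_all:
  assumes F: "finite F" "F \<subseteq> carrier G" and U: "finite \<U>" "open_cover X \<U>"
  shows "names \<U> F (PiE F (\<lambda>_. \<U>))"
  unfolding names_def
proof (intro conjI ballI)
  show "finite (PiE F (\<lambda>_. \<U>))" using F U by (intro finite_PiE) auto
  fix x assume x: "x \<in> topspace X"
  have "\<exists>V\<in>\<U>. \<alpha> s x \<in> V" if "s \<in> F" for s
    using open_cover_act[OF U(2) _ x] that F by blast
  then obtain w where w: "\<And>s. s \<in> F \<Longrightarrow> w s \<in> \<U> \<and> \<alpha> s x \<in> w s" by metis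
  then show "\<exists>w\<in>PiE F (\<lambda>_. \<U>). \<forall>s\<in>F. \<alpha> s x \<in> w s"
    by (intro bexI[of _ "restrict w F"]) auto
qed (auto simp: PiE_def)

lemma join_number_le_power:
  assumes "finite F" "F \<noteq> {}" "F \<subseteq> carrier G" "finite \<U>" "open_cover X \<U>"
  shows "join_number \<U> F \<le> card \<U> ^ card F"
  using join_number_le[OF assms(2,3,5) names_all[OF assms(1,3-5)]] assms(1) by (simp add: card_PiE)

text \<open>Together with \<open>join_number_le\<close> this makes the join number the least size of
  a set of names. Names are easier to cut and glue along tiles than members of the join, since
  different names may describe the same member.\<close>

lemma names_exists:
  assumes F: "finite F" "F \<noteq> {}" "F \<subseteq> carrier G" and U: "finite \<U>" "open_cover X \<U>"
  shows "\<exists>W. names \<U> F W \<and> card W = join_number \<U> F"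
proof -
  let ?P = "\<lambda>n. \<exists>\<V>\<subseteq>cover_join G \<alpha> \<U> F. finite \<V> \<and> \<Union>\<V> = topspace X \<and> card \<V> = n"
  have "\<exists>n. ?P n"
    using names_subcover[OF F(2,3) U(2) names_all[OF F(1,3) U]] by blast
  then have "?P (join_number \<U> F)"
    unfolding cover_number_def by (rule LeastI_ex)
  then obtain \<V> where V: "\<V>\<subseteq>cover_join G \<alpha> \<U> F" "finite \<V>" "\<Union>\<V> = topspace X" "card \<V> = join_number \<U> F"
    by blast
  have "\<exists>u. u \<in> F \<rightarrow> \<U> \<and> V = (\<Inter>s\<in>F. \<alpha> (inv s) ` u s)" if "V \<in> \<V>" for V
    using V(1) that unfolding cover_join_def by blast
  then obtain u where u: "\<And>V. V \<in> \<V> \<Longrightarrow> u V \<in> F \<rightarrow> \<U> \<and> V = (\<Inter>s\<in>F. \<alpha> (inv s) ` u V s)" by metis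
  have Veq: "V = {x \<in> topspace X. \<forall>s\<in>F. \<alpha> s x \<in> u V s}" if "V \<in> \<V>" for V
    using Inter_act_inv[OF F(2,3) U(2), of "u V"] u[OF that] by simp
  have W: "names \<U> F (u ` \<V>)"
    unfolding names_def
  proof (intro conjI ballI)
    show "finite (u ` \<V>)" using V by auto
    show "u ` \<V> \<subseteq> F \<rightarrow> \<U>" using u by auto
    fix x assume "x \<in> topspace X"
    then obtain V where "V \<in> \<V>" "x \<in> V" using V(3) by auto
    then show "\<exists>w\<in>u ` \<V>. \<forall>s\<in>F. \<alpha> s x \<in> w s" using Veq[of V] by blast
  qed
  have "card (u ` \<V>) \<le> join_number \<U> F" using V by (metis card_image_le)
  then show ?thesis
    using W join_number_le[OF F(2,3) U(2) W] by (intro exI[of _ "u ` \<V>"]) auto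
qed

lemma join_number_pos:
  assumes "finite F" "F \<noteq> {}" "F \<subseteq> carrier G" "finite \<U>" "open_cover X \<U>" "topspace X \<noteq> {}"
  shows "1 \<le> join_number \<U> F"
proof -
  obtain W where W: "names \<U> F W" "card W = join_number \<U> F" using names_exists assms by blast
  then have "W \<noteq> {}" "finite W" using assms(6) by (auto simp: names_def)
  then show ?thesis using W(2) by (simp add: Suc_leI card_gt_0_iff flip: W(2))
qed

text \<open>For \<open>s = t \<otimes> c\<close> one has
  \<open>\<alpha> s x = \<alpha> t (\<alpha> c x)\<close>, so a name of the shape for the point
  \<open>\<alpha> c x\<close> describes \<open>x\<close> on the tile with center \<open>c\<close>.
  Sites outside the covered set are given an arbitrary member of \<open>\<U>\<close>.\<close>

lemma join_number_quasitiling: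
  assumes F: "finite F" "F \<noteq> {}" "F \<subseteq> carrier G" and U: "finite \<U>" "open_cover X \<U>"
    and q: "quasitiling (\<otimes>) TT \<epsilon> C F PP" and CF: "C \<subseteq> F"
    and TT: "\<And>T. T \<in> TT \<Longrightarrow> finite T \<and> T \<noteq> {} \<and> T \<subseteq> carrier G"
  shows "join_number \<U> F \<le> (\<Prod>P\<in>PP. join_number \<U> (shape P)) * card \<U> ^ card (F - covered (\<otimes>) PP)"
proof -
  let ?V = "covered (\<otimes>) PP" and ?g = "\<lambda>(P, s). s \<otimes> center P"
  have PP: "finite PP" "shape P \<in> TT" "center P \<in> C" "part P \<subseteq> shape P" if "P \<in> PP" for P
    using q that by (auto simp: quasitiling_def)
  have fPP: "finite PP" using q by (simp add: quasitiling_def)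
  have inj: "inj_on ?g (SIGMA P:PP. part P)" using q by (auto simp: quasitiling_def)
  have VF: "?V \<subseteq> F" using q by (auto simp: quasitiling_def)
  have "\<exists>W. names \<U> T W \<and> card W = join_number \<U> T" if "T \<in> TT" for T
    using names_exists[of T \<U>] TT[OF that] U by blast
  then obtain W where W: "\<And>T. T \<in> TT \<Longrightarrow> names \<U> T (W T) \<and> card (W T) = join_number \<U> T" by metis
  define loc where "loc = inv_into (SIGMA P:PP. part P) ?g"
  have loc: "loc (t \<otimes> center P) = (P, t)" if "P \<in> PP" "t \<in> part P" for P t
    using inv_into_f_f[OF inj, of "(P, t)"] that by (simp add: loc_def)
  \<comment> \<open>Gluing: a covered site finds its tile and its position there through
    \<open>loc\<close>, and reads the name \<open>g\<close> of the tile; an uncovered site reads the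
    free choice \<open>h\<close>.\<close>
  define nm where "nm = (\<lambda>(g, h) s. if s \<in> ?V then g (fst (loc s)) (snd (loc s)) else (h s :: 'x set))"
  define A where "A = PiE PP (\<lambda>P. W (shape P)) \<times> PiE (F - ?V) (\<lambda>_. \<U>)"
  have finW: "finite (W (shape P))" if "P \<in> PP" for P
    using W[OF PP(2)[OF that]] by (auto simp: names_def)
  have finA: "finite A"
    unfolding A_def using finW fPP F U by (intro finite_cartesian_product finite_PiE) auto
  have cardA: "card A = (\<Prod>P\<in>PP. join_number \<U> (shape P)) * card \<U> ^ card (F - ?V)"
    unfolding A_def using fPP F W PP(2) by (simp add: card_cartesian_product card_PiE)
  have "names \<U> F (nm ` A)"
    unfolding names_def
  proof (intro conjI ballI)
    show "finite (nm ` A)" using finA by simp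
    show "nm ` A \<subseteq> F \<rightarrow> \<U>"
    proof (intro subsetI)
      fix w assume "w \<in> nm ` A"
      then obtain g h where gh: "g \<in> PiE PP (\<lambda>P. W (shape P))" "h \<in> PiE (F - ?V) (\<lambda>_. \<U>)" "w = nm (g, h)"
        by (auto simp: A_def)
      have "w s \<in> \<U>" if s: "s \<in> F" for s
      proof (cases "s \<in> ?V")
        case True
        then obtain P t where P: "P \<in> PP" "t \<in> part P" "s = t \<otimes> center P" by (auto simp: covered_def)
        have "g P \<in> W (shape P)" using gh(1) P(1) by auto
        then have "g P t \<in> \<U>"
          using W[OF PP(2)[OF P(1)]] PP(4)[OF P(1)] P(2) unfolding names_def by blast
        then show ?thesis using True loc[OF P(1,2)] gh(3) P(3) by (simp add: nm_def)
      next
        case False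
        then show ?thesis using gh s by (auto simp: nm_def)
      qed
      then show "w \<in> F \<rightarrow> \<U>" by auto
    qed
    fix x assume x: "x \<in> topspace X"
    have cG: "center P \<in> carrier G" if "P \<in> PP" for P using PP(3)[OF that] CF F by auto
    have "\<exists>w\<in>W (shape P). \<forall>s\<in>shape P. \<alpha> s (\<alpha> (center P) x) \<in> w s" if "P \<in> PP" for P
      using W[OF PP(2)[OF that]] act_closed[OF cG[OF that] x] unfolding names_def by blast
    then obtain g where g: "\<And>P. P \<in> PP \<Longrightarrow> g P \<in> W (shape P) \<and> (\<forall>s\<in>shape P. \<alpha> s (\<alpha> (center P) x) \<in> g P s)"
      by metis
    have "\<exists>V\<in>\<U>. \<alpha> s x \<in> V" if "s \<in> F" for s
      by (rule open_cover_act[OF U(2) _ x]) (use that F in auto)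
    then obtain h where h: "\<And>s. s \<in> F \<Longrightarrow> h s \<in> \<U> \<and> \<alpha> s x \<in> h s" by metis
    let ?a = "(restrict g PP, restrict h (F - ?V))"
    have "?a \<in> A" using g h by (auto simp: A_def)
    moreover have "\<alpha> s x \<in> nm ?a s" if s: "s \<in> F" for s
    proof (cases "s \<in> ?V")
      case True
      then obtain P t where P: "P \<in> PP" "t \<in> part P" "s = t \<otimes> center P" by (auto simp: covered_def)
      have t: "t \<in> shape P" "t \<in> carrier G" using PP(2,4)[OF P(1)] P(2) TT by blast+
      have "\<alpha> s x = \<alpha> t (\<alpha> (center P) x)" using act_mult[OF t(2) cG[OF P(1)] x] P(3) by simp
      then show ?thesis using True loc[OF P(1,2)] P g[OF P(1)] t(1) by (simp add: nm_def)
    next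
      case False
      then show ?thesis using h[OF s] s by (simp add: nm_def)
    qed
    ultimately show "\<exists>w\<in>nm ` A. \<forall>s\<in>F. \<alpha> s x \<in> w s" by blast
  qed
  then have "join_number \<U> F \<le> card (nm ` A)" using F(2,3) U(2) by (intro join_number_le)
  also have "\<dots> \<le> card A" using finA by (rule card_image_le)
  finally show ?thesis using cardA by simp
qed

text \<open>Multiplication is associative and cancellative, so in the group itself a point is good
  as soon as its translates by \<open>S\<close> stay in \<open>F\<close>.\<close>

lemma goodpts_mult:
  assumes "S \<subseteq> carrier G" "F \<subseteq> carrier G"
  shows "{c \<in> F. \<forall>s\<in>S. s \<otimes> c \<in> F} \<subseteq> goodpts G S (\<otimes>) F"
  unfolding goodpts_def
  using assms by (auto simp: subset_iff m_assoc inj_on_def)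

section \<open>Convergence of the join rate\<close>

definition join_rate :: "'x set set \<Rightarrow> 'a set \<Rightarrow> real" where
  "join_rate \<U> F = ln (join_number \<U> F) / card F"

lemma join_rate_bounds:
  assumes "finite F" "F \<noteq> {}" "F \<subseteq> carrier G" "finite \<U>" "open_cover X \<U>" "topspace X \<noteq> {}"
  shows "0 \<le> join_rate \<U> F" and "join_rate \<U> F \<le> ln (card \<U>)" 
proof -
  have p: "1 \<le> join_number \<U> F" by (rule join_number_pos[OF assms])
  then show "0 \<le> join_rate \<U> F" by (simp add: join_rate_def)
  have "\<U> \<noteq> {}" using assms(5,6) unfolding open_cover_def by blast
  then have c: "1 \<le> card \<U>" using assms(4) by (simp add: Suc_leI card_gt_0_iff)
  have "ln (real (join_number \<U> F)) \<le> ln (real (card \<U> ^ card F))"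
    using join_number_le_power[OF assms(1-5)] p by (intro ln_mono of_nat_mono) auto
  also have "\<dots> = card F * ln (card \<U>)"
    using c by (simp add: ln_realpow)
  finally show "join_rate \<U> F \<le> ln (card \<U>)"
    using assms(1,2) by (simp add: join_rate_def divide_le_eq card_gt_0_iff mult.commute)
qed

text \<open>A very invariant finite set \<open>F\<close> is quasi-tiled as a model \<open>D = F\<close> under multiplication.\<close>

lemma join_rate_eventually_le:
  assumes U: "finite \<U>" "open_cover X \<U>" and X: "topspace X \<noteq> {}"
    and fr: "frequently (\<lambda>F. join_rate \<U> F \<le> r) (folner G)" and r: "0 \<le> r" "r < u"
  shows "eventually (\<lambda>F. join_rate \<U> F < u) (folner G)"
proof -
  have "\<U> \<noteq> {}" using U(2) X unfolding open_cover_def by blast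
  then have c: "1 \<le> card \<U>" using U by (simp add: Suc_leI card_gt_0_iff)
  define b where "b = ln (real (card \<U>))"
  have b: "0 \<le> b" using c by (simp add: b_def)
  \<comment> \<open>With this \<epsilon> the loss \<open>2 * r * \<epsilon>\<close> caused by
    \<open>1 / (1 - \<epsilon>)\<close> and the cost \<open>\<epsilon> * b\<close> of the free
    choices on the uncovered part use at most half of the gap \<open>u - r\<close>.\<close>
  define \<epsilon> where "\<epsilon> = min (1/2) ((u - r) / (2 * (2 * r + b + 1)))"
  have "\<epsilon> \<le> 1/2" "\<epsilon> \<le> (u - r) / (2 * (2 * r + b + 1))"
    unfolding \<epsilon>_def by (rule min.cobounded1, rule min.cobounded2)
  moreover have "0 < \<epsilon>" using r b by (simp add: \<epsilon>_def)
  ultimately have \<epsilon>: "0 < \<epsilon>" "\<epsilon> \<le> 1/2" and "\<epsilon> \<le> (u - r) / (2 * (2 * r + b + 1))" by simp_all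
  then have "\<epsilon> * (2 * (2 * r + b + 1)) \<le> u - r"
    using r b by (subst (asm) pos_le_divide_eq) auto
  moreover have "0 < \<epsilon> * (2 * r + b + 2)" using \<epsilon> r b by (intro mult_pos_pos) auto
  ultimately have eu: "r + \<epsilon> * (2 * r + b) < u" by (simp add: algebra_simps)
  have "0 < (1 - \<epsilon>)" using \<epsilon> by simp
  have re: "r / (1 - \<epsilon>) \<le> r + \<epsilon> * (2 * r)"
    using div_one_minus_le[OF r(1), of \<epsilon>] \<epsilon> by (simp add: algebra_simps)
  obtain TT S where TT: "finite TT" "\<And>T. T \<in> TT \<Longrightarrow> join_rate \<U> T \<le> r \<and> finite T \<and> T \<noteq> {} \<and> T \<subseteq> S"
    and S: "finite S" "S \<subseteq> carrier G"
    and QT: "\<And>(D :: 'a set) \<tau> C. finite D \<Longrightarrow> (\<And>s. s \<in> S \<Longrightarrow> inj_on (\<tau> s) D) \<Longrightarrow>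
       C \<subseteq> goodpts G S \<tau> D \<Longrightarrow> real (card (D - C)) \<le> \<epsilon> / 4 * card D \<Longrightarrow>
       \<exists>PP. quasitiling \<tau> TT \<epsilon> C D PP \<and> (1 - \<epsilon>) * card D \<le> card (covered \<tau> PP)"
    by (rule quasitiling_exists[OF is_group fr \<epsilon>]) blast
  define \<delta> where "\<delta> = \<epsilon> / (4 * (card S + 1))"
  have \<delta>: "0 < \<delta>" using \<epsilon> by (simp add: \<delta>_def add_pos_nonneg)
  have key: "join_rate \<U> F < u"
    if F: "finite F" "F \<noteq> {}" "F \<subseteq> carrier G" and inv: "card ((S <#> F) - F) \<le> \<delta> * card F" for F
  proof -
    \<comment> \<open>A point of \<open>F\<close> outside \<open>C\<close> is moved out of
      \<open>F\<close> by some \<open>s\<close> in \<open>S\<close>, and each \<open>s\<close> does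
      so for at most \<open>card ((S <#> F) - F)\<close> points. The choice of \<delta> keeps the
      sum over \<open>S\<close> below the allowed proportion \<open>\<epsilon> / 4\<close>.\<close>
    define C where "C = {c \<in> F. \<forall>s\<in>S. s \<otimes> c \<in> F}"
    have "card (F - C) \<le> card (\<Union>s\<in>S. {c \<in> F. s \<otimes> c \<notin> F})"
      using F S by (intro card_mono) (auto simp: C_def)
    also have "\<dots> \<le> (\<Sum>s\<in>S. card {c \<in> F. s \<otimes> c \<notin> F})" using S by (intro card_UN_le)
    also have "\<dots> \<le> (\<Sum>s\<in>S. card ((S <#> F) - F))"
    proof (rule sum_mono)
      fix s assume s: "s \<in> S"
      then have "inj_on ((\<otimes>) s) {c \<in> F. s \<otimes> c \<notin> F}"
        using S F by (auto simp: inj_on_def subset_iff)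
      then show "card {c \<in> F. s \<otimes> c \<notin> F} \<le> card ((S <#> F) - F)"
        using F S s by (intro card_inj_on_le[where f = "(\<otimes>) s"] finite_Diff finite_set_mult)
          (auto simp: set_mult_def)
    qed
    finally have "real (card (F - C)) \<le> real (card S * card ((S <#> F) - F))"
      by (intro of_nat_mono) simp
    also have "\<dots> \<le> card S * (\<delta> * card F)" using inv by (simp add: mult_left_mono)
    also have "\<dots> \<le> \<epsilon> / 4 * card F"
    proof -
      have "card S * \<delta> \<le> \<epsilon> / 4"
        using \<epsilon> by (simp add: \<delta>_def divide_simps add_pos_nonneg)
      then show ?thesis using mult_right_mono[of "card S * \<delta>" "\<epsilon>/4" "card F"] by (simp add: mult_ac)
    qed
    finally have FC: "real (card (F - C)) \<le> \<epsilon> / 4 * card F" .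
    have inj: "inj_on ((\<otimes>) s) F" if "s \<in> S" for s
      using that S F by (auto simp: inj_on_def subset_iff)
    have Cg: "C \<subseteq> goodpts G S (\<otimes>) F"
      unfolding C_def by (rule goodpts_mult[OF S(2) F(3)])
    obtain PP where PP: "quasitiling (\<otimes>) TT \<epsilon> C F PP" "(1 - \<epsilon>) * card F \<le> card (covered (\<otimes>) PP)"
      using QT[where \<tau> = "(\<otimes>)", OF F(1) inj Cg FC] by blast
    let ?V = "covered (\<otimes>) PP"
    have VF: "?V \<subseteq> F" and shTT: "\<And>P. P \<in> PP \<Longrightarrow> shape P \<in> TT" and fPP: "finite PP"
      using PP(1) by (auto simp: quasitiling_def)
    have TG: "finite T \<and> T \<noteq> {} \<and> T \<subseteq> carrier G" if "T \<in> TT" for T using TT(2)[OF that] S by auto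
    have Npos: "0 < join_number \<U> T" if "T \<in> TT" for T
      using join_number_pos[of T \<U>] TG[OF that] U X by force
    have "real (join_number \<U> F) \<le> real ((\<Prod>P\<in>PP. join_number \<U> (shape P)) * card \<U> ^ card (F - ?V))"
      using join_number_quasitiling[OF F U PP(1) _ TG] by (intro of_nat_mono) (auto simp: C_def)
    then have "ln (join_number \<U> F) \<le> ln ((\<Prod>P\<in>PP. real (join_number \<U> (shape P))) * real (card \<U>) ^ card (F - ?V))"
      using join_number_pos[OF F U X] by (intro ln_mono) auto
    also have "\<dots> = (\<Sum>P\<in>PP. ln (join_number \<U> (shape P))) + card (F - ?V) * b"
      using Npos shTT c fPP by (simp add: ln_mult prod_pos ln_prod ln_realpow b_def)
    also have "\<dots> \<le> (\<Sum>P\<in>PP. r * card (shape P)) + (\<epsilon> * card F) * b"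
    proof (intro add_mono sum_mono mult_right_mono)
      fix P assume "P \<in> PP"
      then have "join_rate \<U> (shape P) \<le> r" "finite (shape P)" "shape P \<noteq> {}" using TT(2) shTT by blast+
      then show "ln (join_number \<U> (shape P)) \<le> r * card (shape P)"
        by (simp add: join_rate_def pos_divide_le_eq card_gt_0_iff)
    next
      have "card (F - ?V) = card F - card ?V" "card ?V \<le> card F"
        using VF F(1) by (auto intro: card_Diff_subset finite_subset card_mono)
      then have "real (card (F - ?V)) = real (card F) - card ?V" by simp
      then show "real (card (F - ?V)) \<le> \<epsilon> * card F" using PP(2) by (simp add: algebra_simps)
    qed (rule b)
    also have "(\<Sum>P\<in>PP. r * card (shape P)) \<le> r / (1 - \<epsilon>) * card F"
    proof -
      have "(\<Sum>P\<in>PP. real (card (shape P))) \<le> card F / (1 - \<epsilon>)"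
        using sum_card_shape_le(2)[OF PP(1) F(1) \<epsilon>(2,1)] \<open>0 < 1 - \<epsilon>\<close> by (simp add: pos_le_divide_eq mult.commute)
      from mult_left_mono[OF this r(1)] show ?thesis by (simp add: sum_distrib_left)
    qed
    also have "\<dots> \<le> (r + \<epsilon> * (2 * r)) * card F" using re by (intro mult_right_mono) auto
    finally have "ln (join_number \<U> F) \<le> (r + \<epsilon> * (2 * r + b)) * card F"
      by (simp add: algebra_simps)
    then have "join_rate \<U> F \<le> r + \<epsilon> * (2 * r + b)"
      using F by (simp add: join_rate_def pos_divide_le_eq card_gt_0_iff)
    then show ?thesis using eu by linarith
  qed
  show ?thesis
    using eventually_folner_invariant[OF is_group S \<delta>] eventually_folner_basic[OF is_group]
    by eventually_elim (use key in auto)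
qed

text \<open>The limit is the lower limit, taken as the infimum of the set \<open>R\<close> of levels
  that the rate frequently does not exceed. Each such level is eventually an upper bound up to an
  arbitrary excess, by \<open>join_rate_eventually_le\<close>.\<close>

theorem join_rate_tendsto:
  assumes U: "finite \<U>" "open_cover X \<U>" and X: "topspace X \<noteq> {}"
  shows "\<exists>l\<ge>0. (join_rate \<U> \<longlongrightarrow> l) (folner G)"
proof -
  have ev: "eventually (\<lambda>F. 0 \<le> join_rate \<U> F \<and> join_rate \<U> F \<le> ln (card \<U>)) (folner G)"
    using eventually_folner_basic[OF is_group] by eventually_elim (use join_rate_bounds U X in auto)
  note nb = folner_nonbot[OF is_group amenable]
  define R where "R = {r. frequently (\<lambda>F. join_rate \<U> F \<le> r) (folner G)}"
  have R0: "0 \<le> r" if "r \<in> R" for r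
  proof -
    have "frequently (\<lambda>F. join_rate \<U> F \<le> r) (folner G)" using that by (simp add: R_def)
    from frequently_eventually_ex[OF this ev] show ?thesis by force
  qed
  have "ln (card \<U>) \<in> R"
    unfolding R_def using ev nb by (auto intro!: eventually_frequently elim: eventually_mono)
  then have Rne: "R \<noteq> {}" by auto
  have Rb: "bdd_below R" using R0 by (rule bdd_belowI)
  have l0: "0 \<le> Inf R" using Rne R0 by (rule cInf_greatest)
  have "(join_rate \<U> \<longlongrightarrow> Inf R) (folner G)"
  proof (rule order_tendstoI)
    fix y assume "y < Inf R"
    then have "y \<notin> R" using cInf_lower[OF _ Rb] by force
    then show "eventually (\<lambda>F. y < join_rate \<U> F) (folner G)"
      by (simp add: R_def frequently_def not_le)
  next
    fix u assume "Inf R < u"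
    then obtain r where r: "r \<in> R" "r < u" using cInf_lessD[OF Rne] by blast
    then show "eventually (\<lambda>F. join_rate \<U> F < u) (folner G)"
      using join_rate_eventually_le[OF U X _ R0] by (auto simp: R_def)
  qed
  then show ?thesis using l0 by blast
qed

lemma elog_enat_pos: "0 < n \<Longrightarrow> elog (enat n) = ereal (ln (real n))"
  by (simp add: elog_def)

lemma cover_entropy_eq:
  assumes U: "finite \<U>" "open_cover X \<U>" and X: "topspace X \<noteq> {}"
    and l: "(join_rate \<U> \<longlongrightarrow> l) (folner G)"
  shows "cover_entropy G X \<alpha> \<U> = ereal l"
proof -
  let ?f = "\<lambda>F. elog (enat (join_number \<U> F)) / ereal (real (card F))"
  have "eventually (\<lambda>F. ereal (join_rate \<U> F) = ?f F) (folner G)"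
    using eventually_folner_basic[OF is_group]
  proof eventually_elim
    case (elim F)
    then have "1 \<le> join_number \<U> F" using join_number_pos U X by blast
    then show ?case using elim by (simp add: elog_enat_pos join_rate_def card_gt_0_iff)
  qed
  moreover have "((\<lambda>F. ereal (join_rate \<U> F)) \<longlongrightarrow> ereal l) (folner G)" using l by simp
  ultimately have "(?f \<longlongrightarrow> ereal l) (folner G)"
    by (rule Lim_transform_eventually[rotated])
  then show ?thesis
    unfolding cover_entropy_def invariance_limit_iff_tendsto[OF is_group]
    by (intro the_equality) (auto intro: tendsto_unique[OF folner_nonbot[OF is_group amenable]])
qed

end

section \<open>Unital homomorphisms and generating sequences\<close>

lemma continuous_map_euclidean_iff_tendsto:
  "continuous_map X euclidean f \<longleftrightarrow> (\<forall>x\<in>topspace X. (f \<longlongrightarrow> f x) (atin X x))"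
  by (simp add: continuous_map_atin)

lemma C_fun_restrict:
  assumes "continuous_map X euclidean g"
  shows "(\<lambda>x \<in> topspace X. g x) \<in> C_fun X"
  unfolding C_fun_def using continuous_map_eq[OF assms, of "\<lambda>x \<in> topspace X. g x"] by simp

lemma C_fun_continuous: "f \<in> C_fun X \<Longrightarrow> continuous_map X euclidean f"
  by (simp add: C_fun_def)

lemma continuous_map_complex_ops:
  fixes f g :: "'x \<Rightarrow> complex"
  assumes "continuous_map X euclidean f" "continuous_map X euclidean g"
  shows "continuous_map X euclidean (\<lambda>x. f x + g x)" "continuous_map X euclidean (\<lambda>x. f x * g x)"
    "continuous_map X euclidean (\<lambda>x. cnj (f x))"
  using assms unfolding continuous_map_euclidean_iff_tendsto
  by (auto intro!: tendsto_intros tendsto_cnj)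

lemma C_fun_ops:
  assumes "f \<in> C_fun X" "g \<in> C_fun X"
  shows "(\<lambda>x \<in> topspace X. f x + g x) \<in> C_fun X" "(\<lambda>x \<in> topspace X. f x * g x) \<in> C_fun X"
    "(\<lambda>x \<in> topspace X. cnj (f x)) \<in> C_fun X" "(\<lambda>x \<in> topspace X. c * f x) \<in> C_fun X"
proof -
  note f = C_fun_continuous[OF assms(1)] and g = C_fun_continuous[OF assms(2)]
  show "(\<lambda>x \<in> topspace X. f x + g x) \<in> C_fun X" "(\<lambda>x \<in> topspace X. f x * g x) \<in> C_fun X"
    "(\<lambda>x \<in> topspace X. cnj (f x)) \<in> C_fun X"
    by (intro C_fun_restrict continuous_map_complex_ops f g continuous_map_complex_ops(3)[OF f f])+
  have "continuous_map X euclidean (\<lambda>x. c * f x)"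
    by (rule continuous_map_complex_ops(2)[OF _ f]) simp
  then show "(\<lambda>x \<in> topspace X. c * f x) \<in> C_fun X" by (rule C_fun_restrict)
qed

lemma compact_space_finite_index:
  assumes X: "compact_space X" and U: "\<And>x. x \<in> topspace X \<Longrightarrow> openin X (U x) \<and> x \<in> U x"
  obtains K where "finite K" "K \<subseteq> topspace X" "topspace X \<subseteq> (\<Union>x\<in>K. U x)"
proof -
  have "compactin X (topspace X)" using X by (simp add: compact_space_def)
  moreover have "topspace X \<subseteq> \<Union>(U ` topspace X)" using U by auto
  ultimately obtain F where F: "finite F" "F \<subseteq> U ` topspace X" "topspace X \<subseteq> \<Union>F"
    using compactinD[of X "topspace X" "U ` topspace X"] U by auto
  obtain K where "K \<subseteq> topspace X" "finite K" "F = U ` K"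
    using finite_subset_image[OF F(1,2)] by auto
  then show thesis using that[of K] F(3) by simp
qed

text \<open>Otherwise the kernel contains functions \<open>h x\<close> with \<open>h x x \<noteq> 0\<close>, and finitely many of them have no
  common zero; the sum of their squared moduli is an invertible element of the kernel.\<close>

theorem unital_hom_evaluation:
  assumes X: "compact_space X" and \<phi>: "\<phi> \<in> unital_homs X Y" and y: "y \<in> topspace Y"
  shows "\<exists>x \<in> topspace X. \<forall>f \<in> C_fun X. \<phi> f y = f x"
proof (rule ccontr)
  assume neg: "\<not> ?thesis"
  \<comment> \<open>Members of \<open>C_fun X\<close> are restricted to the carrier. Through
    \<open>r\<close>, the functional \<open>E\<close> acts on unrestricted continuous functions, for
    which sums, products and inverses can be written down directly.\<close>
  define r where "r g = (\<lambda>x \<in> topspace X. g x)" for g :: "'a \<Rightarrow> complex"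
  define E where "E g = \<phi> (r g) y" for g
  have rC: "r g \<in> C_fun X" if "continuous_map X euclidean g" for g
    unfolding r_def using that by (rule C_fun_restrict)
  have E1: "E (\<lambda>x. 1) = 1" using \<phi> y by (simp add: unital_homs_def E_def r_def)
  have Eadd: "E (\<lambda>x. f x + g x) = E f + E g"
    if "continuous_map X euclidean f" "continuous_map X euclidean g" for f g
  proof -
    have "\<phi> (\<lambda>x \<in> topspace X. r f x + r g x) y = \<phi> (r f) y + \<phi> (r g) y"
      using \<phi> y rC[OF that(1)] rC[OF that(2)] unfolding unital_homs_def by blast
    moreover have "(\<lambda>x \<in> topspace X. r f x + r g x) = r (\<lambda>x. f x + g x)"
      by (auto simp: r_def)
    ultimately show ?thesis by (simp add: E_def)
  qed
  have Emult: "E (\<lambda>x. f x * g x) = E f * E g"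
    if "continuous_map X euclidean f" "continuous_map X euclidean g" for f g
  proof -
    have "\<phi> (\<lambda>x \<in> topspace X. r f x * r g x) y = \<phi> (r f) y * \<phi> (r g) y"
      using \<phi> y rC[OF that(1)] rC[OF that(2)] unfolding unital_homs_def by blast
    moreover have "(\<lambda>x \<in> topspace X. r f x * r g x) = r (\<lambda>x. f x * g x)"
      by (auto simp: r_def)
    ultimately show ?thesis by (simp add: E_def)
  qed
  have Ecmult: "E (\<lambda>x. c) = c" for c
  proof -
    have "\<phi> (\<lambda>x \<in> topspace X. c * r (\<lambda>x. 1) x) y = c * \<phi> (r (\<lambda>x. 1)) y"
      using \<phi> y rC[of "\<lambda>x. 1"] unfolding unital_homs_def by auto
    moreover have "(\<lambda>x \<in> topspace X. c * r (\<lambda>x. 1) x) = r (\<lambda>x. c)" by (auto simp: r_def)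
    ultimately show ?thesis using E1 by (simp add: E_def)
  qed
  have "\<exists>h. continuous_map X euclidean h \<and> E h = 0 \<and> h x \<noteq> 0" if x: "x \<in> topspace X" for x
  proof -
    obtain f where f: "f \<in> C_fun X" "\<phi> f y \<noteq> f x" using neg x by auto
    have fc: "continuous_map X euclidean f" using f(1) by (rule C_fun_continuous)
    have "r f = f" using f(1) by (simp add: C_fun_def r_def extensional_restrict)
    then have "E f = \<phi> f y" by (simp add: E_def)
    then have "E (\<lambda>x. f x + (- \<phi> f y)) = 0" using Eadd[OF fc, of "\<lambda>x. - \<phi> f y"] Ecmult by simp
    moreover have "continuous_map X euclidean (\<lambda>x. f x + (- \<phi> f y))"
      by (intro continuous_map_complex_ops fc) auto
    ultimately show ?thesis using f(2) by (intro exI[of _ "\<lambda>x. f x + (- \<phi> f y)"]) auto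
  qed
  then obtain h where h: "\<And>x. x \<in> topspace X \<Longrightarrow> continuous_map X euclidean (h x) \<and> E (h x) = 0 \<and> h x x \<noteq> 0"
    by metis
  have "openin X {z \<in> topspace X. h x z \<in> - {0}} \<and> x \<in> {z \<in> topspace X. h x z \<in> - {0}}" if "x \<in> topspace X" for x
    using h[OF that] that by (intro conjI openin_continuous_map_preimage[of X euclidean]) auto
  then obtain K where K: "finite K" "K \<subseteq> topspace X" "topspace X \<subseteq> (\<Union>x\<in>K. {z \<in> topspace X. h x z \<in> - {0}})"
    using compact_space_finite_index[OF X, of "\<lambda>x. {z \<in> topspace X. h x z \<in> - {0}}"] by blast
  define S where "S L z = (\<Sum>x\<in>L. h x z * cnj (h x z))" for L z
  have S: "continuous_map X euclidean (S L) \<and> E (S L) = 0" if "finite L" "L \<subseteq> topspace X" for L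
    using that
  proof (induction L)
    case empty
    then show ?case using Ecmult[of 0] by (simp add: S_def[abs_def])
  next
    case (insert x L)
    have hx: "continuous_map X euclidean (h x)" "E (h x) = 0" using h insert by auto
    have "S (insert x L) = (\<lambda>z. h x z * cnj (h x z) + S L z)"
      using insert by (auto simp: S_def[abs_def])
    moreover have "continuous_map X euclidean (\<lambda>z. h x z * cnj (h x z) + S L z)"
      using insert by (intro continuous_map_complex_ops hx) auto
    moreover have "E (\<lambda>z. h x z * cnj (h x z) + S L z) = E (h x) * E (\<lambda>z. cnj (h x z)) + E (S L)"
      using insert by (subst Eadd) (auto intro!: continuous_map_complex_ops hx Emult)
    ultimately show ?case using insert hx by simp
  qed
  have Sr: "S K z = of_real (\<Sum>x\<in>K. (norm (h x z))\<^sup>2)" for z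
    unfolding S_def of_real_sum complex_norm_square ..
  have Snz: "S K z \<noteq> 0" if "z \<in> topspace X" for z
  proof -
    obtain x where "x \<in> K" "h x z \<noteq> 0" using K(3) \<open>z \<in> topspace X\<close> by auto
    then have "0 < (\<Sum>x\<in>K. (norm (h x z))\<^sup>2)"
      using K(1) by (intro sum_pos2[of K x]) auto
    then show ?thesis unfolding Sr by (simp only: of_real_eq_0_iff)
  qed
  have cS: "continuous_map X euclidean (S K)" "E (S K) = 0" using S K by auto
  have cI: "continuous_map X euclidean (\<lambda>z. inverse (S K z))"
    using cS(1) Snz unfolding continuous_map_euclidean_iff_tendsto by (auto intro!: tendsto_intros)
  have "r (\<lambda>z. S K z * inverse (S K z)) = r (\<lambda>x. 1)"
    unfolding r_def using Snz by (intro restrict_ext) simp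
  then have "E (\<lambda>z. S K z * inverse (S K z)) = 1" using E1 by (simp add: E_def)
  then show False using Emult[OF cS(1) cI] cS(2) by simp
qed

definition point_hom :: "'x topology \<Rightarrow> nat \<Rightarrow> (nat \<Rightarrow> 'x) \<Rightarrow> ('x \<Rightarrow> complex) \<Rightarrow> nat \<Rightarrow> complex" where
  "point_hom X d \<xi> = (\<lambda>f \<in> C_fun X. \<lambda>a \<in> {1..d}. f (\<xi> a))"

lemma point_hom_apply: "f \<in> C_fun X \<Longrightarrow> a \<in> {1..d} \<Longrightarrow> point_hom X d \<xi> f a = f (\<xi> a)"
  by (simp add: point_hom_def)

lemma point_hom_unital:
  assumes "\<xi> \<in> {1..d} \<rightarrow> topspace X"
  shows "point_hom X d \<xi> \<in> unital_homs X (discrete_topology {1..d})"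
proof -
  have C: "(\<lambda>x\<in>topspace X. c) \<in> C_fun X" for c by (rule C_fun_restrict) simp
  have "point_hom X d \<xi> \<in> C_fun X \<rightarrow>\<^sub>E C_fun (discrete_topology {1..d})"
    by (auto simp: point_hom_def C_fun_def)
  then show ?thesis
    unfolding unital_homs_def using assms C by (auto simp: point_hom_apply Pi_iff C_fun_ops)
qed

lemma compact_metrizable_m:
  assumes "metrizable_space X"
  obtains m where "X = mtopology_of m"
proof -
  obtain M d where M: "Metric_space M d" "X = Metric_space.mtopology M d"
    using assms by (auto simp: metrizable_space_def)
  then have "X = mtopology_of (metric (M, d))"
    by (simp add: mtopology_of_def Metric_space.mspace_metric Metric_space.mdist_metric)
  then show thesis by (rule that)
qed

section \<open>Generating sequences and separation of points\<close>

lemma (in amenable_action) induced_action_C_fun: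
  assumes "s \<in> carrier G" "f \<in> C_fun X"
  shows "induced_action G X \<alpha> s f \<in> C_fun X"
proof -
  have "continuous_map X X (\<alpha> (inv s))" using action assms by (simp add: continuous_action_def)
  moreover have "continuous_map X euclidean f" using assms by (simp add: C_fun_def)
  ultimately have "continuous_map X euclidean (f \<circ> \<alpha> (inv s))" by (rule continuous_map_compose)
  then show ?thesis
    using C_fun_restrict[of X "f \<circ> \<alpha> (inv s)"] by (simp add: induced_action_def o_def)
qed

text \<open>The functions that agree at \<open>\<alpha> s x\<close> and \<open>\<alpha> s y\<close>
  for every \<open>s\<close> form an invariant closed subalgebra. It is proper because the distance
  from \<open>x\<close> is not in it, so it cannot contain a generating sequence.\<close>

lemma (in amenable_action) dynamically_generating_separates:
  assumes X: "metrizable_space X" and p: "dynamically_generating G X \<alpha> p" "unit_ball_sequence X p"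
    and xy: "x \<in> topspace X" "y \<in> topspace X" "x \<noteq> y"
  shows "\<exists>s\<in>carrier G. \<exists>n. p n (\<alpha> s x) \<noteq> p n (\<alpha> s y)"
proof (rule ccontr)
  assume neg: "\<not> ?thesis"
  define A where "A = {f \<in> C_fun X. \<forall>s\<in>carrier G. f (\<alpha> s x) = f (\<alpha> s y)}"
  have pC: "p n \<in> C_fun X" for n using p(2) by (simp add: unit_ball_sequence_def)
  note [simp] = act_closed[OF _ xy(1)] act_closed[OF _ xy(2)]
  have "C_star_subalgebra X A"
    unfolding C_star_subalgebra_def
  proof (intro conjI ballI allI impI)
    show "A \<subseteq> C_fun X" by (auto simp: A_def)
    show "(\<lambda>x\<in>topspace X. 1) \<in> A" by (auto simp: A_def intro!: C_fun_restrict)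
    fix f g assume "f \<in> A" "g \<in> A"
    then show "(\<lambda>x\<in>topspace X. f x + g x) \<in> A" "(\<lambda>x\<in>topspace X. f x * g x) \<in> A"
      by (auto simp: A_def C_fun_ops)
  next
    fix c f assume "f \<in> A"
    then show "(\<lambda>x\<in>topspace X. c * f x) \<in> A"
      by (auto simp: A_def C_fun_ops)
  next
    fix f assume "f \<in> A"
    then show "(\<lambda>x\<in>topspace X. cnj (f x)) \<in> A"
      by (auto simp: A_def C_fun_ops)
  next
    fix F f assume f: "f \<in> C_fun X" and F: "(\<forall>n. F n \<in> A) \<and> uniform_limit (topspace X) F f sequentially"
    have "f (\<alpha> s x) = f (\<alpha> s y)" if s: "s \<in> carrier G" for s
    proof (rule LIMSEQ_unique)
      show "(\<lambda>n. F n (\<alpha> s x)) \<longlonglongrightarrow> f (\<alpha> s x)"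
        using F s by (intro tendsto_uniform_limitI[OF conjunct2[OF F]]) simp
      have "(\<lambda>n. F n (\<alpha> s y)) \<longlonglongrightarrow> f (\<alpha> s y)"
        using F s by (intro tendsto_uniform_limitI[OF conjunct2[OF F]]) simp
      then show "(\<lambda>n. F n (\<alpha> s x)) \<longlonglongrightarrow> f (\<alpha> s y)"
        using F s by (simp add: A_def)
    qed
    then show "f \<in> A" using f by (auto simp: A_def)
  qed
  moreover have "A \<noteq> C_fun X"
  proof -
    obtain m where m: "X = mtopology_of m" using compact_metrizable_m[OF X] .
    have xm: "x \<in> mspace m" "y \<in> mspace m" using xy by (auto simp: m)
    have "continuous_map X euclidean (mdist m x)"
      unfolding m by (rule continuous_on_mdist[OF xm(1)])
    then have "continuous_map X euclidean (\<lambda>z. complex_of_real (mdist m x z))"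
      unfolding continuous_map_euclidean_iff_tendsto by (auto intro!: tendsto_of_real)
    then have C: "(\<lambda>z\<in>topspace X. complex_of_real (mdist m x z)) \<in> C_fun X" by (rule C_fun_restrict)
    have "mdist m x x = 0" "mdist m x y \<noteq> 0"
      using xm xy(3) by auto
    then have "(\<lambda>z\<in>topspace X. complex_of_real (mdist m x z)) \<notin> A"
      using xy by (auto simp: A_def act_one intro!: bexI[of _ "\<one>"])
    then show ?thesis using C by blast
  qed
  moreover have "induced_action G X \<alpha> s f \<in> A" if s: "s \<in> carrier G" and f: "f \<in> A" for s f
  proof -
    have "induced_action G X \<alpha> s f \<in> C_fun X"
      using induced_action_C_fun[OF s] f by (simp add: A_def)
    moreover have "induced_action G X \<alpha> s f (\<alpha> t x) = induced_action G X \<alpha> s f (\<alpha> t y)" if t: "t \<in> carrier G" for t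
    proof -
      have "f (\<alpha> (inv s \<otimes> t) x) = f (\<alpha> (inv s \<otimes> t) y)" using f s t by (auto simp: A_def)
      then show ?thesis using s t xy by (simp add: induced_action_def act_mult)
    qed
    ultimately show ?thesis by (auto simp: A_def)
  qed
  moreover have "range p \<subseteq> A" using pC neg by (auto simp: A_def)
  ultimately show False using p(1) unfolding dynamically_generating_def by blast
qed

lemma uniform_limit_restrict_of_real:
  fixes h :: "nat \<Rightarrow> 'y \<Rightarrow> real"
  assumes h: "\<And>n v. v \<in> S \<Longrightarrow> \<bar>g v - h n v\<bar> < 1 / real (Suc n)" and e: "e ` M \<subseteq> S"
  shows "uniform_limit M (\<lambda>n. \<lambda>x\<in>M. complex_of_real (h n (e x))) (\<lambda>x\<in>M. complex_of_real (g (e x))) sequentially"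
  unfolding uniform_limit_iff
proof (intro allI impI)
  fix \<epsilon> :: real assume "0 < \<epsilon>"
  then have "eventually (\<lambda>n. 1 / real (Suc n) < \<epsilon>) sequentially"
    using order_tendstoD(2)[OF LIMSEQ_inverse_real_of_nat] by (simp add: inverse_eq_divide)
  then show "\<forall>\<^sub>F n in sequentially. \<forall>x\<in>M. dist ((\<lambda>x\<in>M. complex_of_real (h n (e x))) x) ((\<lambda>x\<in>M. complex_of_real (g (e x))) x) < \<epsilon>"
  proof eventually_elim
    case (elim n)
    show ?case
    proof
      fix x assume x: "x \<in> M"
      then have "\<bar>g (e x) - h n (e x)\<bar> < \<epsilon>" using h[of "e x" n] e elim by force
      then show "dist ((\<lambda>x\<in>M. complex_of_real (h n (e x))) x) ((\<lambda>x\<in>M. complex_of_real (g (e x))) x) < \<epsilon>"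
        using x by (simp add: dist_norm norm_minus_commute flip: of_real_diff)
    qed
  qed
qed

text \<open>The functions are distances, truncated at 1, from the points of a countable dense set,
  which is the union of finite nets of mesh \<open>1 / Suc k\<close>.\<close>

lemma countable_separating_sequence:
  assumes X: "compact_space X" "metrizable_space X"
  obtains f :: "nat \<Rightarrow> 'x \<Rightarrow> real" where "\<And>n. continuous_map X euclidean (f n)"
    "\<And>n x. x \<in> topspace X \<Longrightarrow> \<bar>f n x\<bar> \<le> 1"
    "\<And>x y. x \<in> topspace X \<Longrightarrow> y \<in> topspace X \<Longrightarrow> x \<noteq> y \<Longrightarrow> \<exists>n. f n x \<noteq> f n y"
proof (cases "topspace X = {}")
  case True
  then show thesis using that[of "\<lambda>_ _. 0"] by auto
next
  case False
  obtain m where m: "X = mtopology_of m" using compact_metrizable_m[OF X(2)] .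
  have top: "topspace X = mspace m" by (simp add: m)
  have cont: "continuous_map X euclidean (mdist m a)" if "a \<in> topspace X" for a
    unfolding m using that top by (intro continuous_on_mdist) auto
  have "\<forall>k. \<exists>K. finite K \<and> K \<subseteq> topspace X \<and> topspace X \<subseteq> (\<Union>a\<in>K. {x \<in> topspace X. mdist m a x \<in> {..<1 / real (Suc k)}})"
  proof
    fix k
    have "openin X {x \<in> topspace X. mdist m a x \<in> {..<1 / real (Suc k)}} \<and>
      a \<in> {x \<in> topspace X. mdist m a x \<in> {..<1 / real (Suc k)}}" if "a \<in> topspace X" for a
    proof -
      have "mdist m a a = 0" using that top by simp
      then show ?thesis
        using that cont[OF that] by (intro conjI openin_continuous_map_preimage[of X euclidean]) auto
    qed
    then obtain K where "finite K" "K \<subseteq> topspace X"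
      "topspace X \<subseteq> (\<Union>a\<in>K. {x \<in> topspace X. mdist m a x \<in> {..<1 / real (Suc k)}})"
      by (rule compact_space_finite_index[OF X(1)])
    then show "\<exists>K. finite K \<and> K \<subseteq> topspace X \<and> topspace X \<subseteq> (\<Union>a\<in>K. {x \<in> topspace X. mdist m a x \<in> {..<1 / real (Suc k)}})"
      by (intro exI[of _ K] conjI)
  qed
  from choice[OF this] obtain K where K: "\<And>k. finite (K k) \<and> K k \<subseteq> topspace X \<and>
    topspace X \<subseteq> (\<Union>a\<in>K k. {x \<in> topspace X. mdist m a x \<in> {..<1 / real (Suc k)}})" by blast
  define Q where "Q = (\<Union>k. K k)"
  have "K 0 \<noteq> {}" using K[of 0] False by blast
  then have Q: "countable Q" "Q \<subseteq> topspace X" "Q \<noteq> {}"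
    using K unfolding Q_def by (blast intro: countable_UN countable_finite)+
  define q where "q = from_nat_into Q"
  have q: "q n \<in> topspace X" for n using Q from_nat_into[of Q n] by (auto simp: q_def)
  show thesis
  proof (rule that[of "\<lambda>n x. min 1 (mdist m (q n) x)"])
    show "continuous_map X euclidean (\<lambda>x. min 1 (mdist m (q n) x))" for n
      using cont[OF q[of n]] unfolding continuous_map_euclidean_iff_tendsto
      by (auto intro!: tendsto_min)
    show "\<bar>min 1 (mdist m (q n) x)\<bar> \<le> 1" if "x \<in> topspace X" for n x
      by (auto simp: min_def)
    fix x y assume xy: "x \<in> topspace X" "y \<in> topspace X" "x \<noteq> y"
    then have pos: "0 < mdist m x y" using top by (auto simp: less_le)
    \<comment> \<open>A net point closer than \<open>e\<close> to \<open>x\<close> is farther than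
      \<open>e\<close> from \<open>y\<close>, and \<open>e < 1\<close> ensures that the truncation
      does not hide the difference.\<close>
    define e where "e = min 1 (mdist m x y) / 2"
    have e: "0 < e" "2 * e \<le> mdist m x y" "2 * e \<le> 1" using pos by (auto simp: e_def)
    obtain k where k: "1 / real (Suc k) < e"
      using reals_Archimedean[OF e(1)] by (auto simp: inverse_eq_divide)
    obtain a where a: "a \<in> K k" "mdist m a x < 1 / real (Suc k)" using K[of k] xy(1) by auto
    obtain n where n: "q n = a"
      using from_nat_into_surj[OF Q(1), of a] a(1) by (auto simp: Q_def q_def)
    have aX: "a \<in> mspace m" using q[of n] n top by simp
    have "mdist m x y \<le> mdist m x a + mdist m a y"
      using xy aX top by (intro mdist_triangle) auto
    then have "mdist m x y \<le> mdist m a x + mdist m a y"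
      by (simp add: mdist_commute)
    then have "mdist m a x < e" "e < mdist m a y" "e < 1" using a(2) k e by linarith+
    then have "min 1 (mdist m (q n) x) \<noteq> min 1 (mdist m (q n) y)" unfolding n by (auto simp: min_def)
    then show "\<exists>n. min 1 (mdist m (q n) x) \<noteq> min 1 (mdist m (q n) y)" by blast
  qed
qed

text \<open>A separating sequence embeds the compact space \<open>X\<close> into
  \<open>nat \<Rightarrow> real\<close>. Stone-Weierstrass is applied on the image \<open>S\<close>,
  and the approximation is pulled back to \<open>X\<close>. The result makes the set under
  \<open>the_elem\<close> in \<open>sofic_entropy\<close> nonempty.\<close>

theorem generating_sequence_exists:
  assumes X: "compact_space X" "metrizable_space X"
  shows "\<exists>p. unit_ball_sequence X p \<and> (\<forall>A. C_star_subalgebra X A \<longrightarrow> range p \<subseteq> A \<longrightarrow> A = C_fun X)"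
proof -
  obtain f :: "nat \<Rightarrow> 'a \<Rightarrow> real" where f: "\<And>n. continuous_map X euclidean (f n)"
    "\<And>n x. x \<in> topspace X \<Longrightarrow> \<bar>f n x\<bar> \<le> 1"
    "\<And>x y. x \<in> topspace X \<Longrightarrow> y \<in> topspace X \<Longrightarrow> x \<noteq> y \<Longrightarrow> \<exists>n. f n x \<noteq> f n y"
    using countable_separating_sequence[OF X] by blast
  define p where "p n = (\<lambda>x\<in>topspace X. complex_of_real (f n x))" for n
  have ofr: "continuous_map X euclidean (\<lambda>x. complex_of_real (g x))" if "continuous_map X euclidean g" for g
    using that unfolding continuous_map_euclidean_iff_tendsto by (auto intro!: tendsto_of_real)
  have "unit_ball_sequence X p"
    unfolding unit_ball_sequence_def using f(1,2) by (auto simp: p_def intro!: C_fun_restrict ofr)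
  moreover have "A = C_fun X" if A: "C_star_subalgebra X A" and pA: "range p \<subseteq> A" for A
  proof
    show "A \<subseteq> C_fun X" using A by (simp add: C_star_subalgebra_def)
    have Aone: "(\<lambda>x \<in> topspace X. 1) \<in> A"
      and Aadd: "\<And>f g. f \<in> A \<Longrightarrow> g \<in> A \<Longrightarrow> (\<lambda>x \<in> topspace X. f x + g x) \<in> A"
      and Amult: "\<And>f g. f \<in> A \<Longrightarrow> g \<in> A \<Longrightarrow> (\<lambda>x \<in> topspace X. f x * g x) \<in> A"
      and Asmult: "\<And>c f. f \<in> A \<Longrightarrow> (\<lambda>x \<in> topspace X. c * f x) \<in> A"
      and Alim: "\<And>F f. f \<in> C_fun X \<Longrightarrow> (\<And>n. F n \<in> A) \<Longrightarrow> uniform_limit (topspace X) F f sequentially \<Longrightarrow> f \<in> A"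
      using A unfolding C_star_subalgebra_def by blast+
    define e :: "'a \<Rightarrow> nat \<Rightarrow> real" where "e x n = f n x" for x n
    define S where "S = e ` topspace X"
    have e: "continuous_map X euclidean e"
      unfolding euclidean_product_topology[symmetric] continuous_map_componentwise_UNIV
      using f(1) by (simp add: e_def[abs_def])
    have inj: "inj_on e (topspace X)"
    proof (rule inj_onI, rule ccontr)
      fix x y assume xy: "x \<in> topspace X" "y \<in> topspace X" "e x = e y" "x \<noteq> y"
      then obtain n where "f n x \<noteq> f n y" using f(3) by blast
      then show False using fun_cong[OF xy(3), of n] by (simp add: e_def)
    qed
    have cS: "compact S"
      using image_compactin[OF _ e, of "topspace X"] X(1) by (simp add: S_def compact_space_def)
    have eS: "continuous_map X (top_of_set S) e"
      using e by (simp add: continuous_map_in_subtopology S_def)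
    have "homeomorphic_map X (top_of_set S) e"
      using inj by (intro continuous_imp_homeomorphic_map eS X(1) Hausdorff_space_subtopology Hausdorff_space_euclidean)
        (auto simp: S_def)
    then obtain e' where e': "homeomorphic_maps X (top_of_set S) e e'"
      using homeomorphic_map_maps by blast
    then have ce': "continuous_map (top_of_set S) X e'" and e'e: "\<And>x. x \<in> topspace X \<Longrightarrow> e' (e x) = x"
      by (auto simp: homeomorphic_maps_def)
    \<comment> \<open>\<open>R\<close> consists of the functions on \<open>S\<close> whose pull-back
      lies in \<open>A\<close>. It contains the coordinates, which pull back to the functions
      \<open>p n\<close>, and inherits the ring operations from \<open>A\<close>.\<close>
    define R where "R = {g. continuous_on S g \<and> (\<lambda>x\<in>topspace X. complex_of_real (g (e x))) \<in> A}"
    interpret R: function_ring_on R S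
    proof
      show "compact S" by fact
      show "continuous_on S g" if "g \<in> R" for g using that by (simp add: R_def)
      define cc where "cc g = (\<lambda>x\<in>topspace X. complex_of_real (g (e x)))" for g :: "(nat \<Rightarrow> real) \<Rightarrow> real"
      have cc: "cc g \<in> A" if "g \<in> R" for g using that by (simp add: R_def cc_def)
      show "(\<lambda>x. g x + h x) \<in> R" if gh: "g \<in> R" "h \<in> R" for g h
      proof -
        have "(\<lambda>x\<in>topspace X. cc g x + cc h x) \<in> A" by (rule Aadd[OF cc[OF gh(1)] cc[OF gh(2)]])
        also have "(\<lambda>x\<in>topspace X. cc g x + cc h x) = (\<lambda>x\<in>topspace X. complex_of_real (g (e x) + h (e x)))"
          by (intro restrict_ext) (simp add: cc_def)
        finally show ?thesis
          using gh unfolding R_def mem_Collect_eq by (intro conjI continuous_on_add) blast+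
      qed
      show "(\<lambda>x. g x * h x) \<in> R" if gh: "g \<in> R" "h \<in> R" for g h
      proof -
        have "(\<lambda>x\<in>topspace X. cc g x * cc h x) \<in> A" by (rule Amult[OF cc[OF gh(1)] cc[OF gh(2)]])
        also have "(\<lambda>x\<in>topspace X. cc g x * cc h x) = (\<lambda>x\<in>topspace X. complex_of_real (g (e x) * h (e x)))"
          by (intro restrict_ext) (simp add: cc_def)
        finally show ?thesis
          using gh unfolding R_def mem_Collect_eq by (intro conjI continuous_on_mult) blast+
      qed
      show "(\<lambda>_. c) \<in> R" for c
      proof -
        have "(\<lambda>x\<in>topspace X. complex_of_real c * (\<lambda>x\<in>topspace X. 1) x) \<in> A" by (rule Asmult[OF Aone])
        also have "(\<lambda>x\<in>topspace X. complex_of_real c * (\<lambda>x\<in>topspace X. 1) x) = (\<lambda>x\<in>topspace X. complex_of_real c)"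
          by (intro restrict_ext) simp
        finally show ?thesis unfolding R_def mem_Collect_eq by (intro conjI continuous_on_const)
      qed
      fix u v assume "u \<in> S" "v \<in> S" "u \<noteq> v"
      then obtain n where n: "u n \<noteq> v n" by auto
      have "(\<lambda>w. w n) \<in> R"
        using pA continuous_on_subset[OF continuous_on_product_coordinates, of S n]
        by (auto simp: R_def e_def p_def)
      then show "\<exists>g\<in>R. g u \<noteq> g v" using n by (intro bexI[of _ "\<lambda>w. w n"])
    qed
    have real: "(\<lambda>x\<in>topspace X. complex_of_real (g x)) \<in> A" if g: "continuous_map X euclidean g" for g
    proof -
      have cg: "continuous_on S (g \<circ> e')"
        using continuous_map_compose[OF ce' g] by simp
      have "\<exists>h\<in>R. \<forall>v\<in>S. \<bar>(g \<circ> e') v - h v\<bar> < 1 / real (Suc n)" for n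
        by (rule R.Stone_Weierstrass_basic[OF cg]) simp
      then obtain h where h: "\<And>n. h n \<in> R" "\<And>n v. v \<in> S \<Longrightarrow> \<bar>(g \<circ> e') v - h n v\<bar> < 1 / real (Suc n)"
        by metis
      have "uniform_limit (topspace X) (\<lambda>n. \<lambda>x\<in>topspace X. complex_of_real (h n (e x)))
        (\<lambda>x\<in>topspace X. complex_of_real ((g \<circ> e') (e x))) sequentially"
        using h(2) by (intro uniform_limit_restrict_of_real[of S]) (auto simp: S_def)
      moreover have "(\<lambda>x\<in>topspace X. complex_of_real ((g \<circ> e') (e x))) = (\<lambda>x\<in>topspace X. complex_of_real (g x))"
        using e'e by (auto intro!: restrict_ext)
      ultimately have lim: "uniform_limit (topspace X) (\<lambda>n. \<lambda>x\<in>topspace X. complex_of_real (h n (e x)))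
        (\<lambda>x\<in>topspace X. complex_of_real (g x)) sequentially" by simp
      have hA: "(\<lambda>x\<in>topspace X. complex_of_real (h n (e x))) \<in> A" for n
        using h(1)[of n] by (simp only: R_def mem_Collect_eq)
      show ?thesis
        by (rule Alim[OF C_fun_restrict[OF ofr[OF g]] hA lim])
    qed
    show "C_fun X \<subseteq> A"
    proof
      fix g assume g: "g \<in> C_fun X"
      have c: "continuous_map X euclidean g" using g by (rule C_fun_continuous)
      have "continuous_map X euclidean (\<lambda>x. Re (g x))" "continuous_map X euclidean (\<lambda>x. Im (g x))"
        using c unfolding continuous_map_euclidean_iff_tendsto by (auto intro!: tendsto_intros)
      then have RI: "(\<lambda>x\<in>topspace X. complex_of_real (Re (g x))) \<in> A" "(\<lambda>x\<in>topspace X. complex_of_real (Im (g x))) \<in> A"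
        using real by blast+
      define u where "u = (\<lambda>x\<in>topspace X. complex_of_real (Re (g x)))"
      define v where "v = (\<lambda>x\<in>topspace X. complex_of_real (Im (g x)))"
      define w where "w = (\<lambda>x\<in>topspace X. \<i> * v x)"
      have uA: "u \<in> A" and vA: "v \<in> A" unfolding u_def v_def by (rule RI)+
      have wA: "w \<in> A" unfolding w_def by (rule Asmult[OF vA])
      have "(\<lambda>x\<in>topspace X. u x + w x) \<in> A" by (rule Aadd[OF uA wA])
      also have "(\<lambda>x\<in>topspace X. u x + w x) = (\<lambda>x\<in>topspace X. g x)"
        by (intro restrict_ext) (simp add: u_def v_def w_def complex_eq_iff)
      also have "\<dots> = g" using g by (simp add: C_fun_def extensional_restrict)
      finally show "g \<in> A" .
    qed
  qed
  ultimately show ?thesis by blast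
qed

section \<open>Counting estimates and sofic approximations\<close>

abbreviation separated :: "('y \<Rightarrow> 'y \<Rightarrow> real) \<Rightarrow> real \<Rightarrow> 'y set \<Rightarrow> bool" where
  "separated \<rho> \<epsilon> A \<equiv> \<forall>x\<in>A. \<forall>y\<in>A. x \<noteq> y \<longrightarrow> \<epsilon> \<le> \<rho> x y"

section \<open>Estimates for the weighted 2-norms\<close>

lemma norm2_nonneg: "0 \<le> norm2 d f"
  by (simp add: norm2_def sum_nonneg)

lemma norm2_cong: "(\<And>a. a \<in> {1..d} \<Longrightarrow> f a = g a) \<Longrightarrow> norm2 d f = norm2 d g"
  unfolding norm2_def by (metis (mono_tags, lifting) sum.cong)

lemma norm2_le_exceptional:
  assumes d: "0 < d" and Z: "Z \<subseteq> {1..d}" "real (card Z) \<le> \<zeta> * d"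
    and c: "\<And>a. a \<in> Z \<Longrightarrow> norm (f a) \<le> c" and r: "\<And>a. a \<in> {1..d} - Z \<Longrightarrow> norm (f a) \<le> r"
    and "0 \<le> r"
  shows "norm2 d f \<le> sqrt (r\<^sup>2 + c\<^sup>2 * \<zeta>)"
proof -
  have fZ: "finite Z" using Z by (auto intro: finite_subset)
  have "(\<Sum>a=1..d. (norm (f a))\<^sup>2) = (\<Sum>a\<in>{1..d} - Z. (norm (f a))\<^sup>2) + (\<Sum>a\<in>Z. (norm (f a))\<^sup>2)"
    using Z by (intro sum.subset_diff) auto
  also have "\<dots> \<le> (\<Sum>a\<in>{1..d} - Z. r\<^sup>2) + (\<Sum>a\<in>Z. c\<^sup>2)"
    using c r by (intro add_mono sum_mono power_mono) auto
  also have "\<dots> \<le> r\<^sup>2 * d + c\<^sup>2 * card Z"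
  proof -
    have "card ({1..d} - Z) \<le> card {1..d}" by (intro card_mono) auto
    then have "real (card ({1..d} - Z)) * r\<^sup>2 \<le> real d * r\<^sup>2" by (intro mult_right_mono) auto
    then show ?thesis by (simp add: mult.commute)
  qed
  also have "\<dots> \<le> r\<^sup>2 * d + c\<^sup>2 * (\<zeta> * d)"
    using Z(2) by (intro add_left_mono mult_left_mono) auto
  finally have "1 / real d * (\<Sum>a=1..d. (norm (f a))\<^sup>2) \<le> r\<^sup>2 + c\<^sup>2 * \<zeta>"
    using d by (simp add: divide_le_eq algebra_simps)
  then show ?thesis unfolding norm2_def by (rule real_sqrt_le_mono)
qed

lemma norm2_le:
  assumes "0 < d" "\<And>a. a \<in> {1..d} \<Longrightarrow> norm (f a) \<le> r" "0 \<le> r"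
  shows "norm2 d f \<le> r"
  using norm2_le_exceptional[of d "{}" 0 f 0 r] assms by simp

lemma summable_weighted_norm2:
  assumes d: "0 < d" and b: "\<And>n a. a \<in> {1..d} \<Longrightarrow> norm (v n a) \<le> c" and c: "0 \<le> c"
  shows "summable (\<lambda>n. (1/2) ^ Suc n * norm2 d (v n))"
proof (rule summable_comparison_test)
  have nb: "norm2 d (v n) \<le> c" for n by (rule norm2_le[OF d b c])
  have "norm ((1/2) ^ Suc n * norm2 d (v n)) \<le> (1/2) ^ Suc n * c" for n
    using nb[of n] norm2_nonneg[of d "v n"] by (simp add: abs_mult mult_left_mono del: power_Suc)
  then show "\<exists>N. \<forall>n\<ge>N. norm ((1/2) ^ Suc n * norm2 d (v n)) \<le> (1/2) ^ Suc n * c" by blast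
  show "summable (\<lambda>n. (1/2) ^ Suc n * c)"
    using power_half_series by (intro summable_mult2) (auto simp: sums_iff)
qed

text \<open>Only the first \<open>M\<close> terms need to be small off the exceptional set
  \<open>Z\<close>. All later terms together have weight \<open>(1/2) ^ M\<close>, so the trivial
  bound \<open>c\<close> is enough for them.\<close>

lemma weighted_norm2_le:
  assumes d: "0 < d" and b: "\<And>n a. a \<in> {1..d} \<Longrightarrow> norm (v n a) \<le> c" and c: "0 \<le> c"
    and Z: "Z \<subseteq> {1..d}" "real (card Z) \<le> \<zeta> * d"
    and r: "\<And>n a. n < M \<Longrightarrow> a \<in> {1..d} - Z \<Longrightarrow> norm (v n a) \<le> r" "0 \<le> r"
  shows "(\<Sum>n. (1/2) ^ Suc n * norm2 d (v n)) \<le> sqrt (r\<^sup>2 + c\<^sup>2 * \<zeta>) + c * (1/2) ^ M"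
proof -
  let ?f = "\<lambda>n. (1/2) ^ Suc n * norm2 d (v n)" and ?q = "sqrt (r\<^sup>2 + c\<^sup>2 * \<zeta>)"
  have nb: "norm2 d (v n) \<le> c" for n by (rule norm2_le[OF d b c])
  have half: "(\<lambda>n. (1/2) ^ Suc n) sums (1::real)" by (rule power_half_series)
  have sm: "summable ?f" by (rule summable_weighted_norm2[OF d b c])
  have "0 \<le> \<zeta> * d" using Z(2) by linarith
  then have q: "0 \<le> ?q" using d by (simp add: zero_le_mult_iff)
  have "suminf ?f = (\<Sum>n. ?f (n + M)) + (\<Sum>n<M. ?f n)"
    by (rule suminf_split_initial_segment[OF sm])
  also have "(\<Sum>n<M. ?f n) \<le> (\<Sum>n<M. (1/2) ^ Suc n * ?q)"
    using r Z b by (intro sum_mono mult_left_mono norm2_le_exceptional[OF d]) auto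
  also have "\<dots> = (\<Sum>n<M. (1/2) ^ Suc n) * ?q" by (simp add: sum_distrib_right)
  also have "\<dots> \<le> 1 * ?q"
  proof (rule mult_right_mono[OF _ q])
    have "(\<Sum>n<M. (1/2) ^ Suc n) \<le> (\<Sum>n. (1/2) ^ Suc n :: real)"
      using half by (intro sum_le_suminf) (auto simp: sums_iff)
    then show "(\<Sum>n<M. (1/2) ^ Suc n :: real) \<le> 1" using half by (simp add: sums_iff)
  qed
  also have "(\<Sum>n. ?f (n + M)) \<le> (\<Sum>n. (1/2) ^ Suc n * (c * (1/2) ^ M))"
  proof (rule suminf_le)
    show "?f (n + M) \<le> (1/2) ^ Suc n * (c * (1/2) ^ M)" for n
      using nb[of "n + M"] by (simp add: power_add mult_left_mono)
    show "summable (\<lambda>n. ?f (n + M))" by (rule summable_ignore_initial_segment[OF sm])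
    show "summable (\<lambda>n. (1/2) ^ Suc n * (c * (1/2) ^ M))"
      using half by (intro summable_mult2) (auto simp: sums_iff)
  qed
  also have "\<dots> = c * (1/2) ^ M"
    using sums_mult2[OF half, of "c * (1/2) ^ M"] by (simp add: sums_iff)
  finally show ?thesis by simp
qed

text \<open>Chebyshev's inequality for the single term \<open>n\<close>, whose weight is at least
  \<open>(1/2) ^ M\<close>. It converts a small value of \<open>rho2\<close> into smallness at most
  points.\<close>

lemma weighted_norm2_card_large:
  assumes d: "0 < d" and b: "\<And>n a. a \<in> {1..d} \<Longrightarrow> norm (v n a) \<le> c" and c: "0 \<le> c"
    and e: "(\<Sum>n. (1/2) ^ Suc n * norm2 d (v n)) < e" and n: "n < M" and r: "0 < r"
  shows "real (card {a \<in> {1..d}. r \<le> norm (v n a)}) \<le> (2 ^ M * e / r)\<^sup>2 * d"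
proof -
  let ?f = "\<lambda>n. (1/2) ^ Suc n * norm2 d (v n)" and ?B = "{a \<in> {1..d}. r \<le> norm (v n a)}"
  have sm: "summable ?f" by (rule summable_weighted_norm2[OF d b c])
  have "(\<Sum>k\<in>{n}. ?f k) \<le> suminf ?f"
    using sm by (rule sum_le_suminf) (auto simp: norm2_nonneg)
  then have "(1/2) ^ Suc n * norm2 d (v n) < e" using e by simp
  then have "2 ^ Suc n * ((1/2) ^ Suc n * norm2 d (v n)) \<le> 2 ^ Suc n * e"
    by (intro mult_left_mono) auto
  moreover have "2 ^ Suc n * ((1/2) ^ Suc n * norm2 d (v n)) = norm2 d (v n)"
    by (simp add: power_divide)
  ultimately have "norm2 d (v n) \<le> 2 ^ Suc n * e" by (simp only:)
  also have "\<dots> \<le> 2 ^ M * e"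
  proof (rule mult_right_mono)
    have "0 \<le> suminf ?f" using sm by (intro suminf_nonneg) (auto simp: norm2_nonneg)
    then show "0 \<le> e" using e by linarith
    show "(2::real) ^ Suc n \<le> 2 ^ M" using n by (intro power_increasing) auto
  qed
  finally have "(norm2 d (v n))\<^sup>2 \<le> (2 ^ M * e)\<^sup>2" by (intro power_mono norm2_nonneg)
  then have le: "(\<Sum>a=1..d. (norm (v n a))\<^sup>2) \<le> (2 ^ M * e)\<^sup>2 * d"
    using d by (simp add: norm2_def sum_nonneg divide_le_eq)
  have "r\<^sup>2 * card ?B = (\<Sum>a\<in>?B. r\<^sup>2)" by simp
  also have "\<dots> \<le> (\<Sum>a\<in>?B. (norm (v n a))\<^sup>2)"
    using r by (intro sum_mono power_mono) auto
  also have "\<dots> \<le> (\<Sum>a=1..d. (norm (v n a))\<^sup>2)" by (intro sum_mono2) auto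
  finally have "r\<^sup>2 * card ?B \<le> (2 ^ M * e)\<^sup>2 * d" using le by linarith
  then show ?thesis using r by (simp add: power_divide field_simps)
qed

section \<open>Counting subsets of small density\<close>

lemma sum_power_card_Pow:
  fixes x :: "'c::comm_semiring_1"
  assumes "finite A"
  shows "(\<Sum>B\<in>Pow A. x ^ card B) = (1 + x) ^ card A"
  using prod_add[OF assms, of "\<lambda>_. x" "\<lambda>_. 1"] by (simp add: add.commute)

text \<open>Chernoff's method: each subset \<open>B\<close> is weighted by \<open>x ^ card B\<close> with \<open>x \<le> \<kappa> / 2\<close>.\<close>

lemma few_small_subsets:
  fixes \<kappa> :: real
  assumes \<kappa>: "0 < \<kappa>"
  obtains \<theta>0 :: real where "0 < \<theta>0"
    "\<And>\<theta> (D :: 'c set). \<theta> \<le> \<theta>0 \<Longrightarrow> finite D \<Longrightarrow>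
      real (card {B \<in> Pow D. real (card B) \<le> \<theta> * card D}) \<le> exp (\<kappa> * card D)"
proof -
  define x where "x = min 1 (\<kappa> / 2)"
  have x: "0 < x" "x \<le> 1" "x \<le> \<kappa> / 2" using \<kappa> by (auto simp: x_def)
  define y where "y = - ln x"
  have y: "0 \<le> y" using x by (simp add: y_def)
  \<comment> \<open>The factors \<open>(1 + x) ^ card D\<close> and
    \<open>exp (y * (\<theta> * card D))\<close> each receive half of the exponent; \<theta> is made
    for the second one, with \<open>y + 1\<close> because \<open>y\<close> may be 0.\<close>
  define \<theta> where "\<theta> = \<kappa> / (2 * (y + 1))"
  have \<theta>: "0 < \<theta>" using \<kappa> y by (simp add: \<theta>_def)
  have "\<theta> * (y + 1) = \<kappa> / 2" using y by (simp add: \<theta>_def field_simps)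
  then have ty: "\<theta> * y \<le> \<kappa> / 2" using \<theta> by (simp add: algebra_simps)
  have small: "real (card {B \<in> Pow D. real (card B) \<le> \<theta> * card D}) \<le> exp (\<kappa> * card D)"
    if D: "finite D" for D :: "'c set"
  proof -
    let ?S = "{B \<in> Pow D. real (card B) \<le> \<theta> * card D}"
    have "real (card ?S) = (\<Sum>B\<in>?S. 1)" by simp
    also have "\<dots> \<le> (\<Sum>B\<in>?S. x ^ card B * exp (y * (\<theta> * card D)))"
    proof (rule sum_mono)
      fix B assume B: "B \<in> ?S"
      have "x ^ card B = exp (- y * card B)"
        using x by (simp add: y_def exp_of_nat2_mult)
      then have "x ^ card B * exp (y * (\<theta> * card D)) = exp (y * (\<theta> * card D - card B))"
        by (simp add: algebra_simps flip: exp_add)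
      moreover have "0 \<le> y * (\<theta> * card D - card B)" using B y by (intro mult_nonneg_nonneg) auto
      ultimately show "1 \<le> x ^ card B * exp (y * (\<theta> * card D))" by simp
    qed
    also have "\<dots> \<le> (\<Sum>B\<in>Pow D. x ^ card B * exp (y * (\<theta> * card D)))"
      using D x by (intro sum_mono2) auto
    also have "\<dots> = (1 + x) ^ card D * exp (y * (\<theta> * card D))"
      unfolding sum_distrib_right[symmetric] sum_power_card_Pow[OF D] ..
    also have "\<dots> \<le> exp (x * card D) * exp (y * (\<theta> * card D))"
    proof (rule mult_right_mono)
      have "(1 + x) ^ card D \<le> exp x ^ card D" using x by (intro power_mono) auto
      also have "\<dots> = exp (x * card D)" by (simp add: exp_of_nat2_mult)
      finally show "(1 + x) ^ card D \<le> exp (x * card D)" .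
    qed simp
    also have "\<dots> = exp ((x + \<theta> * y) * card D)" by (simp add: algebra_simps flip: exp_add)
    also have "\<dots> \<le> exp (\<kappa> * card D)"
      using x ty by (simp add: mult_right_mono)
    finally show ?thesis .
  qed
  show thesis
  proof (rule that[OF \<theta>])
    fix \<theta>' and D :: "'c set" assume "\<theta>' \<le> \<theta>" and D: "finite D"
    then have "\<theta>' * card D \<le> \<theta> * card D" by (intro mult_right_mono) auto
    then have "card {B \<in> Pow D. real (card B) \<le> \<theta>' * card D} \<le> card {B \<in> Pow D. real (card B) \<le> \<theta> * card D}"
      using D by (intro card_mono) auto
    then show "real (card {B \<in> Pow D. real (card B) \<le> \<theta>' * card D}) \<le> exp (\<kappa> * card D)"
      using small[OF D] by linarith
  qed
qed

text \<open>A point fails to be good only through a coincidence or a failure of multiplicativity for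
  some pair from \<open>S\<close>, as permutations keep it inside \<open>{1..d i}\<close>. Each of
  these finitely many failures has density tending to 0.\<close>

lemma sofic_goodpts:
  fixes G (structure) and \<theta> :: real
  assumes G: "group G" and so: "sofic_approximation G d \<sigma>" and S: "finite S" "S \<subseteq> carrier G" and \<theta>: "0 < \<theta>"
  shows "\<forall>\<^sub>F i in sequentially. 0 < d i \<and> (\<forall>s\<in>carrier G. \<sigma> i s permutes {1..d i}) \<and>
    real (card ({1..d i} - goodpts G S (\<sigma> i) {1..d i})) \<le> \<theta> * d i"
proof -
  interpret group G by fact
  have "\<sigma> i \<in> carrier G \<rightarrow> carrier (sym_group (d i))" for i
    using so by (simp only: sofic_approximation_def)
  then have "\<sigma> i s \<in> carrier (sym_group (d i))" if "s \<in> carrier G" for i s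
    using that by (rule funcset_mem)
  then have perm: "\<sigma> i s permutes {1..d i}" if "s \<in> carrier G" for i s
    using that by (simp only: sym_group_carrier)
  have lim1: "\<forall>s \<in> carrier G. \<forall>t \<in> carrier G. s \<noteq> t \<longrightarrow>
        (\<lambda>i. real (card {a \<in> {1..d i}. \<sigma> i s a \<noteq> \<sigma> i t a}) / real (d i)) \<longlonglongrightarrow> 1"
    and lim2: "\<forall>s \<in> carrier G. \<forall>t \<in> carrier G.
        (\<lambda>i. real (card {a \<in> {1..d i}. \<sigma> i (s \<otimes> t) a = \<sigma> i s (\<sigma> i t a)}) / real (d i))
          \<longlonglongrightarrow> 1"
    using so[unfolded sofic_approximation_def, THEN conjunct2, THEN conjunct2] by (rule conjunct2, rule conjunct1)
  have dinf: "filterlim d at_top sequentially" using so by (simp add: sofic_approximation_def)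
  then have "\<forall>\<^sub>F i in sequentially. 1 \<le> d i" unfolding filterlim_at_top by blast
  then have dpos: "\<forall>\<^sub>F i in sequentially. 0 < d i" by (rule eventually_mono) simp
  \<comment> \<open>For \<open>s = t\<close> a coincidence is no failure; the value 0 there allows
    the sum to run over all pairs.\<close>
  define g1 where "g1 s t i = (if s = t then 0 else 1 - real (card {a \<in> {1..d i}. \<sigma> i s a \<noteq> \<sigma> i t a}) / real (d i))" for s t i
  define g2 where "g2 s t i = 1 - real (card {a \<in> {1..d i}. \<sigma> i (s \<otimes> t) a = \<sigma> i s (\<sigma> i t a)}) / real (d i)" for s t i
  have g1: "(\<lambda>i. g1 s t i) \<longlonglongrightarrow> 0" if "s \<in> S" "t \<in> S" for s t
  proof (cases "s = t")
    case False
    then have "(\<lambda>i. real (card {a \<in> {1..d i}. \<sigma> i s a \<noteq> \<sigma> i t a}) / real (d i)) \<longlonglongrightarrow> 1"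
      using lim1 that S by blast
    from tendsto_diff[OF tendsto_const[of 1] this] show ?thesis using False by (simp add: g1_def)
  qed (simp add: g1_def)
  have g2: "(\<lambda>i. g2 s t i) \<longlonglongrightarrow> 0" if "s \<in> S" "t \<in> S" for s t
  proof -
    have "(\<lambda>i. real (card {a \<in> {1..d i}. \<sigma> i (s \<otimes> t) a = \<sigma> i s (\<sigma> i t a)}) / real (d i)) \<longlonglongrightarrow> 1"
      using lim2 that S by blast
    from tendsto_diff[OF tendsto_const[of 1] this] show ?thesis by (simp add: g2_def)
  qed
  have "(\<lambda>i. \<Sum>s\<in>S. \<Sum>t\<in>S. g1 s t i + g2 s t i) \<longlonglongrightarrow> (\<Sum>s\<in>S. \<Sum>t\<in>S. 0 + 0)"
    by (intro tendsto_sum tendsto_add g1 g2)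
  then have "\<forall>\<^sub>F i in sequentially. (\<Sum>s\<in>S. \<Sum>t\<in>S. g1 s t i + g2 s t i) < \<theta>"
    using \<theta> by (intro order_tendstoD(2)) auto
  then show ?thesis using dpos
  proof eventually_elim
    case (elim i)
    let ?D = "{1..d i}"
    have compl: "real (card {a \<in> ?D. \<not> P a}) = d i * (1 - real (card {a \<in> ?D. P a}) / d i)" for P
    proof -
      have "card ?D = card ({a \<in> ?D. P a} \<union> {a \<in> ?D. \<not> P a})"
        by (rule arg_cong[where f = card]) auto
      also have "\<dots> = card {a \<in> ?D. P a} + card {a \<in> ?D. \<not> P a}"
        by (intro card_Un_disjoint) auto
      finally have "real (d i) = card {a \<in> ?D. P a} + real (card {a \<in> ?D. \<not> P a})" by simp
      then show ?thesis using elim(2) by (simp add: field_simps)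
    qed
    define b1 where "b1 s t = {a \<in> ?D. s \<noteq> t \<and> \<sigma> i s a = \<sigma> i t a}" for s t
    define b2 where "b2 s t = {a \<in> ?D. \<sigma> i (s \<otimes> t) a \<noteq> \<sigma> i s (\<sigma> i t a)}" for s t
    have b1: "real (card (b1 s t)) = d i * g1 s t i" for s t
      using compl[of "\<lambda>a. \<sigma> i s a \<noteq> \<sigma> i t a"] by (auto simp: b1_def g1_def)
    have b2: "real (card (b2 s t)) = d i * g2 s t i" for s t
      using compl[of "\<lambda>a. \<sigma> i (s \<otimes> t) a = \<sigma> i s (\<sigma> i t a)"] by (simp add: b2_def g2_def)
    have "?D - goodpts G S (\<sigma> i) ?D \<subseteq> (\<Union>s\<in>S. \<Union>t\<in>S. b1 s t \<union> b2 s t)"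
    proof
      fix a assume a: "a \<in> ?D - goodpts G S (\<sigma> i) ?D"
      have "\<sigma> i s a \<in> ?D" if "s \<in> S" for s
        using perm[of s i] S that a permutes_in_image[of "\<sigma> i s" ?D a] by blast
      then have cl: "\<forall>s\<in>S. \<sigma> i s a \<in> ?D" by blast
      have aD: "a \<in> ?D" using a by blast
      have "\<exists>s\<in>S. \<exists>t\<in>S. a \<in> b1 s t \<union> b2 s t"
      proof (cases "inj_on (\<lambda>s. \<sigma> i s a) S")
        case True
        then have "\<not> (\<forall>s\<in>S. \<forall>t\<in>S. \<sigma> i s (\<sigma> i t a) = \<sigma> i (s \<otimes> t) a)"
          using a cl by (simp add: goodpts_def)
        then obtain s t where st: "s \<in> S" "t \<in> S" "\<sigma> i s (\<sigma> i t a) \<noteq> \<sigma> i (s \<otimes> t) a" by blast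
        then have "a \<in> b2 s t" using aD by (simp add: b2_def)
        then show ?thesis using st(1,2) by blast
      next
        case False
        then obtain s t where st: "s \<in> S" "t \<in> S" "\<sigma> i s a = \<sigma> i t a" "s \<noteq> t"
          unfolding inj_on_def by blast
        then have "a \<in> b1 s t" using aD by (simp add: b1_def)
        then show ?thesis using st(1,2) by blast
      qed
      then show "a \<in> (\<Union>s\<in>S. \<Union>t\<in>S. b1 s t \<union> b2 s t)" by blast
    qed
    then have "card (?D - goodpts G S (\<sigma> i) ?D) \<le> card (\<Union>s\<in>S. \<Union>t\<in>S. b1 s t \<union> b2 s t)"
      using S by (intro card_mono finite_UN_I) (auto simp: b1_def b2_def)
    also have "\<dots> \<le> (\<Sum>s\<in>S. card (\<Union>t\<in>S. b1 s t \<union> b2 s t))" using S by (intro card_UN_le)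
    also have "\<dots> \<le> (\<Sum>s\<in>S. \<Sum>t\<in>S. card (b1 s t \<union> b2 s t))" using S by (intro sum_mono card_UN_le)
    also have "\<dots> \<le> (\<Sum>s\<in>S. \<Sum>t\<in>S. card (b1 s t) + card (b2 s t))" by (intro sum_mono card_Un_le)
    finally have "real (card (?D - goodpts G S (\<sigma> i) ?D)) \<le> real (\<Sum>s\<in>S. \<Sum>t\<in>S. card (b1 s t) + card (b2 s t))"
      by (rule of_nat_mono)
    also have "\<dots> = d i * (\<Sum>s\<in>S. \<Sum>t\<in>S. g1 s t i + g2 s t i)"
      by (simp add: b1 b2 sum_distrib_left algebra_simps)
    also have "\<dots> \<le> d i * \<theta>" using elim by (intro mult_left_mono) auto
    finally show ?case using elim perm by (simp add: mult.commute)
  qed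
qed

text \<open>The shapes are produced before \<open>S\<close>, so that \<open>S\<close> may be built
  from them, as both entropy bounds require. The set \<open>S0\<close> on which the tiling itself
  relies is added to \<open>S\<close> when good points are counted.\<close>

lemma sofic_quasitiling:
  fixes G (structure) and \<epsilon> :: real
  assumes G: "group G" and so: "sofic_approximation G d \<sigma>"
    and Q: "frequently Q (folner G)" and \<epsilon>: "0 < \<epsilon>" "\<epsilon> \<le> 1/2"
  obtains TT where "finite TT" "\<And>T. T \<in> TT \<Longrightarrow> Q T \<and> finite T \<and> T \<noteq> {} \<and> T \<subseteq> carrier G"
    "\<And>S. finite S \<Longrightarrow> S \<subseteq> carrier G \<Longrightarrow>
      \<forall>\<^sub>F i in sequentially. 0 < d i \<and> (\<forall>s\<in>carrier G. \<sigma> i s permutes {1..d i}) \<and>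
        (\<exists>PP. quasitiling (\<sigma> i) TT \<epsilon> (goodpts G S (\<sigma> i) {1..d i}) {1..d i} PP \<and>
          (1 - \<epsilon>) * d i \<le> card (covered (\<sigma> i) PP))"
proof -
  obtain TT S0 where TT: "finite TT" "\<And>T. T \<in> TT \<Longrightarrow> Q T \<and> finite T \<and> T \<noteq> {} \<and> T \<subseteq> S0"
    and S0: "finite S0" "S0 \<subseteq> carrier G"
    and QT: "\<And>(D :: nat set) \<tau> C. finite D \<Longrightarrow> (\<And>s. s \<in> S0 \<Longrightarrow> inj_on (\<tau> s) D) \<Longrightarrow>
       C \<subseteq> goodpts G S0 \<tau> D \<Longrightarrow> real (card (D - C)) \<le> \<epsilon> / 4 * card D \<Longrightarrow>
       \<exists>PP. quasitiling \<tau> TT \<epsilon> C D PP \<and> (1 - \<epsilon>) * card D \<le> card (covered \<tau> PP)"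
    by (rule quasitiling_exists[OF G Q \<epsilon>]) blast
  show thesis
  proof (rule that[OF TT(1)])
    show "Q T \<and> finite T \<and> T \<noteq> {} \<and> T \<subseteq> carrier G" if "T \<in> TT" for T
      using TT(2)[OF that] S0(2) by blast
    fix S assume S: "finite S" "S \<subseteq> carrier G"
    have "\<forall>\<^sub>F i in sequentially. 0 < d i \<and> (\<forall>s\<in>carrier G. \<sigma> i s permutes {1..d i}) \<and>
      real (card ({1..d i} - goodpts G (S \<union> S0) (\<sigma> i) {1..d i})) \<le> \<epsilon> / 4 * d i"
      by (rule sofic_goodpts[OF G so]) (use S S0 \<epsilon> in auto)
    then show "\<forall>\<^sub>F i in sequentially. 0 < d i \<and> (\<forall>s\<in>carrier G. \<sigma> i s permutes {1..d i}) \<and>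
        (\<exists>PP. quasitiling (\<sigma> i) TT \<epsilon> (goodpts G S (\<sigma> i) {1..d i}) {1..d i} PP \<and>
          (1 - \<epsilon>) * d i \<le> card (covered (\<sigma> i) PP))"
    proof eventually_elim
      case (elim i)
      let ?D = "{1..d i}" and ?C = "goodpts G (S \<union> S0) (\<sigma> i) {1..d i}"
      have "\<exists>PP. quasitiling (\<sigma> i) TT \<epsilon> ?C ?D PP \<and> (1 - \<epsilon>) * card ?D \<le> card (covered (\<sigma> i) PP)"
      proof (rule QT)
        show "inj_on (\<sigma> i s) ?D" if "s \<in> S0" for s
          using elim that S0(2) by (auto intro: permutes_inj_on)
        show "?C \<subseteq> goodpts G S0 (\<sigma> i) ?D" by (rule goodpts_antimono) simp
      qed (use elim in auto)
      then obtain PP where q: "quasitiling (\<sigma> i) TT \<epsilon> ?C ?D PP" and c: "(1 - \<epsilon>) * card ?D \<le> card (covered (\<sigma> i) PP)"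
        by (elim exE conjE)
      have "quasitiling (\<sigma> i) TT \<epsilon> (goodpts G S (\<sigma> i) ?D) ?D PP"
        by (rule quasitiling_mono[OF q order.refl goodpts_antimono[OF Un_upper1]])
      then show ?case using elim c by (intro conjI exI[of _ PP]) simp_all
    qed
  qed
qed

section \<open>Open covers and finite families of functions\<close>

lemma openin_finite_norm_ball:
  fixes \<Phi> :: "('x \<Rightarrow> complex) set"
  assumes "finite \<Phi>" "\<And>f. f \<in> \<Phi> \<Longrightarrow> continuous_map X euclidean f"
  shows "openin X {z \<in> topspace X. \<forall>f\<in>\<Phi>. norm (f x - f z) < r}"
  using assms
proof (induction \<Phi>)
  case (insert f \<Phi>)
  have "openin X {z \<in> topspace X. f z \<in> ball (f x) r}"
    using insert by (intro openin_continuous_map_preimage[of X euclidean]) auto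
  moreover have "openin X {z \<in> topspace X. \<forall>f\<in>\<Phi>. norm (f x - f z) < r}"
    using insert by auto
  ultimately have "openin X ({z \<in> topspace X. f z \<in> ball (f x) r} \<inter> {z \<in> topspace X. \<forall>f\<in>\<Phi>. norm (f x - f z) < r})"
    by (rule openin_Int)
  also have "{z \<in> topspace X. f z \<in> ball (f x) r} \<inter> {z \<in> topspace X. \<forall>f\<in>\<Phi>. norm (f x - f z) < r}
    = {z \<in> topspace X. \<forall>f\<in>insert f \<Phi>. norm (f x - f z) < r}"
    by (auto simp: dist_norm)
  finally show ?case .
qed simp

lemma fine_open_cover:
  fixes \<Phi> :: "('x \<Rightarrow> complex) set"
  assumes X: "compact_space X" and \<Phi>: "finite \<Phi>" "\<And>f. f \<in> \<Phi> \<Longrightarrow> continuous_map X euclidean f" and r: "0 < r"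
  shows "\<exists>\<U>. finite \<U> \<and> open_cover X \<U> \<and> (\<forall>V\<in>\<U>. \<forall>x\<in>V. \<forall>y\<in>V. \<forall>f\<in>\<Phi>. norm (f x - f y) < r)"
proof -
  define B where "B x = {z \<in> topspace X. \<forall>f\<in>\<Phi>. norm (f x - f z) < r / 2}" for x
  have Bo: "openin X (B x)" for x
    unfolding B_def by (rule openin_finite_norm_ball[OF \<Phi>])
  then have "openin X (B x) \<and> x \<in> B x" if "x \<in> topspace X" for x
    using that r by (simp add: B_def)
  then obtain K where K: "finite K" "K \<subseteq> topspace X" "topspace X \<subseteq> (\<Union>x\<in>K. B x)"
    by (rule compact_space_finite_index[OF X])
  have "open_cover X (B ` K)"
    using K Bo openin_subset[OF Bo] unfolding open_cover_def by blast
  moreover have "norm (f x - f y) < r" if "x \<in> B k" "y \<in> B k" "f \<in> \<Phi>" for f x y k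
  proof -
    have "norm (f k - f x) < r / 2" "norm (f k - f y) < r / 2" using that by (auto simp: B_def)
    then show ?thesis using norm_triangle_ineq4[of "f k - f y" "f k - f x"] by simp
  qed
  ultimately show ?thesis using K(1) by (intro exI[of _ "B ` K"]) auto
qed

text \<open>A Lebesgue number, with finitely many functions in place of a metric. For
  \<open>x\<close> in a member \<open>V\<close>, compactness leaves finitely many functions that
  separate \<open>x\<close> from the complement of \<open>V\<close>. A second finite subcover makes
  the choice uniform in \<open>x\<close>; the radius \<open>2 * r\<close> of the first step pays for
  the triangle inequality.\<close>

lemma Lebesgue_functions:
  fixes \<Phi> :: "('x \<Rightarrow> complex) set"
  assumes X: "compact_space X" and \<Phi>: "\<And>f. f \<in> \<Phi> \<Longrightarrow> continuous_map X euclidean f"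
    and sep: "\<And>x y. x \<in> topspace X \<Longrightarrow> y \<in> topspace X \<Longrightarrow> x \<noteq> y \<Longrightarrow> \<exists>f\<in>\<Phi>. f x \<noteq> f y"
    and U: "open_cover X \<U>"
  shows "\<exists>\<Psi> r. finite \<Psi> \<and> \<Psi> \<subseteq> \<Phi> \<and> 0 < r \<and>
    (\<forall>x\<in>topspace X. \<exists>V\<in>\<U>. \<forall>y\<in>topspace X. (\<forall>f\<in>\<Psi>. norm (f x - f y) < r) \<longrightarrow> y \<in> V)"
proof -
  have "\<exists>V \<Psi> r. V \<in> \<U> \<and> finite \<Psi> \<and> \<Psi> \<subseteq> \<Phi> \<and> 0 < r \<and>
      (\<forall>y\<in>topspace X. (\<forall>f\<in>\<Psi>. norm (f x - f y) < 2 * r) \<longrightarrow> y \<in> V)" if x: "x \<in> topspace X" for x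
  proof -
    obtain V where V: "V \<in> \<U>" "x \<in> V" using U x unfolding open_cover_def by blast
    have VX: "openin X V" using U V(1) by (simp add: open_cover_def)
    have "\<exists>f\<in>\<Phi>. f x \<noteq> f y" if "y \<in> topspace X - V" for y
      using sep[of x y] x V(2) that by blast
    then obtain f where f: "\<And>y. y \<in> topspace X - V \<Longrightarrow> f y \<in> \<Phi> \<and> f y x \<noteq> f y y" by metis
    define e where "e y = norm (f y x - f y y) / 2" for y
    \<comment> \<open>\<open>V\<close> covers its own points, so in the finite subcover only indices
      outside \<open>V\<close> contribute a function.\<close>
    define Ov where "Ov y = (if y \<in> V then V else {z \<in> topspace X. f y z \<in> - cball (f y x) (e y)})" for y
    have "openin X (Ov y) \<and> y \<in> Ov y" if "y \<in> topspace X" for y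
    proof (cases "y \<in> V")
      case True
      then show ?thesis using VX by (simp add: Ov_def)
    next
      case False
      then have fy: "f y \<in> \<Phi>" "f y x \<noteq> f y y" using f that by auto
      have "openin X {z \<in> topspace X. f y z \<in> - cball (f y x) (e y)}"
        using \<Phi>[OF fy(1)] by (intro openin_continuous_map_preimage[of X euclidean]) auto
      then show ?thesis using fy False that by (simp add: Ov_def e_def dist_norm)
    qed
    then obtain K where K: "finite K" "K \<subseteq> topspace X" "topspace X \<subseteq> (\<Union>y\<in>K. Ov y)"
      by (rule compact_space_finite_index[OF X])
    \<comment> \<open>The element 1 keeps \<open>Min\<close> meaningful when no index lies outside
      \<open>V\<close>.\<close>
    define r where "r = Min (insert 1 (e ` (K - V))) / 2"
    have epos: "0 < e y" if "y \<in> K - V" for y using f[of y] that K(2) by (auto simp: e_def)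
    then have r: "0 < r" using K(1) by (simp add: r_def)
    have re: "2 * r \<le> e y" if "y \<in> K - V" for y
      using K(1) that by (auto simp: r_def intro!: Min_le)
    have "y \<in> V" if y: "y \<in> topspace X" "\<forall>g\<in>f ` (K - V). norm (g x - g y) < 2 * r" for y
    proof (rule ccontr)
      assume "y \<notin> V"
      obtain k where k: "k \<in> K" "y \<in> Ov k" using K(3) y(1) by blast
      then have kV: "k \<in> K - V" using \<open>y \<notin> V\<close> by (auto simp: Ov_def split: if_splits)
      then have "e k < norm (f k x - f k y)" using k(2) by (simp add: Ov_def dist_norm)
      moreover have "norm (f k x - f k y) < 2 * r" using y(2) kV by blast
      ultimately show False using re[OF kV] by linarith
    qed
    moreover have "f ` (K - V) \<subseteq> \<Phi>" using f K(2) by blast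
    ultimately show ?thesis using V(1) K(1) r
      by (intro exI[of _ V] exI[of _ "f ` (K - V)"] exI[of _ r]) simp
  qed
  then have "\<forall>x\<in>topspace X. \<exists>c. fst c \<in> \<U> \<and> finite (fst (snd c)) \<and> fst (snd c) \<subseteq> \<Phi> \<and> 0 < snd (snd c) \<and>
      (\<forall>y\<in>topspace X. (\<forall>f\<in>fst (snd c). norm (f x - f y) < 2 * snd (snd c)) \<longrightarrow> y \<in> fst c)"
    by (metis fst_conv snd_conv)
  from bchoice[OF this] obtain c where c: "\<forall>x\<in>topspace X. fst (c x) \<in> \<U> \<and> finite (fst (snd (c x))) \<and>
      fst (snd (c x)) \<subseteq> \<Phi> \<and> 0 < snd (snd (c x)) \<and>
      (\<forall>y\<in>topspace X. (\<forall>f\<in>fst (snd (c x)). norm (f x - f y) < 2 * snd (snd (c x))) \<longrightarrow> y \<in> fst (c x))" ..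
  define V where "V x = fst (c x)" for x
  define \<Psi> where "\<Psi> x = fst (snd (c x))" for x
  define r where "r x = snd (snd (c x))" for x
  have c1: "V x \<in> \<U>" "finite (\<Psi> x)" "\<Psi> x \<subseteq> \<Phi>" "0 < r x" if "x \<in> topspace X" for x
    using c that by (simp_all add: V_def \<Psi>_def r_def)
  have c2: "y \<in> V x" if "x \<in> topspace X" "y \<in> topspace X" "\<And>f. f \<in> \<Psi> x \<Longrightarrow> norm (f x - f y) < 2 * r x" for x y
    using c that by (simp add: V_def \<Psi>_def r_def)
  define B where "B x = {z \<in> topspace X. \<forall>f\<in>\<Psi> x. norm (f x - f z) < r x}" for x
  have "openin X (B x) \<and> x \<in> B x" if x: "x \<in> topspace X" for x
    unfolding B_def using openin_finite_norm_ball[OF c1(2)[OF x], of X x "r x"] c1[OF x] \<Phi> x by auto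
  then obtain K where K: "finite K" "K \<subseteq> topspace X" "topspace X \<subseteq> (\<Union>x\<in>K. B x)"
    by (rule compact_space_finite_index[OF X])
  define R where "R = Min (insert 1 (r ` K))"
  have R: "0 < R" using K c1(4) by (auto simp: R_def)
  have RK: "R \<le> r k" if "k \<in> K" for k using K that by (auto simp: R_def)
  have "\<exists>W\<in>\<U>. \<forall>y\<in>topspace X. (\<forall>f\<in>\<Union>(\<Psi> ` K). norm (f x - f y) < R) \<longrightarrow> y \<in> W" if x: "x \<in> topspace X" for x
  proof -
    obtain k where k: "k \<in> K" "x \<in> B k" using K(3) x by blast
    have kX: "k \<in> topspace X" using k K by blast
    have "y \<in> V k" if y: "y \<in> topspace X" "\<forall>f\<in>\<Union>(\<Psi> ` K). norm (f x - f y) < R" for y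
    proof (rule c2[OF kX y(1)])
      fix f assume f: "f \<in> \<Psi> k"
      then have "norm (f x - f y) < r k" using y(2) k(1) RK[OF k(1)] by force
      moreover have "norm (f k - f x) < r k" using k(2) f by (simp add: B_def)
      ultimately show "norm (f k - f y) < 2 * r k"
        using norm_triangle_ineq[of "f k - f x" "f x - f y"] by simp
    qed
    then show ?thesis using c1(1)[OF kX] by blast
  qed
  moreover have "finite (\<Union>(\<Psi> ` K))" "\<Union>(\<Psi> ` K) \<subseteq> \<Phi>" using K c1 by blast+
  ultimately show ?thesis using R by blast
qed

section \<open>The upper bound\<close>

text \<open>Equivariance involves the inverse of the permutation \<open>\<tau> (inv s)\<close>,
  whereas tiles are placed with \<open>\<tau> s\<close>; at good points the two agree. The link is
  that \<open>\<tau> \<one>\<close> fixes \<open>c\<close>, being injective and idempotent at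
  \<open>c\<close>.\<close>

lemma goodpts_inverse:
  fixes G (structure)
  assumes G: "group G" and c: "c \<in> goodpts G S \<tau> D" and s: "s \<in> S" "inv s \<in> S" "\<one> \<in> S" "s \<in> carrier G"
    and perm: "\<And>s. s \<in> carrier G \<Longrightarrow> \<tau> s permutes D"
  shows "inv_into UNIV (\<tau> (inv s)) c = \<tau> s c"
proof -
  interpret group G by fact
  have mult: "\<tau> t (\<tau> u c) = \<tau> (t \<otimes> u) c" if "t \<in> S" "u \<in> S" for t u
    using c that by (simp add: goodpts_def)
  have "\<tau> \<one> (\<tau> \<one> c) = \<tau> \<one> c" using mult[OF s(3,3)] by simp
  then have "\<tau> \<one> c = c"
    using permutes_inj[OF perm[OF one_closed]] by (simp add: inj_eq)
  then have "\<tau> (inv s) (\<tau> s c) = c" using mult[OF s(2,1)] s(4) by simp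
  then show ?thesis
    using s(4) by (intro inv_f_eq permutes_inj[OF perm]) auto
qed

context amenable_action
begin

lemma hom_points:
  assumes "\<phi> \<in> unital_homs X (discrete_topology {1..d})"
  shows "\<exists>\<xi>. \<xi> \<in> {1..d} \<rightarrow> topspace X \<and> (\<forall>f\<in>C_fun X. \<forall>a\<in>{1..d}. \<phi> f a = f (\<xi> a))"
proof -
  have "\<forall>a\<in>{1..d}. \<exists>x. x \<in> topspace X \<and> (\<forall>f \<in> C_fun X. \<phi> f a = f x)"
    using unital_hom_evaluation[OF compact assms] unfolding topspace_discrete_topology by blast
  from bchoice[OF this] show ?thesis by blast
qed

text \<open>The pointwise form of the equivariance defect, which the upper bound exploits and which
  is verified for patterns in the lower bound.\<close>

lemma rho2_equivariance:
  assumes \<phi>: "\<And>f a. f \<in> C_fun X \<Longrightarrow> a \<in> {1..d} \<Longrightarrow> \<phi> f a = f (\<xi> a)" and \<xi>: "\<xi> \<in> {1..d} \<rightarrow> topspace X"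
    and s: "s \<in> carrier G" and perm: "\<tau> permutes {1..d}" and p: "unit_ball_sequence X p"
  shows "rho2 p d (\<phi> \<circ> induced_action G X \<alpha> s) (perm_action d \<tau> \<circ> \<phi>) =
    (\<Sum>n. (1/2) ^ Suc n * norm2 d (\<lambda>a. p n (\<alpha> (inv s) (\<xi> a)) - p n (\<xi> (inv_into UNIV \<tau> a))))"
proof -
  have pC: "p n \<in> C_fun X" for n using p by (simp add: unit_ball_sequence_def)
  have "norm2 d (\<lambda>a. (\<phi> \<circ> induced_action G X \<alpha> s) (p n) a - (perm_action d \<tau> \<circ> \<phi>) (p n) a) =
    norm2 d (\<lambda>a. p n (\<alpha> (inv s) (\<xi> a)) - p n (\<xi> (inv_into UNIV \<tau> a)))" for n
  proof (rule norm2_cong)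
    fix a assume a: "a \<in> {1..d}"
    then have ia: "inv_into UNIV \<tau> a \<in> {1..d}"
      using permutes_in_image[OF permutes_inv[OF perm]] by simp
    have "\<phi> (induced_action G X \<alpha> s (p n)) a = p n (\<alpha> (inv s) (\<xi> a))"
      using \<phi>[OF induced_action_C_fun[OF s pC] a] \<xi> a by (auto simp: induced_action_def)
    moreover have "perm_action d \<tau> (\<phi> (p n)) a = p n (\<xi> (inv_into UNIV \<tau> a))"
      using \<phi>[OF pC ia] a by (simp add: perm_action_def)
    ultimately show "(\<phi> \<circ> induced_action G X \<alpha> s) (p n) a - (perm_action d \<tau> \<circ> \<phi>) (p n) a =
      p n (\<alpha> (inv s) (\<xi> a)) - p n (\<xi> (inv_into UNIV \<tau> a))" by simp
  qed
  then show ?thesis unfolding rho2_def by (rule_tac arg_cong[where f = suminf]) auto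
qed

lemma unit_ball_diff:
  assumes "unit_ball_sequence X p" "x \<in> topspace X" "y \<in> topspace X"
  shows "norm (p n x - p n y) \<le> 2"
proof -
  have "norm (p n x) \<le> 1" "norm (p n y) \<le> 1" using assms by (auto simp: unit_ball_sequence_def)
  then show ?thesis using norm_triangle_ineq4[of "p n x" "p n y"] by linarith
qed

text \<open>A homomorphism in a separated set is determined by the set of points where it fails to be
  equivariant, together with the names of the orbit pieces at the centers of the tiles.\<close>

lemma separated_card_le:
  fixes d :: nat and \<epsilon> \<epsilon>1 \<theta> r :: real
  assumes d: "0 < d" and perm: "\<And>s. s \<in> carrier G \<Longrightarrow> \<tau> s permutes {1..d}"
    and p: "unit_ball_sequence X p"
    and TT: "finite TT" "\<And>T. T \<in> TT \<Longrightarrow> finite T \<and> T \<noteq> {} \<and> T \<subseteq> carrier G"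
    and U: "finite \<U>" "open_cover X \<U>"
    and fine: "\<And>V x y n. V \<in> \<U> \<Longrightarrow> x \<in> V \<Longrightarrow> y \<in> V \<Longrightarrow> n < M \<Longrightarrow> norm (p n x - p n y) < r"
    and PP: "quasitiling \<tau> TT \<epsilon>1 C {1..d} PP" "(1 - \<epsilon>1) * d \<le> card (covered \<tau> PP)"
    and C: "C \<subseteq> goodpts G S \<tau> {1..d}" and S: "\<Union>TT \<subseteq> S" "m_inv G ` \<Union>TT \<subseteq> S" "\<one> \<in> S"
    and A: "finite A" "A \<subseteq> unital_homs X (discrete_topology {1..d})"
      "\<And>\<phi> \<psi>. \<phi> \<in> A \<Longrightarrow> \<psi> \<in> A \<Longrightarrow> \<phi> \<noteq> \<psi> \<Longrightarrow> \<epsilon> \<le> rho2 p d \<phi> \<psi>"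
    and bad: "\<And>\<phi> \<xi>. \<phi> \<in> A \<Longrightarrow> \<xi> \<in> {1..d} \<rightarrow> topspace X \<Longrightarrow>
       (\<And>f a. f \<in> C_fun X \<Longrightarrow> a \<in> {1..d} \<Longrightarrow> \<phi> f a = f (\<xi> a)) \<Longrightarrow>
       real (card {a \<in> {1..d}. \<exists>s\<in>\<Union>TT. \<exists>n<M. r \<le> norm (p n (\<alpha> s (\<xi> a)) - p n (\<xi> (inv_into UNIV (\<tau> (inv s)) a)))}) \<le> \<theta> * d"
    and r: "0 < r" and num: "sqrt ((3 * r)\<^sup>2 + 4 * (\<epsilon>1 + card (\<Union>TT) * \<theta>)) + 2 * (1/2) ^ M < \<epsilon>"
  shows "card A \<le> card {B \<in> Pow {1..d}. real (card B) \<le> \<theta> * d} * (\<Prod>P\<in>PP. join_number \<U> (shape P))"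
proof -
  let ?D = "{1..d}" and ?L = "\<Union>TT"
  have Pc: "center P \<in> C" "shape P \<in> TT" "part P \<subseteq> shape P" if "P \<in> PP" for P
    using PP(1) that by (auto simp: quasitiling_def)
  have fPP: "finite PP" using PP(1) by (simp add: quasitiling_def)
  have covD: "covered \<tau> PP \<subseteq> ?D" using PP(1) by (simp add: quasitiling_def)
  have L: "finite ?L" "?L \<subseteq> carrier G" using TT by auto
  have "\<forall>T\<in>TT. \<exists>W. names \<U> T W \<and> card W = join_number \<U> T"
    using names_exists U TT by blast
  from bchoice[OF this] obtain W where W: "\<And>T. T \<in> TT \<Longrightarrow> names \<U> T (W T) \<and> card (W T) = join_number \<U> T"
    by blast
  have "\<forall>\<phi>\<in>A. \<exists>\<xi>. \<xi> \<in> ?D \<rightarrow> topspace X \<and> (\<forall>f\<in>C_fun X. \<forall>a\<in>?D. \<phi> f a = f (\<xi> a))"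
    using hom_points A(2) by blast
  from bchoice[OF this] obtain \<xi> where \<xi>0: "\<forall>\<phi>\<in>A. \<xi> \<phi> \<in> ?D \<rightarrow> topspace X \<and> (\<forall>f\<in>C_fun X. \<forall>a\<in>?D. \<phi> f a = f (\<xi> \<phi> a))"
    by blast
  then have \<xi>: "\<xi> \<phi> \<in> ?D \<rightarrow> topspace X" if "\<phi> \<in> A" for \<phi> using that by blast
  then have \<xi>X: "\<xi> \<phi> a \<in> topspace X" if "\<phi> \<in> A" "a \<in> ?D" for \<phi> a using that by blast
  have \<xi>v: "\<phi> f a = f (\<xi> \<phi> a)" if "\<phi> \<in> A" "f \<in> C_fun X" "a \<in> ?D" for \<phi> f a using that \<xi>0 by blast
  have pC: "p n \<in> C_fun X" for n using p by (simp add: unit_ball_sequence_def)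
  define Bd where "Bd \<phi> = {a \<in> ?D. \<exists>s\<in>?L. \<exists>n<M. r \<le> norm (p n (\<alpha> s (\<xi> \<phi> a)) - p n (\<xi> \<phi> (inv_into UNIV (\<tau> (inv s)) a)))}" for \<phi>
  have Bd: "Bd \<phi> \<subseteq> ?D" "real (card (Bd \<phi>)) \<le> \<theta> * d" if "\<phi> \<in> A" for \<phi>
    unfolding Bd_def using bad[OF that \<xi>[OF that] \<xi>v[OF that]] by auto
  have cD: "c \<in> ?D" if "c \<in> C" for c using C that by (auto simp: goodpts_def)
  have wex: "\<exists>w\<in>W (shape P). \<forall>s\<in>shape P. \<alpha> s (\<xi> \<phi> (center P)) \<in> w s" if "\<phi> \<in> A" "P \<in> PP" for \<phi> P
    using W[OF Pc(2)[OF that(2)]] \<xi>X[OF that(1) cD[OF Pc(1)[OF that(2)]]] unfolding names_def by blast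
  have "\<forall>q\<in>A \<times> PP. \<exists>w. w \<in> W (shape (snd q)) \<and> (\<forall>s\<in>shape (snd q). \<alpha> s (\<xi> (fst q) (center (snd q))) \<in> w s)"
  proof
    fix q assume "q \<in> A \<times> PP"
    then have "fst q \<in> A" "snd q \<in> PP" by auto
    from wex[OF this]
    show "\<exists>w. w \<in> W (shape (snd q)) \<and> (\<forall>s\<in>shape (snd q). \<alpha> s (\<xi> (fst q) (center (snd q))) \<in> w s)" by blast
  qed
  from bchoice[OF this] obtain w0 where w0: "\<And>q. q \<in> A \<times> PP \<Longrightarrow>
     w0 q \<in> W (shape (snd q)) \<and> (\<forall>s\<in>shape (snd q). \<alpha> s (\<xi> (fst q) (center (snd q))) \<in> w0 q s)" by blast
  define w where "w \<phi> P = w0 (\<phi>, P)" for \<phi> P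
  have w: "w \<phi> P \<in> W (shape P)" "\<And>s. s \<in> shape P \<Longrightarrow> \<alpha> s (\<xi> \<phi> (center P)) \<in> w \<phi> P s"
    if "\<phi> \<in> A" "P \<in> PP" for \<phi> P
    using w0[of "(\<phi>, P)"] that by (auto simp: w_def)
  define lab where "lab \<phi> = (Bd \<phi>, restrict (w \<phi>) PP)" for \<phi>
  have close: "norm (p n (\<alpha> s (\<xi> \<phi> c)) - p n (\<xi> \<phi> (\<tau> s c))) < r"
    if "\<phi> \<in> A" "c \<in> C" "c \<notin> Bd \<phi>" "s \<in> ?L" "n < M" for \<phi> c s n
  proof -
    have "s \<in> S" "inv s \<in> S" "s \<in> carrier G" using that S L by auto
    then have "inv_into UNIV (\<tau> (inv s)) c = \<tau> s c"
      using C that(2) S(3) by (intro goodpts_inverse[OF is_group _ _ _ _ _ perm]) auto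
    then show ?thesis using that cD[OF that(2)] unfolding Bd_def by force
  qed
  have "inj_on lab A"
  proof (rule inj_onI, rule ccontr)
    fix \<phi> \<psi> assume A2: "\<phi> \<in> A" "\<psi> \<in> A" "lab \<phi> = lab \<psi>" "\<phi> \<noteq> \<psi>"
    have B: "Bd \<phi> = Bd \<psi>" using A2(3) by (simp add: lab_def)
    have ww: "w \<phi> P = w \<psi> P" if "P \<in> PP" for P
      using A2(3) that by (auto simp: lab_def dest: fun_cong[of _ _ P])
    define v where "v n a = \<phi> (p n) a - \<psi> (p n) a" for n a
    have v: "v n a = p n (\<xi> \<phi> a) - p n (\<xi> \<psi> a)" if "a \<in> ?D" for n a
      using \<xi>v[OF A2(1) pC that] \<xi>v[OF A2(2) pC that] by (simp add: v_def)
    \<comment> \<open>Sites reached from bad centers are unreliable. Removing the images of all bad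
      points under all of \<open>L\<close> keeps the count simple: at most
      \<open>card L * card (Bd \<phi>)\<close> points.\<close>
    define Z where "Z = (?D - covered \<tau> PP) \<union> (\<lambda>(s, c). \<tau> s c) ` (?L \<times> Bd \<phi>)"
    have tD: "\<tau> s c \<in> ?D" if "s \<in> ?L" "c \<in> ?D" for s c
      using permutes_in_image[OF perm, of s c] L that by auto
    have ZD: "Z \<subseteq> ?D" using tD Bd(1)[OF A2(1)] by (auto simp: Z_def simp del: atLeastAtMost_iff)
    have fB: "finite (Bd \<phi>)" by (simp add: Bd_def)
    have "card Z \<le> card (?D - covered \<tau> PP) + card ((\<lambda>(s, c). \<tau> s c) ` (?L \<times> Bd \<phi>))"
      unfolding Z_def by (rule card_Un_le)
    also have "card ((\<lambda>(s, c). \<tau> s c) ` (?L \<times> Bd \<phi>)) \<le> card (?L \<times> Bd \<phi>)"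
      using L fB by (intro card_image_le finite_cartesian_product)
    also have "card (?L \<times> Bd \<phi>) = card ?L * card (Bd \<phi>)" by (rule card_cartesian_product)
    also have "card (?D - covered \<tau> PP) = d - card (covered \<tau> PP)"
      using covD by (subst card_Diff_subset) (auto intro: finite_subset)
    finally have "real (card Z) \<le> real (d - card (covered \<tau> PP)) + card ?L * real (card (Bd \<phi>))"
      by (simp flip: of_nat_mult of_nat_add)
    also have "real (d - card (covered \<tau> PP)) \<le> \<epsilon>1 * d"
    proof -
      have "card (covered \<tau> PP) \<le> d" using card_mono[OF _ covD] by simp
      then show ?thesis using PP(2) by (simp add: algebra_simps of_nat_diff)
    qed
    also have "card ?L * real (card (Bd \<phi>)) \<le> card ?L * (\<theta> * d)"
      using Bd(2)[OF A2(1)] by (intro mult_left_mono) auto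
    finally have Zc: "real (card Z) \<le> (\<epsilon>1 + card ?L * \<theta>) * d" by (simp add: algebra_simps)
    have small: "norm (v n a) \<le> 3 * r" if n: "n < M" and a: "a \<in> ?D - Z" for n a
    proof -
      have "a \<in> covered \<tau> PP" using a by (auto simp: Z_def)
      then obtain P s where P: "P \<in> PP" "s \<in> part P" "a = \<tau> s (center P)" by (auto simp: covered_def)
      let ?c = "center P"
      have s: "s \<in> shape P" "s \<in> ?L" using Pc[OF P(1)] P(2) by auto
      have cB: "?c \<notin> Bd \<phi>" using a s(2) P(3) by (auto simp: Z_def)
      have "w \<phi> P s \<in> \<U>"
        using W[OF Pc(2)[OF P(1)]] w(1)[OF A2(1) P(1)] s(1) unfolding names_def by blast
      moreover have "\<alpha> s (\<xi> \<phi> ?c) \<in> w \<phi> P s" "\<alpha> s (\<xi> \<psi> ?c) \<in> w \<phi> P s"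
        using w(2)[OF A2(1) P(1) s(1)] w(2)[OF A2(2) P(1) s(1)] ww[OF P(1)] by auto
      ultimately have 1: "norm (p n (\<alpha> s (\<xi> \<phi> ?c)) - p n (\<alpha> s (\<xi> \<psi> ?c))) < r"
        using fine n by blast
      have 2: "norm (p n (\<alpha> s (\<xi> \<phi> ?c)) - p n (\<xi> \<phi> a)) < r"
        unfolding P(3) by (rule close[OF A2(1) Pc(1)[OF P(1)] cB s(2) n])
      have 3: "norm (p n (\<alpha> s (\<xi> \<psi> ?c)) - p n (\<xi> \<psi> a)) < r"
        unfolding P(3) using cB B by (intro close[OF A2(2) Pc(1)[OF P(1)] _ s(2) n]) simp
      \<comment> \<open>Three errors of size \<open>r\<close>: both orbit points lie in the same
        member of the fine cover, and each homomorphism follows the orbit of its center up to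
        \<open>r\<close>.\<close>
      have "v n a = (p n (\<alpha> s (\<xi> \<phi> ?c)) - p n (\<alpha> s (\<xi> \<psi> ?c))) + (p n (\<alpha> s (\<xi> \<psi> ?c)) - p n (\<xi> \<psi> a))
          - (p n (\<alpha> s (\<xi> \<phi> ?c)) - p n (\<xi> \<phi> a))"
        using v a by simp
      also have "norm \<dots> \<le> 3 * r"
        using 1 2 3 by (intro order.trans[OF norm_triangle_ineq4] order.trans[OF add_right_mono[OF norm_triangle_ineq]]) simp
      finally show ?thesis .
    qed
    have v2: "norm (v n a) \<le> 2" if "a \<in> ?D" for n a
      unfolding v[OF that] by (intro unit_ball_diff[OF p] \<xi>X A2 that)
    have "rho2 p d \<phi> \<psi> = (\<Sum>n. (1/2) ^ Suc n * norm2 d (v n))"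
      unfolding rho2_def v_def ..
    also have "\<dots> \<le> sqrt ((3 * r)\<^sup>2 + 2\<^sup>2 * (\<epsilon>1 + card ?L * \<theta>)) + 2 * (1/2) ^ M"
      using r by (intro weighted_norm2_le[OF d v2 _ ZD Zc small]) auto
    also have "\<dots> < \<epsilon>" using num by simp
    finally show False using A(3)[OF A2(1,2,4)] by simp
  qed
  moreover have "lab ` A \<subseteq> {B \<in> Pow ?D. real (card B) \<le> \<theta> * d} \<times> PiE PP (\<lambda>P. W (shape P))"
    using Bd w(1) by (auto simp: lab_def simp del: atLeastAtMost_iff)
  moreover have "finite ({B \<in> Pow ?D. real (card B) \<le> \<theta> * d} \<times> PiE PP (\<lambda>P. W (shape P)))"
    using fPP W Pc(2) by (intro finite_cartesian_product finite_PiE) (auto simp: names_def)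
  ultimately have "card A \<le> card ({B \<in> Pow ?D. real (card B) \<le> \<theta> * d} \<times> PiE PP (\<lambda>P. W (shape P)))"
    by (rule card_inj_on_le)
  also have "\<dots> = card {B \<in> Pow ?D. real (card B) \<le> \<theta> * d} * (\<Prod>P\<in>PP. join_number \<U> (shape P))"
    using fPP W Pc(2) by (simp add: card_cartesian_product card_PiE)
  finally show ?thesis .
qed

end

section \<open>The lower bound\<close>

lemma rho2_commute: "rho2 p d \<phi> \<psi> = rho2 p d \<psi> \<phi>"
  unfolding rho2_def norm2_def by (simp add: norm_minus_commute)

lemma rho2_self: "rho2 p d \<phi> \<phi> = 0"
  unfolding rho2_def norm2_def by simp

lemma maximal_separated_subset:
  assumes "finite E" and sym: "\<And>x y. \<rho> x y = \<rho> y x" and refl: "\<And>x. \<rho> x x = 0" and \<epsilon>: "(0::real) < \<epsilon>"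
  shows "\<exists>A. A \<subseteq> E \<and> separated \<rho> \<epsilon> A \<and> (\<forall>x\<in>E. \<exists>y\<in>A. \<rho> x y < \<epsilon>)"
proof -
  let ?Sep = "{A. A \<subseteq> E \<and> separated \<rho> \<epsilon> A}"
  have fin: "finite ?Sep" using assms(1) by (intro finite_subset[of ?Sep "Pow E"]) auto
  have "?Sep \<noteq> {}" by (rule ex_in_conv[THEN iffD1], rule exI[of _ "{}"]) simp
  from finite_has_maximal[OF fin this] obtain A where A: "A \<in> ?Sep" and max: "\<forall>B\<in>?Sep. A \<subseteq> B \<longrightarrow> A = B"
    by (elim bexE)
  have A1: "A \<subseteq> E" and A2: "separated \<rho> \<epsilon> A" using A by simp_all
  have "\<exists>y\<in>A. \<rho> x y < \<epsilon>" if x: "x \<in> E" for x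
  proof (rule ccontr)
    assume "\<not> ?thesis"
    then have far: "\<forall>y\<in>A. \<epsilon> \<le> \<rho> x y" by (simp add: not_less)
    have far': "\<forall>y\<in>A. \<epsilon> \<le> \<rho> y x"
    proof
      fix y assume "y \<in> A"
      then have "\<epsilon> \<le> \<rho> x y" using far by blast
      also have "\<rho> x y = \<rho> y x" by (rule sym)
      finally show "\<epsilon> \<le> \<rho> y x" .
    qed
    have "insert x A \<in> ?Sep" using A x far far' by blast
    then have "A = insert x A" using bspec[OF max, of "insert x A"] by blast
    then have "x \<in> A" by blast
    then show False using far refl[of x] \<epsilon> by force
  qed
  then have "\<forall>x\<in>E. \<exists>y\<in>A. \<rho> x y < \<epsilon>" by (rule ballI)
  with A1 A2 show ?thesis by (intro exI[of _ A] conjI)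
qed

text \<open>Points are chosen greedily. If no point were far from all of \<open>Y\<close>, the names
  \<open>\<lambda>s. V (\<alpha> s y)\<close> with \<open>y\<close> in \<open>Y\<close> would serve
  the whole of \<open>X\<close>, so \<open>Y\<close> would already have at least
  \<open>join_number \<U> T\<close> elements.\<close>

lemma (in amenable_action) separated_points:
  assumes U: "finite \<U>" "open_cover X \<U>" and T: "finite T" "T \<noteq> {}" "T \<subseteq> carrier G"
    and r: "(0::real) < r" and Leb: "\<And>x. x \<in> topspace X \<Longrightarrow>
      \<exists>V\<in>\<U>. \<forall>y\<in>topspace X. (\<forall>j\<in>J. norm (f j x - f j y) < r) \<longrightarrow> y \<in> V"
  shows "\<exists>Y. finite Y \<and> Y \<subseteq> topspace X \<and> card Y = join_number \<U> T \<and>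
    (\<forall>x\<in>Y. \<forall>y\<in>Y. x \<noteq> y \<longrightarrow> (\<exists>s\<in>T. \<exists>j\<in>J. r \<le> norm (f j (\<alpha> s x) - f j (\<alpha> s y))))"
proof -
  define far where "far x y \<longleftrightarrow> (\<exists>s\<in>T. \<exists>j\<in>J. r \<le> norm (f j (\<alpha> s x) - f j (\<alpha> s y)))" for x y
  have far_sym: "far x y = far y x" for x y by (simp add: far_def norm_minus_commute)
  have "\<forall>x\<in>topspace X. \<exists>V. V \<in> \<U> \<and> (\<forall>y\<in>topspace X. (\<forall>j\<in>J. norm (f j x - f j y) < r) \<longrightarrow> y \<in> V)"
    using Leb by blast
  from bchoice[OF this] obtain V where V: "\<And>x. x \<in> topspace X \<Longrightarrow> V x \<in> \<U>"
    "\<And>x y. x \<in> topspace X \<Longrightarrow> y \<in> topspace X \<Longrightarrow> (\<forall>j\<in>J. norm (f j x - f j y) < r) \<Longrightarrow> y \<in> V x" by blast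
  have "k \<le> join_number \<U> T \<Longrightarrow> \<exists>Y. finite Y \<and> Y \<subseteq> topspace X \<and> card Y = k \<and> (\<forall>x\<in>Y. \<forall>y\<in>Y. x \<noteq> y \<longrightarrow> far x y)" for k
  proof (induction k)
    case 0
    then show ?case by (intro exI[of _ "{}"]) simp
  next
    case (Suc k)
    then obtain Y where Y: "finite Y" "Y \<subseteq> topspace X" "card Y = k" "\<forall>x\<in>Y. \<forall>y\<in>Y. x \<noteq> y \<longrightarrow> far x y"
      by auto
    have "\<exists>x\<in>topspace X. \<forall>y\<in>Y. far y x"
    proof (rule ccontr)
      assume "\<not> ?thesis"
      then have near: "\<And>x. x \<in> topspace X \<Longrightarrow> \<exists>y\<in>Y. \<not> far y x" by blast
      have "names \<U> T ((\<lambda>y s. V (\<alpha> s y)) ` Y)"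
        unfolding names_def
      proof (intro conjI ballI)
        show "finite ((\<lambda>y s. V (\<alpha> s y)) ` Y)" using Y(1) by simp
        show "(\<lambda>y s. V (\<alpha> s y)) ` Y \<subseteq> T \<rightarrow> \<U>" using V(1) act_closed Y(2) T(3) by blast
        fix x assume x: "x \<in> topspace X"
        obtain y where y: "y \<in> Y" "\<not> far y x" using near[OF x] by blast
        have "\<alpha> s x \<in> V (\<alpha> s y)" if s: "s \<in> T" for s
        proof (rule V(2))
          have "s \<in> carrier G" "y \<in> topspace X" using s T(3) y(1) Y(2) by blast+
          then show "\<alpha> s y \<in> topspace X" "\<alpha> s x \<in> topspace X" using x by (simp_all add: act_closed)
          show "\<forall>j\<in>J. norm (f j (\<alpha> s y) - f j (\<alpha> s x)) < r"
          proof
            fix j assume "j \<in> J"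
            then have "\<not> r \<le> norm (f j (\<alpha> s y) - f j (\<alpha> s x))"
              using y(2) s unfolding far_def by blast
            then show "norm (f j (\<alpha> s y) - f j (\<alpha> s x)) < r" by (rule not_le_imp_less)
          qed
        qed
        then show "\<exists>w\<in>(\<lambda>y s. V (\<alpha> s y)) ` Y. \<forall>s\<in>T. \<alpha> s x \<in> w s"
          by (intro bexI[of _ "\<lambda>s. V (\<alpha> s y)"] ballI imageI y(1))
      qed
      then have "join_number \<U> T \<le> card ((\<lambda>y s. V (\<alpha> s y)) ` Y)"
        by (rule join_number_le[OF T(2,3) U(2)])
      also have "\<dots> \<le> card Y" using Y(1) by (rule card_image_le)
      finally show False using Y(3) Suc.prems by simp
    qed
    then obtain x where x: "x \<in> topspace X" "\<And>y. y \<in> Y \<Longrightarrow> far y x" by blast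
    have "x \<notin> Y"
    proof
      assume "x \<in> Y"
      then have "far x x" by (rule x(2))
      then obtain s j where "r \<le> norm (f j (\<alpha> s x) - f j (\<alpha> s x))" unfolding far_def by blast
      then show False using r by simp
    qed
    have far2: "far x y" "far y x" if "y \<in> Y" for y
      using x(2)[OF that] far_sym[of x y] by simp_all
    have "finite (insert x Y) \<and> insert x Y \<subseteq> topspace X \<and> card (insert x Y) = Suc k"
      using Y(1-3) x(1) \<open>x \<notin> Y\<close> by simp
    moreover have "\<forall>u\<in>insert x Y. \<forall>v\<in>insert x Y. u \<noteq> v \<longrightarrow> far u v"
      using Y(4) far2 by blast
    ultimately show ?case by blast
  qed
  from this[OF order.refl] show ?thesis unfolding far_def .
qed

text \<open>A tiled model in which patterns are built: \<beta> bounds the boundaries of the shapes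
  in the lemmas below, and \<open>x0\<close> is the default value at uncovered points.\<close>

locale tiled_points = amenable_action G X \<alpha> for G (structure) and X :: "'x topology" and \<alpha> +
  fixes d :: nat and \<tau> :: "'a \<Rightarrow> nat \<Rightarrow> nat" and TT :: "'a set set" and \<epsilon> \<beta> :: real
    and C :: "nat set" and S :: "'a set" and PP :: "('a set \<times> nat \<times> 'a set) set" and x0 :: 'x
  assumes d: "0 < d" and perm: "\<And>s. s \<in> carrier G \<Longrightarrow> \<tau> s permutes {1..d}"
    and TT: "finite TT" "\<And>T. T \<in> TT \<Longrightarrow> finite T \<and> T \<noteq> {} \<and> T \<subseteq> carrier G"
    and \<epsilon>: "0 < \<epsilon>" "\<epsilon> \<le> 1/2" and \<beta>: "0 \<le> \<beta>"
    and PP: "quasitiling \<tau> TT \<epsilon> C {1..d} PP" "(1 - \<epsilon>) * d \<le> card (covered \<tau> PP)"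
    and C: "C \<subseteq> goodpts G S \<tau> {1..d}" and x0: "x0 \<in> topspace X"
begin

text \<open>A pattern places the orbit piece of \<open>x P\<close> on the claimed part of each tile \<open>P\<close>.\<close>

definition slots :: "(('a set \<times> nat \<times> 'a set) \<times> 'a) set" where
  "slots = (SIGMA P:PP. part P)"

definition site :: "('a set \<times> nat \<times> 'a set) \<times> 'a \<Rightarrow> nat" where
  "site = (\<lambda>(P, s). \<tau> s (center P))"

definition pattern :: "('a set \<times> nat \<times> 'a set \<Rightarrow> 'x) \<Rightarrow> nat \<Rightarrow> 'x" where
  "pattern x a = (if a \<in> site ` slots
     then \<alpha> (snd (inv_into slots site a)) (x (fst (inv_into slots site a))) else x0)"

lemma finite_PP: "finite PP" using PP(1) by (simp add: quasitiling_def)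

lemma PPD: "P \<in> PP \<Longrightarrow> shape P \<in> TT" "P \<in> PP \<Longrightarrow> center P \<in> C" "P \<in> PP \<Longrightarrow> part P \<subseteq> shape P"
  "P \<in> PP \<Longrightarrow> (1 - \<epsilon>) * card (shape P) \<le> card (part P)"
  using PP(1) by (auto simp: quasitiling_def)

lemma shapeD: "P \<in> PP \<Longrightarrow> finite (shape P)" "P \<in> PP \<Longrightarrow> shape P \<noteq> {}" "P \<in> PP \<Longrightarrow> shape P \<subseteq> carrier G"
  using TT(2)[OF PPD(1)] by auto

lemma finite_part: "P \<in> PP \<Longrightarrow> finite (part P)"
  using shapeD(1) PPD(3) finite_subset by blast

lemma part_carrier: "P \<in> PP \<Longrightarrow> s \<in> part P \<Longrightarrow> s \<in> carrier G"
  using shapeD(3) PPD(3) by blast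

lemma inj_site: "inj_on site slots"
  using PP(1) unfolding quasitiling_def slots_def site_def by blast

lemma covered_eq: "covered \<tau> PP = site ` slots"
  by (simp add: covered_def slots_def site_def)

lemma site_range: "site ` slots \<subseteq> {1..d}"
  using PP(1) unfolding covered_eq[symmetric] quasitiling_def by blast

lemma finite_slots: "finite slots"
  unfolding slots_def using finite_PP finite_part by (rule finite_SigmaI)

lemma card_slots: "(1 - \<epsilon>) * d \<le> card slots" "card slots \<le> d"
  using PP(2) card_image[OF inj_site] card_mono[OF _ site_range] by (auto simp: covered_eq)

lemma center_range: "P \<in> PP \<Longrightarrow> center P \<in> {1..d}"
  using PPD(2) C unfolding goodpts_def by blast

lemma pattern_site:
  assumes "P \<in> PP" "s \<in> part P"
  shows "pattern x (\<tau> s (center P)) = \<alpha> s (x P)"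
proof -
  have m: "(P, s) \<in> slots" using assms by (simp add: slots_def)
  have "\<tau> s (center P) = site (P, s)" by (simp add: site_def)
  then show ?thesis using inv_into_f_f[OF inj_site m] m by (simp add: pattern_def)
qed

lemma pattern_closed:
  assumes "\<And>P. P \<in> PP \<Longrightarrow> x P \<in> topspace X"
  shows "pattern x a \<in> topspace X"
proof (cases "a \<in> site ` slots")
  case True
  then obtain P s where P: "P \<in> PP" "s \<in> part P" "a = \<tau> s (center P)" by (auto simp: slots_def site_def)
  then show ?thesis using pattern_site[OF P(1,2)] act_closed part_carrier assms by simp
next
  case False
  then show ?thesis using x0 by (simp add: pattern_def)
qed

lemma sum_shape: "(\<Sum>P\<in>PP. real (card (shape P))) \<le> 2 * d"
  using sum_card_shape_le(1)[OF PP(1) _ \<epsilon>(2,1)] by simp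

text \<open>Translation by \<open>t\<close> is injective. An element of the shape that it moves out
  of the claimed part lands either outside the shape, which \<beta> controls, or in the unclaimed
  rest, which \<epsilon> controls; the 2 comes from \<open>sum_shape\<close>.\<close>

lemma sum_defect:
  assumes t: "t \<in> carrier G" and inv: "\<And>T. T \<in> TT \<Longrightarrow> card (({t} <#> T) - T) \<le> \<beta> * card T"
  shows "(\<Sum>P\<in>PP. real (card {s \<in> shape P. t \<otimes> s \<notin> part P})) \<le> 2 * (\<beta> + \<epsilon>) * d"
proof -
  have "real (card {s \<in> shape P. t \<otimes> s \<notin> part P}) \<le> (\<beta> + \<epsilon>) * card (shape P)" if P: "P \<in> PP" for P
  proof -
    have "card {s \<in> shape P. t \<otimes> s \<notin> part P} \<le> card ((({t} <#> shape P) - shape P) \<union> (shape P - part P))"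
    proof (rule card_inj_on_le[where f = "\<lambda>s. t \<otimes> s"])
      show "inj_on (\<lambda>s. t \<otimes> s) {s \<in> shape P. t \<otimes> s \<notin> part P}"
        using t shapeD(3)[OF P] by (auto simp: inj_on_def subset_iff)
      show "(\<lambda>s. t \<otimes> s) ` {s \<in> shape P. t \<otimes> s \<notin> part P} \<subseteq> ({t} <#> shape P) - shape P \<union> (shape P - part P)"
        by (auto simp: set_mult_def)
      show "finite (({t} <#> shape P) - shape P \<union> (shape P - part P))"
        using shapeD(1)[OF P] by (intro finite_UnI finite_Diff finite_set_mult) auto
    qed
    also have "\<dots> \<le> card (({t} <#> shape P) - shape P) + card (shape P - part P)" by (rule card_Un_le)
    finally have "real (card {s \<in> shape P. t \<otimes> s \<notin> part P})
        \<le> real (card (({t} <#> shape P) - shape P)) + real (card (shape P - part P))" by simp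
    also have "real (card (shape P - part P)) = real (card (shape P)) - card (part P)"
      using shapeD(1)[OF P] PPD(3)[OF P] finite_part[OF P]
      by (simp add: card_Diff_subset of_nat_diff card_mono)
    finally show ?thesis using inv[OF PPD(1)[OF P]] PPD(4)[OF P] by (simp add: algebra_simps)
  qed
  then have "(\<Sum>P\<in>PP. real (card {s \<in> shape P. t \<otimes> s \<notin> part P})) \<le> (\<beta> + \<epsilon>) * (\<Sum>P\<in>PP. real (card (shape P)))"
    unfolding sum_distrib_left by (rule sum_mono)
  also have "\<dots> \<le> (\<beta> + \<epsilon>) * (2 * d)" using sum_shape \<epsilon> \<beta> by (intro mult_left_mono) auto
  finally show ?thesis by (simp add: algebra_simps)
qed

text \<open>If \<open>s\<close> and \<open>inv h \<otimes> s\<close> are both claimed by a tile, the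
  pattern is exactly equivariant under \<open>h\<close> at the site of \<open>s\<close>, since both
  values lie on one orbit. The remaining points have density at most
  \<open>\<epsilon> + 2 * (\<beta> + \<epsilon>)\<close>: uncovered points and tile
  boundaries.\<close>

lemma pattern_approx_hom:
  assumes x: "\<And>P. P \<in> PP \<Longrightarrow> x P \<in> topspace X" and p: "unit_ball_sequence X p"
    and F: "F \<subseteq> carrier G" "F \<subseteq> S" "\<And>h T. h \<in> F \<Longrightarrow> T \<in> TT \<Longrightarrow> T \<subseteq> S \<and> {inv h} <#> T \<subseteq> S"
    and inv: "\<And>h T. h \<in> F \<Longrightarrow> T \<in> TT \<Longrightarrow> card (({inv h} <#> T) - T) \<le> \<beta> * card T"
    and num: "sqrt (4 * (\<epsilon> + 2 * (\<beta> + \<epsilon>))) + 2 * (1/2) ^ M < \<delta>"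
  shows "point_hom X d (pattern x) \<in> approx_homs G X \<alpha> p F \<delta> d \<tau>"
proof -
  let ?\<xi> = "pattern x" and ?D = "{1..d}"
  have \<xi>: "?\<xi> \<in> ?D \<rightarrow> topspace X" by (intro funcsetI pattern_closed x)
  have "rho2 p d (point_hom X d ?\<xi> \<circ> induced_action G X \<alpha> h) (perm_action d (\<tau> h) \<circ> point_hom X d ?\<xi>) < \<delta>"
    if h: "h \<in> F" for h
  proof -
    have hG: "h \<in> carrier G" "h \<in> S" using h F by auto
    define v where "v n a = p n (\<alpha> (inv h) (?\<xi> a)) - p n (?\<xi> (inv_into UNIV (\<tau> h) a))" for n a
    define I where "I = {q \<in> slots. inv h \<otimes> snd q \<in> part (fst q)}"
    define Z where "Z = ?D - site ` I"
    have I: "I \<subseteq> slots" by (auto simp: I_def)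
    have zero: "v n a = 0" if a: "a \<in> ?D - Z" for n a
    proof -
      obtain P s where P: "P \<in> PP" "s \<in> part P" "inv h \<otimes> s \<in> part P" "a = \<tau> s (center P)"
      proof -
        obtain q where "q \<in> slots" "inv h \<otimes> snd q \<in> part (fst q)" "a = site q"
          using a unfolding Z_def I_def by blast
        moreover obtain P s where "q = (P, s)" by (cases q)
        ultimately show thesis using that[of P s] by (simp add: slots_def site_def)
      qed
      let ?u = "inv h \<otimes> s"
      have sG: "s \<in> carrier G" using part_carrier[OF P(1,2)] .
      have "?u \<in> {inv h} <#> shape P" using subsetD[OF PPD(3)[OF P(1)] P(2)] by (auto simp: set_mult_def)
      then have uS: "?u \<in> S" using F(3)[OF h PPD(1)[OF P(1)]] by blast
      have "center P \<in> goodpts G S \<tau> ?D" using C PPD(2)[OF P(1)] by blast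
      then have "\<tau> h (\<tau> ?u (center P)) = \<tau> (h \<otimes> ?u) (center P)"
        using hG(2) uS by (simp add: goodpts_def)
      also have "h \<otimes> ?u = s" using hG sG by (simp add: m_assoc[symmetric])
      finally have "inv_into UNIV (\<tau> h) a = \<tau> ?u (center P)"
        using permutes_inj[OF perm[OF hG(1)]] P(4) by (intro inv_f_eq) auto
      then have "?\<xi> (inv_into UNIV (\<tau> h) a) = \<alpha> ?u (x P)" using pattern_site[OF P(1,3)] by simp
      also have "\<dots> = \<alpha> (inv h) (\<alpha> s (x P))" using hG sG x[OF P(1)] by (simp add: act_mult)
      also have "\<alpha> s (x P) = ?\<xi> a" using pattern_site[OF P(1,2)] P(4) by simp
      finally show ?thesis by (simp add: v_def)
    qed
    have "slots \<subseteq> I \<union> (SIGMA P:PP. {s \<in> shape P. inv h \<otimes> s \<notin> part P})"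
    proof
      fix q assume "q \<in> slots"
      moreover obtain P s where "q = (P, s)" by (cases q)
      ultimately have P: "q = (P, s)" "P \<in> PP" "s \<in> part P" by (simp_all add: slots_def)
      then have "s \<in> shape P" using PPD(3) by blast
      then show "q \<in> I \<union> (SIGMA P:PP. {s \<in> shape P. inv h \<otimes> s \<notin> part P})"
        using P \<open>q \<in> slots\<close> by (simp add: I_def)
    qed
    then have "card slots \<le> card (I \<union> (SIGMA P:PP. {s \<in> shape P. inv h \<otimes> s \<notin> part P}))"
      using finite_subset[OF I finite_slots] finite_PP shapeD(1)
      by (intro card_mono finite_UnI finite_SigmaI) simp_all
    also have "\<dots> \<le> card I + card (SIGMA P:PP. {s \<in> shape P. inv h \<otimes> s \<notin> part P})" by (rule card_Un_le)
    also have "card (SIGMA P:PP. {s \<in> shape P. inv h \<otimes> s \<notin> part P}) = (\<Sum>P\<in>PP. card {s \<in> shape P. inv h \<otimes> s \<notin> part P})"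
      using finite_PP shapeD(1) by (intro card_SigmaI) auto
    finally have "real (card slots) \<le> card I + (\<Sum>P\<in>PP. real (card {s \<in> shape P. inv h \<otimes> s \<notin> part P}))"
      by (simp flip: of_nat_sum of_nat_add)
    also have "\<dots> \<le> card I + 2 * (\<beta> + \<epsilon>) * d"
      using sum_defect[of "inv h"] hG inv[OF h] by (intro add_left_mono) auto
    finally have cI: "(1 - \<epsilon> - 2 * (\<beta> + \<epsilon>)) * d \<le> card I"
      using card_slots(1) by (simp add: algebra_simps)
    have sI: "site ` I \<subseteq> ?D" using I site_range by blast
    have "card (site ` I) = card I" using inj_site I by (intro card_image) (rule inj_on_subset)
    moreover have "card Z = d - card (site ` I)"
      unfolding Z_def using sI by (subst card_Diff_subset) (auto intro: finite_subset)
    moreover have "card (site ` I) \<le> d" using card_mono[OF _ sI] by simp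
    ultimately have "real (card Z) = real d - card I" by (simp add: of_nat_diff)
    then have Zc: "real (card Z) \<le> (\<epsilon> + 2 * (\<beta> + \<epsilon>)) * d" using cI by (simp add: algebra_simps)
    have \<xi>X: "?\<xi> a \<in> topspace X" for a by (rule pattern_closed[OF x])
    have v2: "norm (v n a) \<le> 2" for n a
      unfolding v_def using hG by (intro unit_ball_diff[OF p] \<xi>X act_closed) auto
    have "rho2 p d (point_hom X d ?\<xi> \<circ> induced_action G X \<alpha> h) (perm_action d (\<tau> h) \<circ> point_hom X d ?\<xi>)
      = (\<Sum>n. (1/2) ^ Suc n * norm2 d (v n))"
      unfolding v_def by (intro rho2_equivariance point_hom_apply \<xi> hG perm p)
    also have "\<dots> \<le> sqrt (0\<^sup>2 + 2\<^sup>2 * (\<epsilon> + 2 * (\<beta> + \<epsilon>))) + 2 * (1/2) ^ M"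
      using zero by (intro weighted_norm2_le[OF d v2 _ _ Zc]) (auto simp: Z_def)
    also have "\<dots> < \<delta>" using num by simp
    finally show ?thesis .
  qed
  then show ?thesis
    using point_hom_unital[OF \<xi>] by (simp add: approx_homs_def)
qed

text \<open>Given a maximal separated set \<open>A\<close> of patterns, a pattern is encoded by an element of \<open>A\<close> close to
  it, by the small set \<open>B\<close> of points where the two differ visibly, and by the cells of \<open>\<alpha> s (x P)\<close> at
  the pairs \<open>(P, s)\<close> in \<open>Q B\<close>, where the boundary of the tile or the set \<open>B\<close> hides the orbit.\<close>

lemma card_patterns_le:
  fixes m :: nat and \<theta> r \<epsilon>0 :: real
  assumes p: "unit_ball_sequence X p"
    and Y: "\<And>T. T \<in> TT \<Longrightarrow> finite (Y T) \<and> Y T \<subseteq> topspace X"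
    and far: "\<And>T x y. T \<in> TT \<Longrightarrow> x \<in> Y T \<Longrightarrow> y \<in> Y T \<Longrightarrow> x \<noteq> y \<Longrightarrow>
      \<exists>s\<in>T. \<exists>j\<in>J. r \<le> norm (p (fst j) (\<alpha> (snd j) (\<alpha> s x)) - p (fst j) (\<alpha> (snd j) (\<alpha> s y)))"
    and J: "finite J" "J \<subseteq> {..<M} \<times> carrier G"
    and inv: "\<And>j T. j \<in> J \<Longrightarrow> T \<in> TT \<Longrightarrow> card (({snd j} <#> T) - T) \<le> \<beta> * card T"
    and q: "\<And>x. x \<in> topspace X \<Longrightarrow> q x < m"
      "\<And>x y j. x \<in> topspace X \<Longrightarrow> y \<in> topspace X \<Longrightarrow> q x = q y \<Longrightarrow> j \<in> J \<Longrightarrow>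
        norm (p (fst j) (\<alpha> (snd j) x) - p (fst j) (\<alpha> (snd j) y)) < r"
    and m: "1 \<le> m" and r: "0 < r" and \<epsilon>0: "0 < \<epsilon>0" and num: "M * (2 ^ M * \<epsilon>0 / (r / 2))\<^sup>2 \<le> \<theta>"
  shows "\<exists>A. finite A \<and> A \<subseteq> (\<lambda>x. point_hom X d (pattern x)) ` PiE PP (\<lambda>P. Y (shape P)) \<and>
    separated (rho2 p d) \<epsilon>0 A \<and>
    real (\<Prod>P\<in>PP. card (Y (shape P))) \<le> card A * (card {B \<in> Pow {1..d}. real (card B) \<le> \<theta> * d} *
       exp (card J * (2 * (\<beta> + \<epsilon>) + \<theta>) * d * ln m))"
proof -
  let ?D = "{1..d}" and ?Xi = "PiE PP (\<lambda>P. Y (shape P))" and ?h = "\<lambda>x. point_hom X d (pattern x)"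
  have finXi: "finite ?Xi" using finite_PP Y PPD(1) by (intro finite_PiE) auto
  obtain A where A: "A \<subseteq> ?h ` ?Xi" "separated (rho2 p d) \<epsilon>0 A"
    "\<forall>\<phi>\<in>?h ` ?Xi. \<exists>\<psi>\<in>A. rho2 p d \<phi> \<psi> < \<epsilon>0"
    using maximal_separated_subset[where E = "?h ` ?Xi" and \<rho> = "rho2 p d", OF finite_imageI[OF finXi] rho2_commute rho2_self \<epsilon>0]
    by (elim exE conjE)
  have finA: "finite A" using A(1) finXi finite_subset by blast
  have XiX: "x P \<in> topspace X" if "x \<in> ?Xi" "P \<in> PP" for x P
    using that Y PPD(1) by blast
  have XiY: "x P \<in> Y (shape P)" if "x \<in> ?Xi" "P \<in> PP" for x P using that by blast
  have pX: "pattern x a \<in> topspace X" if "x \<in> ?Xi" for x a by (rule pattern_closed) (rule XiX[OF that])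
  have pC: "p n \<in> C_fun X" for n using p by (simp add: unit_ball_sequence_def)
  have hv: "?h x (p n) a = p n (pattern x a)" if "a \<in> ?D" for x n a
    by (rule point_hom_apply[OF pC that])
  have "\<forall>x\<in>?Xi. \<exists>\<psi>. \<psi> \<in> A \<and> rho2 p d (?h x) \<psi> < \<epsilon>0" using A(3) by blast
  from bchoice[OF this] obtain N where N: "\<And>x. x \<in> ?Xi \<Longrightarrow> N x \<in> A \<and> rho2 p d (?h x) (N x) < \<epsilon>0" by blast
  \<comment> \<open>The threshold is \<open>r / 2\<close> because two patterns with the same
    neighbour in \<open>A\<close> are compared through this neighbour.\<close>
  define B where "B x = {a \<in> ?D. \<exists>n<M. r / 2 \<le> norm (?h x (p n) a - N x (p n) a)}" for x
  have BD: "B x \<subseteq> ?D" for x by (auto simp: B_def)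
  have Bc: "real (card (B x)) \<le> \<theta> * d" if x: "x \<in> ?Xi" for x
  proof -
    obtain y where y: "y \<in> ?Xi" "N x = ?h y" using N[OF x] A(1) by blast
    let ?v = "\<lambda>n a. ?h x (p n) a - N x (p n) a"
    have v2: "norm (?v n a) \<le> 2" if "a \<in> ?D" for n a
      unfolding y(2) hv[OF that] by (intro unit_ball_diff[OF p] pX x y)
    have e: "(\<Sum>n. (1/2) ^ Suc n * norm2 d (?v n)) < \<epsilon>0" using N[OF x] unfolding rho2_def by blast
    have "B x = (\<Union>n<M. {a \<in> ?D. r / 2 \<le> norm (?v n a)})" by (auto simp: B_def)
    then have "card (B x) \<le> (\<Sum>n<M. card {a \<in> ?D. r / 2 \<le> norm (?v n a)})"
      using card_UN_le[of "{..<M}" "\<lambda>n. {a \<in> ?D. r / 2 \<le> norm (?v n a)}"] by simp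
    then have "real (card (B x)) \<le> real (\<Sum>n<M. card {a \<in> ?D. r / 2 \<le> norm (?v n a)})" by (rule of_nat_mono)
    also have "\<dots> = (\<Sum>n<M. real (card {a \<in> ?D. r / 2 \<le> norm (?v n a)}))" by simp
    also have "\<dots> \<le> (\<Sum>n<M. (2 ^ M * \<epsilon>0 / (r / 2))\<^sup>2 * d)"
    proof (rule sum_mono)
      fix n assume "n \<in> {..<M}"
      then have "n < M" by simp
      then show "real (card {a \<in> ?D. r / 2 \<le> norm (?v n a)}) \<le> (2 ^ M * \<epsilon>0 / (r / 2))\<^sup>2 * d"
        using r by (intro weighted_norm2_card_large[where v = ?v, OF d v2 _ e]) simp_all
    qed
    also have "\<dots> = (M * (2 ^ M * \<epsilon>0 / (r / 2))\<^sup>2) * d" by simp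
    also have "\<dots> \<le> \<theta> * d" using num by (rule mult_right_mono) simp
    finally show ?thesis .
  qed
  define Q where "Q b = {(P, s). P \<in> PP \<and> s \<in> shape P \<and>
      \<not> (\<forall>j\<in>J. snd j \<otimes> s \<in> part P \<and> \<tau> (snd j \<otimes> s) (center P) \<notin> b)}" for b
  have Qsub: "Q b \<subseteq> (SIGMA P:PP. shape P)" for b by (auto simp: Q_def)
  have finQ: "finite (Q b)" for b
    using finite_PP shapeD(1) by (intro finite_subset[OF Qsub] finite_SigmaI)
  have Qc: "real (card (Q b)) \<le> card J * (2 * (\<beta> + \<epsilon>) + \<theta>) * d" if b: "b \<subseteq> ?D" "real (card b) \<le> \<theta> * d" for b
  proof -
    \<comment> \<open>A pair enters \<open>Q b\<close> through some \<open>j\<close> for one of two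
      reasons: translation by \<open>snd j\<close> leaves the claimed part (\<open>Q1\<close>,
      bounded by \<open>sum_defect\<close>), or it leads to a site in \<open>b\<close>
      (\<open>Q2\<close>, which injects into \<open>b\<close>).\<close>
    define Q1 where "Q1 j = (SIGMA P:PP. {s \<in> shape P. snd j \<otimes> s \<notin> part P})" for j :: "nat \<times> 'a"
    define Q2 where "Q2 j = {(P, s). P \<in> PP \<and> s \<in> shape P \<and> snd j \<otimes> s \<in> part P \<and> \<tau> (snd j \<otimes> s) (center P) \<in> b}" for j :: "nat \<times> 'a"
    have fb: "finite b" using b(1) finite_subset by blast
    have Q2sub: "Q2 j \<subseteq> (SIGMA P:PP. shape P)" for j by (auto simp: Q2_def)
    have fin: "finite (Q1 j)" "finite (Q2 j)" for j
      unfolding Q1_def using finite_PP shapeD(1)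
      by (auto intro!: finite_SigmaI finite_subset[OF Q2sub])
    have c1: "real (card (Q1 j)) \<le> 2 * (\<beta> + \<epsilon>) * d" if "j \<in> J" for j
    proof -
      have "card (Q1 j) = (\<Sum>P\<in>PP. card {s \<in> shape P. snd j \<otimes> s \<notin> part P})"
        unfolding Q1_def using finite_PP shapeD(1) by (intro card_SigmaI) auto
      then show ?thesis using sum_defect[of "snd j"] J(2) that inv[OF that] by auto
    qed
    have c2: "card (Q2 j) \<le> card b" if j: "j \<in> J" for j
    proof (rule card_inj_on_le[OF _ _ fb])
      let ?g = "\<lambda>(P, s). site (P, snd j \<otimes> s)"
      show "?g ` Q2 j \<subseteq> b" by (auto simp: Q2_def site_def)
      have jG: "snd j \<in> carrier G" using J(2) j by auto
      show "inj_on ?g (Q2 j)"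
      proof (rule inj_onI)
        fix u v assume uv: "u \<in> Q2 j" "v \<in> Q2 j" "?g u = ?g v"
        obtain P s where u: "u = (P, s)" by (cases u)
        obtain P' s' where v: "v = (P', s')" by (cases v)
        have m: "(P, snd j \<otimes> s) \<in> slots" "(P', snd j \<otimes> s') \<in> slots" "P \<in> PP" "P' \<in> PP" "s \<in> shape P" "s' \<in> shape P'"
          using uv(1,2) by (auto simp: u v Q2_def slots_def)
        have "(P, snd j \<otimes> s) = (P', snd j \<otimes> s')"
          using uv(3) m(1,2) unfolding u v by (intro inj_onD[OF inj_site]) simp_all
        moreover have "s \<in> carrier G" "s' \<in> carrier G" using shapeD(3) m(3-6) by blast+
        ultimately show "u = v" using jG unfolding u v by simp
      qed
    qed
    have "Q b \<subseteq> (\<Union>j\<in>J. Q1 j \<union> Q2 j)" by (auto simp: Q_def Q1_def Q2_def)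
    then have "card (Q b) \<le> card (\<Union>j\<in>J. Q1 j \<union> Q2 j)" using J(1) fin by (intro card_mono) auto
    also have "\<dots> \<le> (\<Sum>j\<in>J. card (Q1 j \<union> Q2 j))" using J(1) by (rule card_UN_le)
    also have "\<dots> \<le> (\<Sum>j\<in>J. card (Q1 j) + card (Q2 j))" by (intro sum_mono card_Un_le)
    finally have "real (card (Q b)) \<le> real (\<Sum>j\<in>J. card (Q1 j) + card (Q2 j))" by (rule of_nat_mono)
    also have "\<dots> = (\<Sum>j\<in>J. real (card (Q1 j)) + real (card (Q2 j)))" by simp
    also have "\<dots> \<le> (\<Sum>j\<in>J. 2 * (\<beta> + \<epsilon>) * d + \<theta> * d)"
    proof (intro sum_mono add_mono c1)
      fix j assume "j \<in> J"
      then have "real (card (Q2 j)) \<le> real (card b)" by (intro of_nat_mono c2)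
      then show "real (card (Q2 j)) \<le> \<theta> * d" using b(2) by linarith
    qed
    also have "\<dots> = card J * (2 * (\<beta> + \<epsilon>) + \<theta>) * d" by (simp add: algebra_simps)
    finally show ?thesis .
  qed
  define lab where "lab x = (N x, B x, \<lambda>z\<in>Q (B x). q (\<alpha> (snd z) (x (fst z))))" for x
  let ?K = "{B \<in> Pow ?D. real (card B) \<le> \<theta> * d}"
  let ?R = "A \<times> (SIGMA b:?K. PiE (Q b) (\<lambda>_. {..<m}))"
  have "inj_on lab ?Xi"
  proof (rule inj_onI)
    fix x y assume xy: "x \<in> ?Xi" "y \<in> ?Xi" "lab x = lab y"
    have Neq: "N x = N y" and Beq: "B x = B y" using xy(3) by (simp_all add: lab_def)
    have qeq: "q (\<alpha> s (x P)) = q (\<alpha> s (y P))" if "(P, s) \<in> Q (B x)" for P s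
    proof -
      have "(\<lambda>z\<in>Q (B x). q (\<alpha> (snd z) (x (fst z)))) = (\<lambda>z\<in>Q (B y). q (\<alpha> (snd z) (y (fst z))))"
        using xy(3) unfolding lab_def prod.inject by (elim conjE)
      from fun_cong[OF this, of "(P, s)"] show ?thesis using that Beq by simp
    qed
    show "x = y"
    proof (rule PiE_ext[OF xy(1,2)], rule ccontr)
      fix P assume P: "P \<in> PP" and ne: "x P \<noteq> y P"
      obtain s j where sj: "s \<in> shape P" "j \<in> J"
        "r \<le> norm (p (fst j) (\<alpha> (snd j) (\<alpha> s (x P))) - p (fst j) (\<alpha> (snd j) (\<alpha> s (y P))))"
        using far[OF PPD(1)[OF P] XiY[OF xy(1) P] XiY[OF xy(2) P] ne] by blast
      have G1: "s \<in> carrier G" "snd j \<in> carrier G" "fst j < M" using shapeD(3)[OF P] sj J(2) by auto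
      have xX: "x P \<in> topspace X" "y P \<in> topspace X" using XiX xy P by blast+
      show False
      proof (cases "(P, s) \<in> Q (B x)")
        case True
        have "norm (p (fst j) (\<alpha> (snd j) (\<alpha> s (x P))) - p (fst j) (\<alpha> (snd j) (\<alpha> s (y P)))) < r"
          using qeq[OF True] xX G1 sj(2) by (intro q(2) act_closed)
        then show False using sj(3) by linarith
      next
        case False
        \<comment> \<open>Outside \<open>Q\<close> the orbit is visible: the site of
          \<open>snd j \<otimes> s\<close> is claimed and avoids the common set \<open>B x\<close>,
          so both patterns are within \<open>r / 2\<close> of the neighbour there.\<close>
        let ?a = "\<tau> (snd j \<otimes> s) (center P)"
        have part: "snd j \<otimes> s \<in> part P" and aB: "?a \<notin> B x" using False P sj(1,2) unfolding Q_def by blast+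
        have aD: "?a \<in> ?D"
          using permutes_in_image[OF perm[of "snd j \<otimes> s"], of "center P"] G1 center_range[OF P] by blast
        have "norm (?h x (p (fst j)) ?a - N x (p (fst j)) ?a) < r / 2"
          using aB aD G1(3) unfolding B_def by force
        moreover have "norm (?h y (p (fst j)) ?a - N x (p (fst j)) ?a) < r / 2"
          using aB aD G1(3) unfolding Beq Neq unfolding B_def by force
        ultimately have "norm (?h x (p (fst j)) ?a - ?h y (p (fst j)) ?a) < r"
          using norm_triangle_ineq4[of "?h x (p (fst j)) ?a - N x (p (fst j)) ?a" "?h y (p (fst j)) ?a - N x (p (fst j)) ?a"]
          by simp
        moreover have "?h x (p (fst j)) ?a = p (fst j) (\<alpha> (snd j) (\<alpha> s (x P)))"
          using hv[OF aD] pattern_site[OF P part] act_mult G1 xX by simp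
        moreover have "?h y (p (fst j)) ?a = p (fst j) (\<alpha> (snd j) (\<alpha> s (y P)))"
          using hv[OF aD] pattern_site[OF P part] act_mult G1 xX by simp
        ultimately show False using sj(3) by simp
      qed
    qed
  qed
  moreover have "lab ` ?Xi \<subseteq> ?R"
  proof
    fix z assume "z \<in> lab ` ?Xi"
    then obtain x where x: "x \<in> ?Xi" "z = lab x" by blast
    have "(\<lambda>z\<in>Q (B x). q (\<alpha> (snd z) (x (fst z)))) \<in> PiE (Q (B x)) (\<lambda>_. {..<m})"
    proof (rule restrict_PiE_iff[THEN iffD2], intro ballI)
      fix u assume "u \<in> Q (B x)"
      then have "fst u \<in> PP" "snd u \<in> shape (fst u)" by (auto simp: Q_def)
      then show "q (\<alpha> (snd u) (x (fst u))) \<in> {..<m}"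
        using q(1) act_closed XiX[OF x(1)] shapeD(3) by blast
    qed
    then show "z \<in> ?R" using x N[OF x(1)] BD Bc[OF x(1)] by (simp add: lab_def)
  qed
  moreover have finK: "finite ?K" by simp
  moreover have finS: "finite (SIGMA b:?K. PiE (Q b) (\<lambda>_. {..<m}))"
    using finK finQ by (intro finite_SigmaI finite_PiE) auto
  ultimately have "card ?Xi \<le> card ?R"
    using finA by (intro card_inj_on_le[of lab]) auto
  also have "\<dots> = card A * card (SIGMA b:?K. PiE (Q b) (\<lambda>_. {..<m}))" by (rule card_cartesian_product)
  also have "card (SIGMA b:?K. PiE (Q b) (\<lambda>_. {..<m})) = (\<Sum>b\<in>?K. m ^ card (Q b))"
    using finK finQ by (subst card_SigmaI) (auto simp: card_PiE intro!: finite_PiE)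
  finally have "real (card ?Xi) \<le> real (card A * (\<Sum>b\<in>?K. m ^ card (Q b)))" by (rule of_nat_mono)
  also have "\<dots> = card A * (\<Sum>b\<in>?K. real m ^ card (Q b))" by simp
  also have "(\<Sum>b\<in>?K. real m ^ card (Q b)) \<le> (\<Sum>b\<in>?K. exp (card J * (2 * (\<beta> + \<epsilon>) + \<theta>) * d * ln m))"
  proof (rule sum_mono)
    fix b assume "b \<in> ?K"
    then have "real (card (Q b)) * ln m \<le> card J * (2 * (\<beta> + \<epsilon>) + \<theta>) * d * ln m"
      using Qc m by (intro mult_right_mono) auto
    then have "exp (real (card (Q b)) * ln m) \<le> exp (card J * (2 * (\<beta> + \<epsilon>) + \<theta>) * d * ln m)" by simp
    moreover have "exp (real (card (Q b)) * ln m) = real m ^ card (Q b)"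
      using m by (simp add: exp_of_nat_mult)
    ultimately show "real m ^ card (Q b) \<le> exp (card J * (2 * (\<beta> + \<epsilon>) + \<theta>) * d * ln m)" by simp
  qed
  also have "(\<Sum>b\<in>?K. exp (card J * (2 * (\<beta> + \<epsilon>) + \<theta>) * d * ln m)) = card ?K * exp (card J * (2 * (\<beta> + \<epsilon>) + \<theta>) * d * ln m)"
    by simp
  finally have "real (card ?Xi) \<le> card A * (card ?K * exp (card J * (2 * (\<beta> + \<epsilon>) + \<theta>) * d * ln m))"
    by (simp add: mult_left_mono)
  moreover have "card ?Xi = (\<Prod>P\<in>PP. card (Y (shape P)))" using finite_PP by (rule card_PiE)
  ultimately show ?thesis using A(1,2) finA by (intro exI[of _ A]) simp
qed

end

section \<open>Exponential bounds for separated sets\<close>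

lemma mult_le_of_succ_mult_eq:
  fixes n z t :: real
  assumes "(n + 1) * z = t" "0 \<le> z"
  shows "n * z \<le> t"
  using assms by (auto simp: distrib_right)

lemma divide_mult_cancel_factor:
  fixes x y k :: real
  assumes "0 < y"
  shows "x / (k * y) * y = x / k" and "y * (x / (k * y)) = x / k" and "y * (x / y) = x"
  using assms by simp_all

context amenable_action
begin

lemma join_number_exp:
  assumes U: "finite \<U>" "open_cover X \<U>" and X: "topspace X \<noteq> {}"
    and T: "finite T" "T \<noteq> {}" "T \<subseteq> carrier G"
  shows "real (join_number \<U> T) = exp (join_rate \<U> T * card T)"
  using join_number_pos[OF T U X] T by (simp add: join_rate_def card_gt_0_iff)

text \<open>There are at most \<open>exp (\<kappa> / 2 * d i)\<close> bad sets and
  \<open>exp ((l + \<kappa> / 2) * d i)\<close> choices of names on the tiles. The cover is fixed by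
  \<epsilon>, and \<open>F\<close> and \<delta> are chosen after the shapes, so that equivariance
  can be demanded for all elements of the shapes.\<close>

theorem sofic_upper_bound:
  assumes X: "topspace X \<noteq> {}" and p: "unit_ball_sequence X p" and so: "sofic_approximation G d \<sigma>"
    and h: "\<And>\<U> l. finite \<U> \<Longrightarrow> open_cover X \<U> \<Longrightarrow> (join_rate \<U> \<longlongrightarrow> l) (folner G) \<Longrightarrow> l \<le> h"
    and \<epsilon>: "0 < \<epsilon>" and \<kappa>: "0 < \<kappa>"
  shows "\<exists>F \<delta>. finite F \<and> F \<noteq> {} \<and> F \<subseteq> carrier G \<and> 0 < \<delta> \<and> (\<forall>\<^sub>F i in sequentially. 0 < d i \<and>
    (\<forall>A. finite A \<longrightarrow> A \<subseteq> approx_homs G X \<alpha> p F \<delta> (d i) (\<sigma> i) \<longrightarrow>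
      separated (rho2 p (d i)) \<epsilon> A \<longrightarrow> real (card A) \<le> exp ((h + \<kappa>) * d i)))"
proof -
  have pc: "continuous_map X euclidean (p n)" for n using p by (auto simp: unit_ball_sequence_def C_fun_def)
  obtain M where M: "(1/2) ^ M < \<epsilon> / 8" using real_arch_pow_inv[of "\<epsilon>/8" "1/2"] \<epsilon> by auto
  define r where "r = \<epsilon> / 8"
  have r: "0 < r" using \<epsilon> by (simp add: r_def)
  have "\<exists>\<U>. finite \<U> \<and> open_cover X \<U> \<and> (\<forall>V\<in>\<U>. \<forall>x\<in>V. \<forall>y\<in>V. \<forall>f\<in>p ` {..<M}. norm (f x - f y) < r)"
    using pc r by (intro fine_open_cover[OF compact]) auto
  then obtain \<U> where U: "finite \<U>" "open_cover X \<U>"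
    and fine0: "\<forall>V\<in>\<U>. \<forall>x\<in>V. \<forall>y\<in>V. \<forall>f\<in>p ` {..<M}. norm (f x - f y) < r" by (elim exE conjE)
  have fine: "norm (p n x - p n y) < r" if "V \<in> \<U>" "x \<in> V" "y \<in> V" "n < M" for V x y n
    using fine0 that by simp
  obtain l where l: "0 \<le> l" "(join_rate \<U> \<longlongrightarrow> l) (folner G)" using join_rate_tendsto[OF U X] by blast
  have lh: "l \<le> h" by (rule h[OF U l(2)])
  \<comment> \<open>The bound \<open>\<epsilon>\<^sup>2 / 128\<close> makes uncovered points
    harmless in the norm. The bound with \<kappa> gives \<open>2 * e * c \<le> \<kappa> / 4\<close>,
    so shapes of rate at most \<open>c = l + \<kappa> / 4\<close> cost at most
    \<open>l + \<kappa> / 2\<close> per point.\<close>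
  define e where "e = min (1/2) (min (\<epsilon>\<^sup>2 / 128) (\<kappa> / (8 * (l + \<kappa>))))"
  have lk: "0 < l + \<kappa>" using l(1) \<kappa> by simp
  have e: "0 < e" "e \<le> 1/2" "e \<le> \<epsilon>\<^sup>2 / 128" "e \<le> \<kappa> / (8 * (l + \<kappa>))"
  proof -
    show "0 < e" using \<epsilon> \<kappa> lk by (simp add: e_def)
    show "e \<le> 1/2" unfolding e_def by (rule min.cobounded1)
    show "e \<le> \<epsilon>\<^sup>2 / 128" unfolding e_def by (rule order.trans[OF min.cobounded2 min.cobounded1])
    show "e \<le> \<kappa> / (8 * (l + \<kappa>))" unfolding e_def by (rule order.trans[OF min.cobounded2 min.cobounded2])
  qed
  define c where "c = l + \<kappa> / 4"
  have c: "0 \<le> c" "c \<le> l + \<kappa>" using l(1) \<kappa> by (simp_all add: c_def)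
  have "e * c \<le> \<kappa> / (8 * (l + \<kappa>)) * (l + \<kappa>)"
    using e c lk \<kappa> by (intro mult_mono) auto
  also have "\<dots> = \<kappa> / 8" by (rule divide_mult_cancel_factor(1)[OF lk])
  finally have ce: "c / (1 - e) \<le> l + \<kappa> / 2"
    using div_one_minus_le[OF c(1), of e] e by (simp add: c_def)
  have "eventually (\<lambda>T. join_rate \<U> T \<le> c) (folner G)"
    using order_tendstoD(2)[OF l(2), of c] \<kappa> by (auto simp: c_def elim: eventually_mono)
  then have fr: "frequently (\<lambda>T. join_rate \<U> T \<le> c) (folner G)"
    by (rule eventually_frequently[OF folner_nonbot[OF is_group amenable]])
  obtain TT where TT: "finite TT" "\<And>T. T \<in> TT \<Longrightarrow> join_rate \<U> T \<le> c \<and> finite T \<and> T \<noteq> {} \<and> T \<subseteq> carrier G"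
    and QT: "\<And>S. finite S \<Longrightarrow> S \<subseteq> carrier G \<Longrightarrow>
      \<forall>\<^sub>F i in sequentially. 0 < d i \<and> (\<forall>s\<in>carrier G. \<sigma> i s permutes {1..d i}) \<and>
        (\<exists>PP. quasitiling (\<sigma> i) TT e (goodpts G S (\<sigma> i) {1..d i}) {1..d i} PP \<and>
          (1 - e) * d i \<le> card (covered (\<sigma> i) PP))"
    by (rule sofic_quasitiling[OF is_group so fr e(1,2)]) blast
  have TG: "finite T \<and> T \<noteq> {} \<and> T \<subseteq> carrier G" if "T \<in> TT" for T using TT(2)[OF that] by blast
  define L where "L = \<Union>TT"
  have L: "finite L" "L \<subseteq> carrier G" using TT(1) TG by (auto simp: L_def)
  have "0 < \<kappa> / 2" using \<kappa> by simp
  then obtain \<theta>0 :: real where \<theta>0: "0 < \<theta>0"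
    and small: "\<And>\<theta> (D :: nat set). \<theta> \<le> \<theta>0 \<Longrightarrow> finite D \<Longrightarrow>
      real (card {B \<in> Pow D. real (card B) \<le> \<theta> * card D}) \<le> exp (\<kappa> / 2 * card D)"
    by (rule few_small_subsets) blast
  \<comment> \<open>The bound \<open>\<theta>0\<close> keeps the number of bad sets small; the other
    one limits the density of their images under \<open>L\<close>.\<close>
  define \<theta> where "\<theta> = min \<theta>0 (\<epsilon>\<^sup>2 / (128 * (real (card L) + 1)))"
  have \<theta>: "0 < \<theta>" "\<theta> \<le> \<theta>0" "\<theta> \<le> \<epsilon>\<^sup>2 / (128 * (real (card L) + 1))"
  proof -
    show "0 < \<theta>" using \<theta>0 \<epsilon> by (simp add: \<theta>_def add_nonneg_pos)
    show "\<theta> \<le> \<theta>0" unfolding \<theta>_def by (rule min.cobounded1)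
    show "\<theta> \<le> \<epsilon>\<^sup>2 / (128 * (real (card L) + 1))" unfolding \<theta>_def by (rule min.cobounded2)
  qed
  have "card L * \<theta> \<le> (real (card L) + 1) * (\<epsilon>\<^sup>2 / (128 * (real (card L) + 1)))"
    using \<theta> by (intro mult_mono) auto
  also have "\<dots> = \<epsilon>\<^sup>2 / 128" by (rule divide_mult_cancel_factor(2)) (simp add: add_nonneg_pos)
  finally have "4 * (e + card L * \<theta>) \<le> \<epsilon>\<^sup>2 / 16" using e(3) by simp
  moreover have "(3 * r)\<^sup>2 = 9 / 64 * \<epsilon>\<^sup>2" "(\<epsilon> / 2)\<^sup>2 = \<epsilon>\<^sup>2 / 4" "0 \<le> \<epsilon>\<^sup>2"
    by (simp_all add: r_def power_divide power_mult_distrib)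
  ultimately have "(3 * r)\<^sup>2 + 4 * (e + card L * \<theta>) \<le> (\<epsilon> / 2)\<^sup>2" by linarith
  then have "sqrt ((3 * r)\<^sup>2 + 4 * (e + card L * \<theta>)) \<le> sqrt ((\<epsilon> / 2)\<^sup>2)" by (rule real_sqrt_le_mono)
  also have "\<dots> = \<epsilon> / 2" using \<epsilon> by simp
  finally have num: "sqrt ((3 * r)\<^sup>2 + 4 * (e + card L * \<theta>)) + 2 * (1/2) ^ M < \<epsilon>" using M \<epsilon> by linarith
  define S where "S = L \<union> m_inv G ` L \<union> {\<one>}"
  have S: "finite S" "S \<subseteq> carrier G" "L \<subseteq> S" "m_inv G ` L \<subseteq> S" "\<one> \<in> S"
    using L by (auto simp: S_def)
  \<comment> \<open>Inverses, because \<open>goodpts_inverse\<close> turns equivariance under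
    \<open>inv s\<close> into a statement about \<open>\<sigma> i s c\<close>; the unit makes
    \<open>F\<close> nonempty.\<close>
  define F where "F = m_inv G ` L \<union> {\<one>}"
  have F: "finite F" "F \<noteq> {}" "F \<subseteq> carrier G" using L by (auto simp: F_def)
  \<comment> \<open>Solves
    \<open>(card L * M + 1) * (2 ^ M * \<delta> / r)\<^sup>2 = \<theta>\<close>: Chebyshev's bound
    is summed over \<open>card L * M\<close> pairs, and the summand 1 keeps the denominator
    positive.\<close>
  define \<delta> where "\<delta> = r * sqrt (\<theta> / (real (card L * M) + 1)) / 2 ^ M"
  have pos1: "0 < \<theta> / (real (card L * M) + 1)" using \<theta>(1) by (simp add: add_nonneg_pos)
  have \<delta>: "0 < \<delta>" using r pos1 unfolding \<delta>_def by (intro divide_pos_pos mult_pos_pos) auto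
  have "2 ^ M * \<delta> / r = sqrt (\<theta> / (real (card L * M) + 1))" using r by (simp add: \<delta>_def)
  then have "(2 ^ M * \<delta> / r)\<^sup>2 = \<theta> / (real (card L * M) + 1)" using pos1 by simp
  then have "(real (card L * M) + 1) * (2 ^ M * \<delta> / r)\<^sup>2 = \<theta>"
    by (simp only: divide_mult_cancel_factor(3)[of "real (card L * M) + 1"] add_nonneg_pos of_nat_0_le_iff zero_less_one)
  then have num2: "real (card L * M) * (2 ^ M * \<delta> / r)\<^sup>2 \<le> \<theta>"
    by (rule mult_le_of_succ_mult_eq) simp
  from QT[OF S(1,2)] have "\<forall>\<^sub>F i in sequentially. 0 < d i \<and>
    (\<forall>A. finite A \<longrightarrow> A \<subseteq> approx_homs G X \<alpha> p F \<delta> (d i) (\<sigma> i) \<longrightarrow>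
      separated (rho2 p (d i)) \<epsilon> A \<longrightarrow> real (card A) \<le> exp ((h + \<kappa>) * d i))"
  proof eventually_elim
    case (elim i)
    let ?D = "{1..d i}" and ?C = "goodpts G S (\<sigma> i) {1..d i}"
    have dpos: "0 < d i" and perm: "\<And>s. s \<in> carrier G \<Longrightarrow> \<sigma> i s permutes ?D" using elim by auto
    obtain PP where PP: "quasitiling (\<sigma> i) TT e ?C ?D PP" "(1 - e) * d i \<le> card (covered (\<sigma> i) PP)"
      using elim by blast
    have fPP: "finite PP" and shTT: "\<And>P. P \<in> PP \<Longrightarrow> shape P \<in> TT" using PP(1) by (auto simp: quasitiling_def)
    have "real (card A) \<le> exp ((h + \<kappa>) * d i)"
      if A: "finite A" "A \<subseteq> approx_homs G X \<alpha> p F \<delta> (d i) (\<sigma> i)"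
        "separated (rho2 p (d i)) \<epsilon> A" for A
    proof -
      have bad: "real (card {a \<in> ?D. \<exists>s\<in>\<Union>TT. \<exists>n<M. r \<le> norm (p n (\<alpha> s (\<xi> a)) - p n (\<xi> (inv_into UNIV (\<sigma> i (inv s)) a)))}) \<le> \<theta> * d i"
        if \<phi>: "\<phi> \<in> A" and \<xi>: "\<xi> \<in> ?D \<rightarrow> topspace X" "\<And>f a. f \<in> C_fun X \<Longrightarrow> a \<in> ?D \<Longrightarrow> \<phi> f a = f (\<xi> a)" for \<phi> \<xi>
      proof -
        define v where "v s n a = p n (\<alpha> s (\<xi> a)) - p n (\<xi> (inv_into UNIV (\<sigma> i (inv s)) a))" for s n a
        define E where "E s n = {a \<in> ?D. r \<le> norm (v s n a)}" for s n
        have Ec: "real (card (E s n)) \<le> (2 ^ M * \<delta> / r)\<^sup>2 * d i" if s: "s \<in> L" and n: "n < M" for s n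
          unfolding E_def
        proof (rule weighted_norm2_card_large[OF dpos _ _ _ n r])
          have sG: "s \<in> carrier G" "inv s \<in> carrier G" "inv s \<in> F" using s L by (auto simp: F_def)
          show "norm (v s n a) \<le> 2" if a: "a \<in> ?D" for n a
          proof -
            have "inv_into UNIV (\<sigma> i (inv s)) a \<in> ?D"
              using permutes_in_image[OF permutes_inv[OF perm[OF sG(2)]]] a by blast
            then show ?thesis
              unfolding v_def using \<xi>(1) a sG(1) by (intro unit_ball_diff[OF p] act_closed) auto
          qed
          have "\<phi> \<in> approx_homs G X \<alpha> p F \<delta> (d i) (\<sigma> i)" using A(2) \<phi> by blast
          then have "rho2 p (d i) (\<phi> \<circ> induced_action G X \<alpha> (inv s)) (perm_action (d i) (\<sigma> i (inv s)) \<circ> \<phi>) < \<delta>"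
            using sG(3) by (simp add: approx_homs_def)
          then show "(\<Sum>n. (1/2) ^ Suc n * norm2 (d i) (v s n)) < \<delta>"
            using rho2_equivariance[where \<phi> = \<phi> and \<xi> = \<xi>, OF \<xi>(2,1) sG(2) perm[OF sG(2)] p] sG(1) unfolding v_def by simp
        qed auto
        have "{a \<in> ?D. \<exists>s\<in>\<Union>TT. \<exists>n<M. r \<le> norm (p n (\<alpha> s (\<xi> a)) - p n (\<xi> (inv_into UNIV (\<sigma> i (inv s)) a)))}
          = (\<Union>s\<in>L. \<Union>n<M. E s n)" unfolding E_def v_def L_def by blast
        moreover have "card (\<Union>s\<in>L. \<Union>n<M. E s n) \<le> (\<Sum>s\<in>L. card (\<Union>n<M. E s n))" by (rule card_UN_le[OF L(1)])
        moreover have "\<dots> \<le> (\<Sum>s\<in>L. \<Sum>n<M. card (E s n))" by (intro sum_mono card_UN_le) simp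
        ultimately have "real (card {a \<in> ?D. \<exists>s\<in>\<Union>TT. \<exists>n<M. r \<le> norm (p n (\<alpha> s (\<xi> a)) - p n (\<xi> (inv_into UNIV (\<sigma> i (inv s)) a)))})
          \<le> real (\<Sum>s\<in>L. \<Sum>n<M. card (E s n))" by (simp only: of_nat_le_iff)
        also have "\<dots> = (\<Sum>s\<in>L. \<Sum>n<M. real (card (E s n)))" by simp
        also have "\<dots> \<le> (\<Sum>s\<in>L. \<Sum>n<M. (2 ^ M * \<delta> / r)\<^sup>2 * d i)"
          using Ec by (intro sum_mono) simp
        also have "\<dots> = (real (card L * M) * (2 ^ M * \<delta> / r)\<^sup>2) * d i" by simp
        also have "\<dots> \<le> \<theta> * d i" using num2 by (rule mult_right_mono) simp
        finally show ?thesis .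
      qed
      have AH: "A \<subseteq> unital_homs X (discrete_topology ?D)" using A(2) by (auto simp: approx_homs_def)
      have "card A \<le> card {B \<in> Pow ?D. real (card B) \<le> \<theta> * d i} * (\<Prod>P\<in>PP. join_number \<U> (shape P))"
      proof (rule separated_card_le[OF dpos perm p TT(1) TG U fine PP order.refl _ _ S(5) A(1) AH _ _ r])
        show "\<Union>TT \<subseteq> S" "m_inv G ` \<Union>TT \<subseteq> S" using S(3,4) by (simp_all add: L_def)
        show "\<epsilon> \<le> rho2 p (d i) \<phi> \<psi>" if "\<phi> \<in> A" "\<psi> \<in> A" "\<phi> \<noteq> \<psi>" for \<phi> \<psi>
          using A(3) that by blast
        show "sqrt ((3 * r)\<^sup>2 + 4 * (e + card (\<Union>TT) * \<theta>)) + 2 * (1/2) ^ M < \<epsilon>"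
          using num by (simp only: L_def)
        show "real (card {a \<in> ?D. \<exists>s\<in>\<Union>TT. \<exists>n<M. r \<le> norm (p n (\<alpha> s (\<xi> a)) - p n (\<xi> (inv_into UNIV (\<sigma> i (inv s)) a)))}) \<le> \<theta> * d i"
          if "\<phi> \<in> A" "\<xi> \<in> ?D \<rightarrow> topspace X" "\<And>f a. f \<in> C_fun X \<Longrightarrow> a \<in> ?D \<Longrightarrow> \<phi> f a = f (\<xi> a)" for \<phi> \<xi>
          by (rule bad[where \<phi> = \<phi> and \<xi> = \<xi>, OF that])
      qed
      then have "real (card A) \<le> real (card {B \<in> Pow ?D. real (card B) \<le> \<theta> * d i} * (\<Prod>P\<in>PP. join_number \<U> (shape P)))"
        by (rule of_nat_mono)
      also have "\<dots> = real (card {B \<in> Pow ?D. real (card B) \<le> \<theta> * d i}) * (\<Prod>P\<in>PP. real (join_number \<U> (shape P)))"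
        by simp
      also have "\<dots> \<le> exp (\<kappa> / 2 * d i) * exp ((l + \<kappa> / 2) * d i)"
      proof (rule mult_mono)
        show "real (card {B \<in> Pow ?D. real (card B) \<le> \<theta> * d i}) \<le> exp (\<kappa> / 2 * d i)"
          using small[OF \<theta>(2), of ?D] by simp
        have "(\<Prod>P\<in>PP. real (join_number \<U> (shape P))) \<le> (\<Prod>P\<in>PP. exp (c * card (shape P)))"
        proof (rule prod_mono)
          fix P assume "P \<in> PP"
          then have "shape P \<in> TT" by (rule shTT)
          then have "join_rate \<U> (shape P) * card (shape P) \<le> c * card (shape P)"
            using TT(2) by (intro mult_right_mono) auto
          then show "0 \<le> real (join_number \<U> (shape P)) \<and> real (join_number \<U> (shape P)) \<le> exp (c * card (shape P))"
            using join_number_exp[OF U X] TG[OF \<open>shape P \<in> TT\<close>] by simp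
        qed
        also have "\<dots> = exp (c * (\<Sum>P\<in>PP. real (card (shape P))))"
          using fPP by (simp add: exp_sum sum_distrib_left)
        also have "\<dots> \<le> exp ((l + \<kappa> / 2) * d i)"
        proof -
          have "(\<Sum>P\<in>PP. real (card (shape P))) \<le> d i / (1 - e)"
            using sum_card_shape_le(2)[OF PP(1) _ e(2,1)] e(2) by (simp add: pos_le_divide_eq mult.commute)
          then have "c * (\<Sum>P\<in>PP. real (card (shape P))) \<le> c * (d i / (1 - e))"
            using c(1) by (rule mult_left_mono)
          also have "\<dots> = (c / (1 - e)) * d i" by simp
          also have "\<dots> \<le> (l + \<kappa> / 2) * d i" using ce by (rule mult_right_mono) simp
          finally show ?thesis by simp
        qed
        finally show "(\<Prod>P\<in>PP. real (join_number \<U> (shape P))) \<le> exp ((l + \<kappa> / 2) * d i)" .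
      qed (auto intro: prod_nonneg)
      also have "\<dots> = exp ((l + \<kappa>) * d i)" by (simp add: algebra_simps flip: exp_add)
      also have "\<dots> \<le> exp ((h + \<kappa>) * d i)" using lh by (simp add: mult_right_mono)
      finally show ?thesis .
    qed
    then show ?case using dpos by blast
  qed
  then show ?thesis using F \<delta> by blast
qed

text \<open>The scale \<open>\<epsilon>0\<close> precedes \<open>F\<close> and \<delta>, so
  \<open>J\<close>, the cells and \<theta> are obtained from the cover, \<open>p\<close> and
  \<kappa> alone; \<open>e\<close> and the shapes then adapt to \<open>F\<close> and \<delta>. At
  least \<open>exp ((l - \<kappa> / 4) * d i)\<close> families of orbit pieces are available, and
  the small sets and the cells cost a factor \<open>exp (\<kappa> / 4 * d i)\<close> each.\<close>

theorem sofic_lower_bound: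
  assumes X: "topspace X \<noteq> {}" "metrizable_space X" and p: "unit_ball_sequence X p"
    and dg: "dynamically_generating G X \<alpha> p" and so: "sofic_approximation G d \<sigma>"
    and U: "finite \<U>" "open_cover X \<U>" and l: "(join_rate \<U> \<longlongrightarrow> l) (folner G)" "0 \<le> l" and \<kappa>: "0 < \<kappa>"
  shows "\<exists>\<epsilon>>0. \<forall>F \<delta>. finite F \<and> F \<subseteq> carrier G \<and> 0 < \<delta> \<longrightarrow> (\<forall>\<^sub>F i in sequentially. 0 < d i \<and>
    (\<exists>A. finite A \<and> A \<subseteq> approx_homs G X \<alpha> p F \<delta> (d i) (\<sigma> i) \<and>
      separated (rho2 p (d i)) \<epsilon> A \<and> exp ((l - \<kappa>) * d i) \<le> real (card A)))"
proof -
  \<comment> \<open>Indices are pairs of a position in \<open>p\<close> and a group element, because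
    points are separated by \<open>p\<close> only along their orbits.\<close>
  define f where "f j x = p (fst j) (\<alpha> (snd j) x)" for j :: "nat \<times> 'a" and x
  have fc: "continuous_map X euclidean (f j)" if "snd j \<in> carrier G" for j
  proof -
    have "continuous_map X X (\<alpha> (snd j))" using action that by (simp add: continuous_action_def)
    moreover have "continuous_map X euclidean (p (fst j))" using p by (auto simp: unit_ball_sequence_def C_fun_def)
    ultimately have "continuous_map X euclidean (p (fst j) \<circ> \<alpha> (snd j))" by (rule continuous_map_compose)
    then show ?thesis by (simp add: f_def[abs_def] o_def)
  qed
  have "\<exists>\<Psi> r. finite \<Psi> \<and> \<Psi> \<subseteq> f ` (UNIV \<times> carrier G) \<and> 0 < r \<and>
    (\<forall>x\<in>topspace X. \<exists>V\<in>\<U>. \<forall>y\<in>topspace X. (\<forall>g\<in>\<Psi>. norm (g x - g y) < r) \<longrightarrow> y \<in> V)"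
  proof (rule Lebesgue_functions[OF compact _ _ U(2)])
    show "continuous_map X euclidean g" if "g \<in> f ` (UNIV \<times> carrier G)" for g using that fc by auto
    fix x y assume "x \<in> topspace X" "y \<in> topspace X" "x \<noteq> y"
    from dynamically_generating_separates[OF X(2) dg p this]
    obtain s n where "s \<in> carrier G" "p n (\<alpha> s x) \<noteq> p n (\<alpha> s y)" by blast
    then show "\<exists>g\<in>f ` (UNIV \<times> carrier G). g x \<noteq> g y"
      by (intro bexI[of _ "f (n, s)"] imageI) (auto simp: f_def)
  qed
  then obtain \<Psi> r where \<Psi>: "finite \<Psi>" "\<Psi> \<subseteq> f ` (UNIV \<times> carrier G)" and r: "0 < r"
    and Leb0: "\<forall>x\<in>topspace X. \<exists>V\<in>\<U>. \<forall>y\<in>topspace X. (\<forall>g\<in>\<Psi>. norm (g x - g y) < r) \<longrightarrow> y \<in> V"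
    by (elim exE conjE)
  obtain J where J: "J \<subseteq> UNIV \<times> carrier G" "finite J" "\<Psi> = f ` J"
    using finite_subset_image[OF \<Psi>] by blast
  have Leb: "\<exists>V\<in>\<U>. \<forall>y\<in>topspace X. (\<forall>j\<in>J. norm (f j x - f j y) < r) \<longrightarrow> y \<in> V" if "x \<in> topspace X" for x
    using Leb0 that unfolding J(3) ball_simps by blast
  define M where "M = Suc (Max (insert 0 (fst ` J)))"
  have JM: "J \<subseteq> {..<M} \<times> carrier G"
  proof
    fix j assume "j \<in> J"
    then have "fst j \<le> Max (insert 0 (fst ` J))" using J(2) by (intro Max_ge) auto
    then show "j \<in> {..<M} \<times> carrier G" using J(1) \<open>j \<in> J\<close> by (auto simp: M_def mem_Times_iff)
  qed
  have "\<exists>\<V>. finite \<V> \<and> open_cover X \<V> \<and> (\<forall>V\<in>\<V>. \<forall>x\<in>V. \<forall>y\<in>V. \<forall>g\<in>\<Psi>. norm (g x - g y) < r)"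
    using \<Psi> fc r by (intro fine_open_cover[OF compact]) auto
  then obtain \<V> where V: "finite \<V>" "open_cover X \<V>"
    and Vf: "\<forall>V\<in>\<V>. \<forall>x\<in>V. \<forall>y\<in>V. \<forall>g\<in>\<Psi>. norm (g x - g y) < r" by (elim exE conjE)
  obtain idx :: "'x set \<Rightarrow> nat" and k where idx: "idx ` \<V> = {i. i < k}" "inj_on idx \<V>"
    using finite_imp_inj_to_nat_seg[OF V(1)] by blast
  \<comment> \<open>The cell of a point is a chosen member of \<open>\<V>\<close>, on which the
    functions of \<open>\<Psi>\<close> vary by less than \<open>r\<close>; \<open>q\<close> numbers
    the cells. The maximum with 1 in \<open>m\<close> makes \<open>ln m\<close> nonnegative.\<close>
  define cell where "cell x = (SOME V. V \<in> \<V> \<and> x \<in> V)" for x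
  have cell: "cell x \<in> \<V>" "x \<in> cell x" if "x \<in> topspace X" for x
  proof -
    have "\<exists>V. V \<in> \<V> \<and> x \<in> V" using V(2) that unfolding open_cover_def by blast
    from someI_ex[OF this] show "cell x \<in> \<V>" "x \<in> cell x" unfolding cell_def by blast+
  qed
  define q where "q x = idx (cell x)" for x
  define m where "m = max 1 k"
  have m: "1 \<le> m" by (simp add: m_def)
  have q1: "q x < m" if "x \<in> topspace X" for x
  proof -
    have "q x \<in> idx ` \<V>" using cell(1)[OF that] by (simp add: q_def)
    then show ?thesis using idx(1) by (auto simp: m_def)
  qed
  have q2: "norm (f j x - f j y) < r"
    if xy: "x \<in> topspace X" "y \<in> topspace X" "q x = q y" "j \<in> J" for x y j
  proof -
    have "cell x = cell y" using xy(3) inj_onD[OF idx(2)] cell(1) xy(1,2) by (simp add: q_def)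
    then have "x \<in> cell x" "y \<in> cell x" "cell x \<in> \<V>" using cell xy by auto
    moreover have "f j \<in> \<Psi>" using xy(4) J(3) by blast
    ultimately show ?thesis using Vf by blast
  qed
  define c where "c = card J * ln m"
  have c: "0 \<le> c" using m by (simp add: c_def)
  have "0 < \<kappa> / 4" using \<kappa> by simp
  then obtain \<theta>0 :: real where \<theta>0: "0 < \<theta>0"
    and small: "\<And>\<theta> (D :: nat set). \<theta> \<le> \<theta>0 \<Longrightarrow> finite D \<Longrightarrow>
      real (card {B \<in> Pow D. real (card B) \<le> \<theta> * card D}) \<le> exp (\<kappa> / 4 * card D)"
    by (rule few_small_subsets) blast
  define \<theta> where "\<theta> = min \<theta>0 (\<kappa> / (8 * (c + 1)))"
  have \<theta>: "0 < \<theta>" "\<theta> \<le> \<theta>0" "\<theta> \<le> \<kappa> / (8 * (c + 1))"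
  proof -
    show "0 < \<theta>" using \<theta>0 \<kappa> c by (simp add: \<theta>_def)
    show "\<theta> \<le> \<theta>0" unfolding \<theta>_def by (rule min.cobounded1)
    show "\<theta> \<le> \<kappa> / (8 * (c + 1))" unfolding \<theta>_def by (rule min.cobounded2)
  qed
  have "c * \<theta> \<le> (c + 1) * (\<kappa> / (8 * (c + 1)))" using \<theta> c \<kappa> by (intro mult_mono) auto
  also have "\<dots> = \<kappa> / 8" using c by (intro divide_mult_cancel_factor(2)) simp
  finally have c\<theta>: "c * \<theta> \<le> \<kappa> / 8" .
  \<comment> \<open>Solves
    \<open>(M + 1) * (2 ^ M * \<epsilon>0 / (r / 2))\<^sup>2 = \<theta>\<close>, so that patterns
    closer than \<open>\<epsilon>0\<close> differ visibly only on a set of density at most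
    \<theta>.\<close>
  define \<epsilon>0 where "\<epsilon>0 = (r / 2) * sqrt (\<theta> / (real M + 1)) / 2 ^ M"
  have pos1: "0 < \<theta> / (real M + 1)" using \<theta>(1) by (simp add: add_nonneg_pos)
  have \<epsilon>0: "0 < \<epsilon>0" using r pos1 unfolding \<epsilon>0_def by (intro divide_pos_pos mult_pos_pos) auto
  have "2 ^ M * \<epsilon>0 / (r / 2) = sqrt (\<theta> / (real M + 1))" using r by (simp add: \<epsilon>0_def)
  then have "(2 ^ M * \<epsilon>0 / (r / 2))\<^sup>2 = \<theta> / (real M + 1)" using pos1 by simp
  then have "(real M + 1) * (2 ^ M * \<epsilon>0 / (r / 2))\<^sup>2 = \<theta>"
    by (simp only: divide_mult_cancel_factor(3)[of "real M + 1"] add_nonneg_pos of_nat_0_le_iff zero_less_one)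
  then have num: "M * (2 ^ M * \<epsilon>0 / (r / 2))\<^sup>2 \<le> \<theta>"
    by (rule mult_le_of_succ_mult_eq) simp
  have "\<forall>\<^sub>F i in sequentially. 0 < d i \<and> (\<exists>A. finite A \<and> A \<subseteq> approx_homs G X \<alpha> p F \<delta> (d i) (\<sigma> i) \<and>
      separated (rho2 p (d i)) \<epsilon>0 A \<and> exp ((l - \<kappa>) * d i) \<le> real (card A))"
    if F: "finite F" "F \<subseteq> carrier G" and \<delta>: "0 < \<delta>" for F \<delta>
  proof -
    obtain M' where M': "(1/2) ^ M' < \<delta> / 4" using real_arch_pow_inv[of "\<delta>/4" "1/2"] \<delta> by auto
    \<comment> \<open>After the \<open>1/2\<close> required by the tiling, the bounds give
      \<open>20 * e \<le> \<delta>\<^sup>2 / 4\<close> for equivariance,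
      \<open>4 * c * e \<le> \<kappa> / 8\<close> for the cells at tile boundaries, and
      \<open>l * e \<le> \<kappa> / 8\<close> for the uncovered part.\<close>
    define e where "e = min (1/2) (min (\<delta>\<^sup>2 / 80) (min (\<kappa> / (32 * (c + 1))) (\<kappa> / (8 * (l + 1)))))"
    have e: "0 < e" "e \<le> 1/2" "e \<le> \<delta>\<^sup>2 / 80" "e \<le> \<kappa> / (32 * (c + 1))" "e \<le> \<kappa> / (8 * (l + 1))"
    proof -
      show "0 < e" using \<delta> \<kappa> c l(2) by (simp add: e_def)
      show "e \<le> 1/2" unfolding e_def by (rule min.cobounded1)
      show "e \<le> \<delta>\<^sup>2 / 80" unfolding e_def by (rule order.trans[OF min.cobounded2 min.cobounded1])
      show "e \<le> \<kappa> / (32 * (c + 1))"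
        unfolding e_def by (rule order.trans[OF order.trans[OF min.cobounded2 min.cobounded2] min.cobounded1])
      show "e \<le> \<kappa> / (8 * (l + 1))"
        unfolding e_def by (rule order.trans[OF order.trans[OF min.cobounded2 min.cobounded2] min.cobounded2])
    qed
    have "c * e \<le> (c + 1) * (\<kappa> / (32 * (c + 1)))" using e c \<kappa> by (intro mult_mono) auto
    also have "\<dots> = \<kappa> / 32" using c by (intro divide_mult_cancel_factor(2)) simp
    finally have ce: "c * e \<le> \<kappa> / 32" .
    have "(l + 1) * e \<le> (l + 1) * (\<kappa> / (8 * (l + 1)))" using e(5) l(2) by (intro mult_left_mono) auto
    also have "\<dots> = \<kappa> / 8" using l(2) by (intro divide_mult_cancel_factor(2)) simp
    finally have "l * e + e \<le> \<kappa> / 8" by (simp add: algebra_simps)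
    then have le: "l * e \<le> \<kappa> / 8" using e(1) by linarith
    have "sqrt (4 * (e + 2 * (e + e))) \<le> sqrt ((\<delta> / 2)\<^sup>2)"
      using e(3) by (intro real_sqrt_le_mono) (simp add: power_divide)
    also have "\<dots> = \<delta> / 2" using \<delta> by simp
    finally have num2: "sqrt (4 * (e + 2 * (e + e))) + 2 * (1/2) ^ M' < \<delta>" using M' \<delta> by linarith
    \<comment> \<open>The number \<open>l - \<kappa> / 8\<close> may be negative, while lower bounds
      for sizes can only be multiplied by a nonnegative rate. Rates are nonnegative, so the maximum
      with 0 is still a lower bound for them.\<close>
    define lo where "lo = max 0 (l - \<kappa> / 8)"
    have lo: "0 \<le> lo" "l - \<kappa> / 8 \<le> lo" "lo \<le> l" using l(2) \<kappa> by (auto simp: lo_def)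
    \<comment> \<open>Invariance under \<open>inv h\<close> for \<open>h\<close> in \<open>F\<close>
      makes patterns equivariant; invariance under the group elements in \<open>J\<close> lets tile
      boundaries hide only few orbit points.\<close>
    define K where "K = m_inv G ` F \<union> snd ` J"
    have K: "finite K" "K \<subseteq> carrier G" using F J by (auto simp: K_def)
    define Q where "Q T \<longleftrightarrow> lo \<le> join_rate \<U> T \<and> card ((K <#> T) - T) \<le> e * card T" for T
    have "eventually (\<lambda>T. l - \<kappa> / 8 < join_rate \<U> T) (folner G)"
      using l(1) \<kappa> by (intro order_tendstoD(1)) auto
    then have "eventually Q (folner G)"
      using eventually_folner_invariant[OF is_group K e(1)] eventually_folner_basic[OF is_group]
    proof eventually_elim
      case (elim T)
      then have "0 \<le> join_rate \<U> T" using U X(1) by (intro join_rate_bounds) auto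
      then show ?case using elim by (simp add: Q_def lo_def)
    qed
    then have fr: "frequently Q (folner G)"
      by (rule eventually_frequently[OF folner_nonbot[OF is_group amenable]])
    obtain TT where TT: "finite TT" "\<And>T. T \<in> TT \<Longrightarrow> Q T \<and> finite T \<and> T \<noteq> {} \<and> T \<subseteq> carrier G"
      and QT: "\<And>S. finite S \<Longrightarrow> S \<subseteq> carrier G \<Longrightarrow>
        \<forall>\<^sub>F i in sequentially. 0 < d i \<and> (\<forall>s\<in>carrier G. \<sigma> i s permutes {1..d i}) \<and>
          (\<exists>PP. quasitiling (\<sigma> i) TT e (goodpts G S (\<sigma> i) {1..d i}) {1..d i} PP \<and>
            (1 - e) * d i \<le> card (covered (\<sigma> i) PP))"
      by (rule sofic_quasitiling[OF is_group so fr e(1,2)]) blast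
    have TG: "finite T \<and> T \<noteq> {} \<and> T \<subseteq> carrier G" if "T \<in> TT" for T using TT(2)[OF that] by blast
    have TK: "card (({t} <#> T) - T) \<le> e * card T" if "T \<in> TT" "t \<in> K" for T t
    proof -
      have "card (({t} <#> T) - T) \<le> card ((K <#> T) - T)"
        using K(1) TG[OF that(1)] that(2)
        by (intro card_mono finite_Diff finite_set_mult Diff_mono mono_set_mult) auto
      moreover have "card ((K <#> T) - T) \<le> e * card T" using TT(2)[OF that(1)] by (simp add: Q_def)
      ultimately show ?thesis by linarith
    qed
    define S where "S = \<Union>TT \<union> F \<union> ((m_inv G ` F) <#> \<Union>TT)"
    have TTf: "finite (\<Union>TT)" "\<Union>TT \<subseteq> carrier G" using TT(1) TG by auto
    have iF: "m_inv G ` F \<subseteq> carrier G" using F by auto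
    have S: "finite S" "S \<subseteq> carrier G" "F \<subseteq> S"
      using TTf F set_mult_closed[OF iF TTf(2)] by (auto simp: S_def intro!: finite_set_mult)
    have FT: "T \<subseteq> S \<and> {inv h} <#> T \<subseteq> S" if "h \<in> F" "T \<in> TT" for h T
    proof -
      have "{inv h} <#> T \<subseteq> (m_inv G ` F) <#> \<Union>TT" using that by (intro mono_set_mult) auto
      then show ?thesis using that(2) by (auto simp: S_def)
    qed
    have "\<forall>T\<in>TT. \<exists>Y. finite Y \<and> Y \<subseteq> topspace X \<and> card Y = join_number \<U> T \<and>
      (\<forall>x\<in>Y. \<forall>y\<in>Y. x \<noteq> y \<longrightarrow> (\<exists>s\<in>T. \<exists>j\<in>J. r \<le> norm (f j (\<alpha> s x) - f j (\<alpha> s y))))"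
      using TG Leb by (intro ballI separated_points[OF U _ _ _ r]) blast+
    from bchoice[OF this] obtain Y where Y0: "\<forall>T\<in>TT. finite (Y T) \<and> Y T \<subseteq> topspace X \<and> card (Y T) = join_number \<U> T \<and>
      (\<forall>x\<in>Y T. \<forall>y\<in>Y T. x \<noteq> y \<longrightarrow> (\<exists>s\<in>T. \<exists>j\<in>J. r \<le> norm (f j (\<alpha> s x) - f j (\<alpha> s y))))" ..
    have Y: "finite (Y T) \<and> Y T \<subseteq> topspace X" "card (Y T) = join_number \<U> T" if "T \<in> TT" for T
      using Y0 that by auto
    have far: "\<exists>s\<in>T. \<exists>j\<in>J. r \<le> norm (p (fst j) (\<alpha> (snd j) (\<alpha> s x)) - p (fst j) (\<alpha> (snd j) (\<alpha> s y)))"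
      if "T \<in> TT" "x \<in> Y T" "y \<in> Y T" "x \<noteq> y" for T x y
      using Y0 that unfolding f_def by blast
    from QT[OF S(1,2)] show ?thesis
    proof eventually_elim
      case (elim i)
      let ?D = "{1..d i}" and ?C = "goodpts G S (\<sigma> i) {1..d i}"
      have dpos: "0 < d i" and perm: "\<And>s. s \<in> carrier G \<Longrightarrow> \<sigma> i s permutes ?D" using elim by auto
      obtain PP where PP: "quasitiling (\<sigma> i) TT e ?C ?D PP" "(1 - e) * d i \<le> card (covered (\<sigma> i) PP)"
        using elim by blast
      obtain x0 where x0: "x0 \<in> topspace X" using X(1) by blast
      interpret tp: tiled_points G X \<alpha> "d i" "\<sigma> i" TT e e ?C S PP x0
        using dpos perm TT(1) TG e PP x0 by unfold_locales auto
      let ?Xi = "PiE PP (\<lambda>P. Y (shape P))"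
      have "\<exists>A. finite A \<and> A \<subseteq> (\<lambda>x. point_hom X (d i) (tp.pattern x)) ` ?Xi \<and>
        separated (rho2 p (d i)) \<epsilon>0 A \<and>
        real (\<Prod>P\<in>PP. card (Y (shape P))) \<le> card A * (card {B \<in> Pow ?D. real (card B) \<le> \<theta> * d i} *
          exp (card J * (2 * (e + e) + \<theta>) * d i * ln m))"
      proof (rule tp.card_patterns_le[where q = q and r = r and M = M])
        show "card (({snd j} <#> T) - T) \<le> e * card T" if "j \<in> J" "T \<in> TT" for j T
          using TK that by (simp add: K_def)
        show "norm (p (fst j) (\<alpha> (snd j) x) - p (fst j) (\<alpha> (snd j) y)) < r"
          if "x \<in> topspace X" "y \<in> topspace X" "q x = q y" "j \<in> J" for x y j
          using q2[OF that] by (simp add: f_def)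
      qed (fact p Y(1) far J(2) JM q1 m r \<epsilon>0 num)+
      then obtain A where A: "finite A" "A \<subseteq> (\<lambda>x. point_hom X (d i) (tp.pattern x)) ` ?Xi"
        "separated (rho2 p (d i)) \<epsilon>0 A"
        "real (\<Prod>P\<in>PP. card (Y (shape P))) \<le> card A * (card {B \<in> Pow ?D. real (card B) \<le> \<theta> * d i} *
          exp (card J * (2 * (e + e) + \<theta>) * d i * ln m))" by (elim exE conjE)
      have hom: "point_hom X (d i) (tp.pattern x) \<in> approx_homs G X \<alpha> p F \<delta> (d i) (\<sigma> i)" if x: "x \<in> ?Xi" for x
      proof (rule tp.pattern_approx_hom[OF _ p F(2) S(3) FT _ num2])
        show "x P \<in> topspace X" if "P \<in> PP" for P
          using x that Y(1)[OF tp.PPD(1)[OF that]] by blast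
        show "card (({inv h} <#> T) - T) \<le> e * card T" if "h \<in> F" "T \<in> TT" for h T
          using TK that by (simp add: K_def)
      qed
      have AH: "A \<subseteq> approx_homs G X \<alpha> p F \<delta> (d i) (\<sigma> i)" using A(2) hom by blast
      have "exp ((l - \<kappa> / 4) * d i) \<le> exp (lo * (\<Sum>P\<in>PP. real (card (shape P))))"
      proof -
        have "(\<Sum>P\<in>PP. real (card (part P))) \<le> (\<Sum>P\<in>PP. real (card (shape P)))"
          using tp.PPD(3) tp.shapeD(1) by (intro sum_mono of_nat_mono card_mono)
        then have "(1 - e) * d i \<le> (\<Sum>P\<in>PP. real (card (shape P)))"
          using PP(2) card_covered[OF PP(1)] by simp
        then have "lo * ((1 - e) * d i) \<le> lo * (\<Sum>P\<in>PP. real (card (shape P)))"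
          using lo(1) by (rule mult_left_mono)
        moreover have "l - \<kappa> / 4 \<le> lo * (1 - e)"
        proof -
          have "lo * e \<le> l * e" using lo(3) e(1) by (intro mult_right_mono) auto
          then show ?thesis using lo(2) le by (simp add: algebra_simps)
        qed
        then have "(l - \<kappa> / 4) * d i \<le> lo * (1 - e) * d i" by (rule mult_right_mono) simp
        ultimately show ?thesis by (simp add: mult.assoc)
      qed
      also have "\<dots> = (\<Prod>P\<in>PP. exp (lo * card (shape P)))"
        using tp.finite_PP by (simp add: exp_sum sum_distrib_left)
      also have "\<dots> \<le> (\<Prod>P\<in>PP. real (card (Y (shape P))))"
      proof (rule prod_mono)
        fix P assume P: "P \<in> PP"
        note T = tp.PPD(1)[OF P]
        have "lo * card (shape P) \<le> join_rate \<U> (shape P) * card (shape P)"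
          using TT(2)[OF T] by (intro mult_right_mono) (auto simp: Q_def)
        then show "0 \<le> exp (lo * card (shape P)) \<and> exp (lo * card (shape P)) \<le> real (card (Y (shape P)))"
          unfolding Y(2)[OF T] using join_number_exp[OF U X(1)] TG[OF T] by simp
      qed
      also have "\<dots> = real (\<Prod>P\<in>PP. card (Y (shape P)))" by simp
      also have "\<dots> \<le> card A * (card {B \<in> Pow ?D. real (card B) \<le> \<theta> * d i} *
          exp (card J * (2 * (e + e) + \<theta>) * d i * ln m))" by (rule A(4))
      also have "\<dots> \<le> card A * (exp (\<kappa> / 4 * d i) * exp (\<kappa> / 4 * d i))"
      proof (intro mult_left_mono mult_mono)
        show "real (card {B \<in> Pow ?D. real (card B) \<le> \<theta> * d i}) \<le> exp (\<kappa> / 4 * d i)"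
          using small[OF \<theta>(2), of ?D] by simp
        have "card J * (2 * (e + e) + \<theta>) * d i * ln m = (4 * (c * e) + c * \<theta>) * d i"
          by (simp add: c_def algebra_simps)
        also have "\<dots> \<le> \<kappa> / 4 * d i" using ce c\<theta> by (intro mult_right_mono) auto
        finally show "exp (card J * (2 * (e + e) + \<theta>) * d i * ln m) \<le> exp (\<kappa> / 4 * d i)" by simp
      qed auto
      finally have "exp ((l - \<kappa> / 4) * d i) \<le> card A * exp (\<kappa> / 2 * d i)"
        by (simp flip: exp_add)
      then have "exp ((l - \<kappa> / 4) * d i) * exp (- (\<kappa> / 2 * d i)) \<le> card A * exp (\<kappa> / 2 * d i) * exp (- (\<kappa> / 2 * d i))"
        by (rule mult_right_mono) simp
      then have "exp ((l - \<kappa> / 4) * d i - \<kappa> / 2 * d i) \<le> card A"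
        by (simp add: mult.assoc flip: exp_add)
      moreover have "(l - \<kappa>) * d i \<le> (l - \<kappa> / 4) * d i - \<kappa> / 2 * d i"
        using \<kappa> by (simp add: algebra_simps)
      ultimately have "exp ((l - \<kappa>) * d i) \<le> card A" by (meson exp_le_cancel_iff order.trans)
      then show ?case using dpos A(1,3) AH by blast
    qed
  qed
  then show ?thesis using \<epsilon>0 by (intro exI[of _ \<epsilon>0]) simp
qed

end

section \<open>Comparison of the entropies\<close>

lemma elog_separation_number_le:
  assumes d: "0 < d" and le: "\<And>A. finite A \<Longrightarrow> A \<subseteq> H \<Longrightarrow>
    separated \<rho> \<epsilon> A \<Longrightarrow> real (card A) \<le> exp (t * real d)"
  shows "elog (separation_number H \<rho> \<epsilon>) / ereal (real d) \<le> ereal t"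
proof -
  \<comment> \<open>All cardinalities lie below one integer, so the supremum in \<open>enat\<close>
    is finite and \<open>elog\<close> is a real logarithm or \<open>- \<infinity>\<close>.\<close>
  define N where "N = nat \<lfloor>exp (t * real d)\<rfloor>"
  have "separation_number H \<rho> \<epsilon> \<le> enat N"
    unfolding separation_number_def
  proof (rule SUP_least)
    fix A assume "A \<in> {A. finite A \<and> A \<subseteq> H \<and> separated \<rho> \<epsilon> A}"
    then have "real (card A) \<le> exp (t * real d)" by (intro le) auto
    then show "enat (card A) \<le> enat N" by (simp add: N_def le_nat_floor)
  qed
  then obtain k where k: "separation_number H \<rho> \<epsilon> = enat k" "k \<le> N"
    using enat_ile by (metis enat_ord_simps(1))
  show ?thesis
  proof (cases "k = 0")
    case True
    then show ?thesis using d by (simp add: k(1) elog_def)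
  next
    case False
    have "real k \<le> real N" using k(2) by simp
    also have "\<dots> \<le> exp (t * real d)" by (simp add: N_def)
    finally have "ln (real k) \<le> ln (exp (t * real d))" using False by (intro ln_mono) auto
    then have "ln (real k) \<le> t * real d" by simp
    then have "ln (real k) / real d \<le> t" using d by (simp add: pos_divide_le_eq)
    then show ?thesis using False d by (simp add: k(1) elog_def)
  qed
qed

lemma elog_separation_number_ge:
  assumes d: "0 < d" and A: "finite A" "A \<subseteq> H" "separated \<rho> \<epsilon> A"
    and ge: "exp (t * real d) \<le> real (card A)"
  shows "ereal t \<le> elog (separation_number H \<rho> \<epsilon>) / ereal (real d)"
proof -
  have le: "enat (card A) \<le> separation_number H \<rho> \<epsilon>"
    unfolding separation_number_def using A by (intro SUP_upper) auto
  have pos: "0 < real (card A)" using ge by (meson exp_gt_zero order_less_le_trans)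
  show ?thesis
  proof (cases "separation_number H \<rho> \<epsilon>")
    case (enat k)
    then have k: "card A \<le> k" using le by simp
    then have kr: "exp (t * real d) \<le> real k" using ge by linarith
    have kpos: "0 < real k" using k pos by linarith
    have "t * real d \<le> ln (real k)" using kr kpos by (simp add: ln_ge_iff)
    then have "t \<le> ln (real k) / real d" using d by (simp add: pos_le_divide_eq)
    then show ?thesis using kpos d by (simp add: enat elog_def)
  next
    case infinity
    then show ?thesis using d by (simp add: elog_def)
  qed
qed

text \<open>On an empty space the constant functions 0 and 1 coincide, so the value of a
  homomorphism at the unit would be both 0 and 1.\<close>

lemma unital_homs_empty:
  assumes X: "topspace X = {}" and Y: "topspace Y \<noteq> {}"
  shows "unital_homs X Y = {}"
proof (rule ccontr)
  assume "unital_homs X Y \<noteq> {}"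
  then obtain \<phi> where \<phi>: "\<phi> \<in> unital_homs X Y" by blast
  obtain y where y: "y \<in> topspace Y" using Y by blast
  let ?u = "\<lambda>x\<in>topspace X. 1 :: complex"
  have u: "?u \<in> C_fun X" by (rule C_fun_restrict) simp
  have 1: "\<phi> ?u y = 1" using \<phi> y unfolding unital_homs_def by blast
  have "\<phi> (\<lambda>x\<in>topspace X. 0 * ?u x) y = 0 * \<phi> ?u y" using \<phi> y u unfolding unital_homs_def by blast
  moreover have "(\<lambda>x\<in>topspace X. 0 * ?u x) = ?u" unfolding X by auto
  ultimately show False using 1 by simp
qed

context amenable_action
begin

text \<open>For empty \<open>X\<close> the empty family is a subcover of everything. All cover
  numbers are 0, and \<open>elog\<close> makes the quotient constantly
  \<open>- \<infinity>\<close>.\<close>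

lemma topological_entropy_empty:
  assumes X: "topspace X = {}"
  shows "topological_entropy G X \<alpha> = - \<infinity>"
proof -
  have N: "cover_number X \<V> = 0" for \<V>
  proof -
    have "cover_number X \<V> \<le> 0"
      unfolding cover_number_def X by (rule Least_le) (intro exI[of _ "{}"], simp)
    then show ?thesis by simp
  qed
  have ce: "cover_entropy G X \<alpha> \<U> = - \<infinity>" for \<U>
  proof -
    let ?f = "\<lambda>F. elog (enat (cover_number X (cover_join G \<alpha> \<U> F))) / ereal (real (card F))"
    have "eventually (\<lambda>F. - \<infinity> = ?f F) (folner G)"
      using eventually_folner_basic[OF is_group]
      by eventually_elim (simp add: N elog_def card_gt_0_iff)
    then have "(?f \<longlongrightarrow> - \<infinity>) (folner G)"
      by (rule Lim_transform_eventually[OF tendsto_const])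
    then show ?thesis
      unfolding cover_entropy_def invariance_limit_iff_tendsto[OF is_group]
      by (intro the_equality) (auto intro: tendsto_unique[OF folner_nonbot[OF is_group amenable]])
  qed
  have "{} \<in> {\<U>. finite \<U> \<and> open_cover X \<U>}" using X by (simp add: open_cover_def)
  then have "{\<U>. finite \<U> \<and> open_cover X \<U>} \<noteq> {}" by (metis empty_iff)
  then show ?thesis unfolding topological_entropy_def ce by (rule SUP_const)
qed

lemma sofic_entropy_of_le:
  assumes "\<And>\<epsilon>. 0 < \<epsilon> \<Longrightarrow> \<exists>F \<delta>. finite F \<and> F \<noteq> {} \<and> F \<subseteq> carrier G \<and> 0 < \<delta> \<and> (\<forall>\<^sub>F i in sequentially. 0 < d i \<and>
    (\<forall>A. finite A \<longrightarrow> A \<subseteq> approx_homs G X \<alpha> p F \<delta> (d i) (\<sigma> i) \<longrightarrow>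
      separated (rho2 p (d i)) \<epsilon> A \<longrightarrow> real (card A) \<le> exp (t * d i)))"
  shows "sofic_entropy_of G X \<alpha> d \<sigma> p \<le> ereal t"
  unfolding sofic_entropy_of_def
proof (rule SUP_least)
  fix \<epsilon> :: real assume "\<epsilon> \<in> {0<..}"
  then have "0 < \<epsilon>" by simp
  from assms[OF this] obtain F \<delta> where F: "finite F" "F \<noteq> {}" "F \<subseteq> carrier G" "0 < \<delta>"
    and ev: "\<forall>\<^sub>F i in sequentially. 0 < d i \<and>
    (\<forall>A. finite A \<longrightarrow> A \<subseteq> approx_homs G X \<alpha> p F \<delta> (d i) (\<sigma> i) \<longrightarrow>
      separated (rho2 p (d i)) \<epsilon> A \<longrightarrow> real (card A) \<le> exp (t * d i))"
    by (elim exE conjE)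
  have "\<forall>\<^sub>F i in sequentially. elog (separation_number (approx_homs G X \<alpha> p F \<delta> (d i) (\<sigma> i)) (rho2 p (d i)) \<epsilon>)
      / ereal (real (d i)) \<le> ereal t"
    using ev by eventually_elim (intro elog_separation_number_le, auto)
  then have "limsup (\<lambda>i. elog (separation_number (approx_homs G X \<alpha> p F \<delta> (d i) (\<sigma> i)) (rho2 p (d i)) \<epsilon>)
      / ereal (real (d i))) \<le> ereal t"
    by (rule Limsup_bounded)
  then show "(INF F\<in>{F. finite F \<and> F \<noteq> {} \<and> F \<subseteq> carrier G}. INF \<delta>\<in>{0<..}.
      limsup (\<lambda>i. elog (separation_number (approx_homs G X \<alpha> p F \<delta> (d i) (\<sigma> i)) (rho2 p (d i)) \<epsilon>)
      / ereal (real (d i)))) \<le> ereal t"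
    using F by (intro INF_lower2[of F] INF_lower2[of \<delta>]) auto
qed

lemma sofic_entropy_of_ge:
  assumes \<epsilon>: "0 < \<epsilon>" and ev: "\<And>F \<delta>. finite F \<Longrightarrow> F \<subseteq> carrier G \<Longrightarrow> 0 < \<delta> \<Longrightarrow> \<forall>\<^sub>F i in sequentially. 0 < d i \<and>
    (\<exists>A. finite A \<and> A \<subseteq> approx_homs G X \<alpha> p F \<delta> (d i) (\<sigma> i) \<and>
      separated (rho2 p (d i)) \<epsilon> A \<and> exp (t * d i) \<le> real (card A))"
  shows "ereal t \<le> sofic_entropy_of G X \<alpha> d \<sigma> p"
  unfolding sofic_entropy_of_def
proof (rule SUP_upper2[of \<epsilon>])
  show "\<epsilon> \<in> {0<..}" using \<epsilon> by simp
  show "ereal t \<le> (INF F\<in>{F. finite F \<and> F \<noteq> {} \<and> F \<subseteq> carrier G}. INF \<delta>\<in>{0<..}.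
      limsup (\<lambda>i. elog (separation_number (approx_homs G X \<alpha> p F \<delta> (d i) (\<sigma> i)) (rho2 p (d i)) \<epsilon>)
      / ereal (real (d i))))"
  proof (intro INF_greatest)
    fix F :: "'a set" and \<delta> :: real
    assume F: "F \<in> {F. finite F \<and> F \<noteq> {} \<and> F \<subseteq> carrier G}" and \<delta>: "\<delta> \<in> {0<..}"
    have "\<forall>\<^sub>F i in sequentially. ereal t \<le> elog (separation_number (approx_homs G X \<alpha> p F \<delta> (d i) (\<sigma> i)) (rho2 p (d i)) \<epsilon>)
      / ereal (real (d i))"
      using ev[of F \<delta>] F \<delta> by (auto elim!: eventually_mono intro!: elog_separation_number_ge)
    then show "ereal t \<le> limsup (\<lambda>i. elog (separation_number (approx_homs G X \<alpha> p F \<delta> (d i) (\<sigma> i)) (rho2 p (d i)) \<epsilon>)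
      / ereal (real (d i)))"
      by (intro le_Limsup sequentially_bot)
  qed
qed

text \<open>Eventually there are no homomorphisms, so the only separated set is empty and every real
  \<open>t\<close> is an upper bound, already for \<open>F = {\<one>}\<close> and
  \<open>\<delta> = 1\<close>.\<close>

lemma sofic_entropy_of_empty:
  assumes X: "topspace X = {}" and so: "sofic_approximation G d \<sigma>"
  shows "sofic_entropy_of G X \<alpha> d \<sigma> p = - \<infinity>"
proof (rule ereal_bot)
  fix t :: real
  have "\<forall>\<^sub>F i in sequentially. 0 < d i"
    using sofic_goodpts[OF is_group so, of "{}" 1] by (auto elim: eventually_mono)
  moreover have "approx_homs G X \<alpha> p F \<delta> (d i) (\<sigma> i) = {}" if "0 < d i" for F \<delta> i
    using unital_homs_empty[OF X, of "discrete_topology {1..d i}"] that by (simp add: approx_homs_def)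
  ultimately have ev: "\<forall>\<^sub>F i in sequentially. 0 < d i \<and>
    (\<forall>A. finite A \<longrightarrow> A \<subseteq> approx_homs G X \<alpha> p {\<one>} 1 (d i) (\<sigma> i) \<longrightarrow>
      separated (rho2 p (d i)) \<epsilon> A \<longrightarrow> real (card A) \<le> exp (t * d i))" for \<epsilon>
    by (auto elim!: eventually_mono)
  show "sofic_entropy_of G X \<alpha> d \<sigma> p \<le> ereal t"
    by (rule sofic_entropy_of_le, rule exI[of _ "{\<one>}"], rule exI[of _ 1]) (simp add: ev)
qed

theorem sofic_entropy_of_eq:
  assumes X: "topspace X \<noteq> {}" "metrizable_space X" and p: "unit_ball_sequence X p"
    and dg: "dynamically_generating G X \<alpha> p" and so: "sofic_approximation G d \<sigma>"
  shows "sofic_entropy_of G X \<alpha> d \<sigma> p = topological_entropy G X \<alpha>"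
proof (rule antisym)
  have U1: "finite {topspace X}" "open_cover X {topspace X}" by (simp_all add: open_cover_def)
  show "sofic_entropy_of G X \<alpha> d \<sigma> p \<le> topological_entropy G X \<alpha>"
  proof (cases "topological_entropy G X \<alpha>")
    case (real h)
    have h: "l \<le> h" if "finite \<U>" "open_cover X \<U>" "(join_rate \<U> \<longlongrightarrow> l) (folner G)" for \<U> l
    proof -
      have "ereal l \<le> topological_entropy G X \<alpha>"
        unfolding topological_entropy_def cover_entropy_eq[OF that(1,2) X(1) that(3), symmetric]
        using that by (intro SUP_upper) auto
      then show ?thesis by (simp add: real)
    qed
    have "sofic_entropy_of G X \<alpha> d \<sigma> p \<le> ereal (h + \<kappa>)" if \<kappa>: "0 < \<kappa>" for \<kappa>
      by (rule sofic_entropy_of_le) (rule sofic_upper_bound[OF X(1) p so h _ \<kappa>])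
    then show ?thesis unfolding real by - (rule ereal_le_epsilon2, simp)
  next
    \<comment> \<open>This case is impossible: the cover by \<open>topspace X\<close> alone has
      entropy at least 0.\<close>
    case MInf
    obtain l where l: "0 \<le> l" "(join_rate {topspace X} \<longlongrightarrow> l) (folner G)"
      using join_rate_tendsto[OF U1 X(1)] by blast
    have "ereal l \<le> topological_entropy G X \<alpha>"
      unfolding topological_entropy_def cover_entropy_eq[OF U1 X(1) l(2), symmetric]
      using U1 by (intro SUP_upper) auto
    then show ?thesis using MInf by simp
  qed simp
  show "topological_entropy G X \<alpha> \<le> sofic_entropy_of G X \<alpha> d \<sigma> p"
    unfolding topological_entropy_def
  proof (rule SUP_least)
    fix \<U> assume "\<U> \<in> {\<U>. finite \<U> \<and> open_cover X \<U>}"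
    then have U: "finite \<U>" "open_cover X \<U>" by auto
    obtain l where l: "0 \<le> l" "(join_rate \<U> \<longlongrightarrow> l) (folner G)"
      using join_rate_tendsto[OF U X(1)] by blast
    have le: "ereal (l - \<kappa>) \<le> sofic_entropy_of G X \<alpha> d \<sigma> p" if \<kappa>: "0 < \<kappa>" for \<kappa>
    proof -
      from sofic_lower_bound[OF X p dg so U l(2,1) \<kappa>] obtain \<epsilon> where \<epsilon>: "0 < \<epsilon>"
        and ev: "\<forall>F \<delta>. finite F \<and> F \<subseteq> carrier G \<and> 0 < \<delta> \<longrightarrow> (\<forall>\<^sub>F i in sequentially. 0 < d i \<and>
        (\<exists>A. finite A \<and> A \<subseteq> approx_homs G X \<alpha> p F \<delta> (d i) (\<sigma> i) \<and>
          separated (rho2 p (d i)) \<epsilon> A \<and> exp ((l - \<kappa>) * d i) \<le> real (card A)))"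
        by (elim exE conjE)
      show ?thesis by (rule sofic_entropy_of_ge[OF \<epsilon>]) (rule ev[rule_format], simp)
    qed
    have "ereal l \<le> sofic_entropy_of G X \<alpha> d \<sigma> p"
    proof (rule ereal_le_epsilon2)
      fix \<kappa> :: real assume "0 < \<kappa>"
      then show "ereal l \<le> sofic_entropy_of G X \<alpha> d \<sigma> p + ereal \<kappa>"
        using le[of \<kappa>] by (cases "sofic_entropy_of G X \<alpha> d \<sigma> p") auto
    qed
    then show "cover_entropy G X \<alpha> \<U> \<le> sofic_entropy_of G X \<alpha> d \<sigma> p"
      by (simp add: cover_entropy_eq[OF U X(1) l(2)])
  qed
qed

end

theorem theorem5p3:
  fixes G :: "('g, 'b) monoid_scheme"
    and X :: "'x topology"
    and \<alpha> :: "'g \<Rightarrow> 'x \<Rightarrow> 'x"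
    and d :: "nat \<Rightarrow> nat"
    and \<sigma> :: "nat \<Rightarrow> 'g \<Rightarrow> nat \<Rightarrow> nat"
  assumes "group G" and "countable (carrier G)" and "amenable G"
    and "compact_space X" and "metrizable_space X"
    and "continuous_action G X \<alpha>"
    and "sofic_approximation G d \<sigma>"
  shows "sofic_entropy G X \<alpha> d \<sigma> = topological_entropy G X \<alpha>"
proof -
  interpret group G by fact
  interpret amenable_action G X \<alpha> by unfold_locales fact+
  let ?P = "{p. unit_ball_sequence X p \<and> dynamically_generating G X \<alpha> p}"
  have eq: "sofic_entropy_of G X \<alpha> d \<sigma> p = topological_entropy G X \<alpha>" if "p \<in> ?P" for p
  proof (cases "topspace X = {}")
    case True
    then show ?thesis
      using sofic_entropy_of_empty[OF True assms(7)] topological_entropy_empty by simp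
  next
    case False
    then show ?thesis using that by (intro sofic_entropy_of_eq assms) auto
  qed
  obtain p where p: "unit_ball_sequence X p" "\<forall>A. C_star_subalgebra X A \<longrightarrow> range p \<subseteq> A \<longrightarrow> A = C_fun X"
    using generating_sequence_exists[OF assms(4,5)] by (elim exE conjE)
  have "dynamically_generating G X \<alpha> p"
    unfolding dynamically_generating_def
  proof (intro notI, elim exE conjE)
    fix A assume "C_star_subalgebra X A" "A \<noteq> C_fun X" "range p \<subseteq> A"
    then show False using p(2) by simp
  qed
  then have "p \<in> ?P" using p(1) by simp
  then have "sofic_entropy_of G X \<alpha> d \<sigma> ` ?P = {topological_entropy G X \<alpha>}"
    using eq by (intro equalityI subsetI) (auto simp: image_iff)
  then show ?thesis unfolding sofic_entropy_def by simp
qed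

end
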